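(* Let $V$ be a vector space of continuous functions $f:\mathbb{R}^d\to\mathbb{R}$ with linear growth such that the order-2 weak error expansion $(\mathcal{E}^V_2)$ of the context holds, and such that $V$ is characterizing for almost sure equality in the sense of the context. Let $W^{(1)},W^{(2)}$ be two standard $q$-dimensional Brownian motions defined on the same probability space $(\Omega,\mathcal{A},\mathbb{P})$ (with arbitrary joint law). For $i=1,2$ let $X^{(i)}$ be the strong solution of the SDE driven by $W^{(i)}$ with $X^{(i)}_0=x$, and let $\bar X^{(i)}$ be its Euler scheme with step $\frac{T}{in}$ built from the increments of $W^{(i)}$. Then for every $f\in V$, $$\lim_{n\to\infty}\mathrm{Var}\big(2f(\bar X^{(2)}_T)-f(\bar X^{(1)}_T)\big)=\mathrm{Var}\big(2f(X^{(2)}_T)-f(X^{(1)}_T)\big),$$ and the pair $(W^{(1)},W^{(2)})$ minimizes this asymptotic variance, among all such pairs of Brownian motions, simultaneously for every $f\in V$ if and only if $$X^{(2)}_T=X^{(1)}_T\quad \mathbb{P}\text{-a.s.}$$ In particular, the choice $W^{(2)}=W^{(1)}$ is optimal for every $f\in V$.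
   Context: Let $T>0$, $x\in\mathbb{R}^d$. Consider the SDE $$dX_t=b(t,X_t)\,dt+\sigma(t,X_t)\,dW_t,\qquad X_0=x,$$ where $b:[0,T]\times\mathbb{R}^d\to\mathbb{R}^d$ and $\sigma:[0,T]\times\mathbb{R}^d\to\mathcal{M}(d\times q)$ are continuous, Lipschitz continuous in the space variable uniformly in $t\in[0,T]$, with $b(\cdot,0)$ and $\sigma(\cdot,0)$ bounded on $[0,T]$, and $W$ is a standard $q$-dimensional Brownian motion. The Euler scheme with step $T/m$ built from the increments of $W$ is defined by $\bar X_0=x$ and, with $t_k=kT/m$, $$\bar X_{t_{k+1}}=\bar X_{t_k}+b(t_k,\bar X_{t_k})\tfrac{T}{m}+\sigma(t_k,\bar X_{t_k})(W_{t_{k+1}}-W_{t_k}),\quad k=0,\dots,m-1.$$ Expansion $(\mathcal{E}^V_2)$: for every $f\in V$ there is a real constant $c_1$, not depending on $n$, such that $\mathbb{E} f(X_T)=\mathbb{E} f(\bar X_T)+\frac{c_1}{n}+O(n^{-2})$ as $n\to\infty$, where $\bar X$ is the Euler scheme with step $T/n$. $V$ is characterizing for almost sure equality: for every pair of $\mathbb{R}^d$-valued random vectors $Y,Z$ on a common probability space, if $f(Y)=f(Z)$ a.s. for every $f\in V$, then $Y=Z$ a.s. *)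

theory Defs
  imports "HOL-Probability.Probability" "HOL-Library.Landau_Symbols"
begin

section \<open>Filtrations and Brownian motion\<close>

definition natural_filtration ::
  "'w measure \<Rightarrow> (real \<Rightarrow> 'w \<Rightarrow> 'e::topological_space) \<Rightarrow> real \<Rightarrow> 'w measure" where
  "natural_filtration M W t =
     sigma (space M) {W s -` A \<inter> space M | s A. s \<in> {0..t} \<and> A \<in> sets borel}"

definition augmented_filtration ::
  "'w measure \<Rightarrow> (real \<Rightarrow> 'w \<Rightarrow> 'e::topological_space) \<Rightarrow> real \<Rightarrow> 'w measure" where
  "augmented_filtration M W t =
     sigma (space M) (sets (natural_filtration M W t) \<union> null_sets M)"

definition standard_BM :: "'w measure \<Rightarrow> (real \<Rightarrow> 'w \<Rightarrow> real ^ 'q) \<Rightarrow> bool" where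
  "standard_BM M W \<longleftrightarrow>
     (\<forall>t\<ge>0. W t \<in> borel_measurable M) \<and>
     (AE \<omega> in M. W 0 \<omega> = 0) \<and>
     (AE \<omega> in M. continuous_on {0..} (\<lambda>t. W t \<omega>)) \<and>
     (\<forall>s t. 0 \<le> s \<and> s < t \<longrightarrow>
        prob_space.indep_set M
          (sets (natural_filtration M W s))
          {(\<lambda>\<omega>. W t \<omega> - W s \<omega>) -` A \<inter> space M | A. A \<in> sets borel} \<and>
        distributed M lborel (\<lambda>\<omega>. W t \<omega> - W s \<omega>)
          (\<lambda>y. ennreal (\<Prod>i\<in>UNIV. normal_density 0 (sqrt (t - s)) (y $ i))))"

section \<open>The Ito integral\<close>

definition to_zero_in_probability :: "'w measure \<Rightarrow> (nat \<Rightarrow> 'w \<Rightarrow> ennreal) \<Rightarrow> bool" where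
  "to_zero_in_probability M Z \<longleftrightarrow>
     (\<forall>\<epsilon>>0. (\<lambda>j. measure M {\<omega> \<in> space M. ennreal \<epsilon> < Z j \<omega>}) \<longlonglongrightarrow> 0)"

text \<open>The triple \<open>n\<close>, \<open>\<tau>\<close>, \<open>\<xi>\<close> stands for the process that equals \<open>\<xi> k\<close> on
  \<open>(\<tau> k, \<tau> (k + 1)]\<close> for \<open>k < n\<close>, and \<open>0\<close> elsewhere.\<close>

definition simple_process ::
  "(real \<Rightarrow> 'w measure) \<Rightarrow> nat \<Rightarrow> (nat \<Rightarrow> real) \<Rightarrow> (nat \<Rightarrow> 'w \<Rightarrow> real ^ 'q ^ 'd) \<Rightarrow> bool" where
  "simple_process F n \<tau> \<xi> \<longleftrightarrow>
     0 \<le> \<tau> 0 \<and> mono_on {..n} \<tau> \<and>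
     (\<forall>k<n. \<xi> k \<in> borel_measurable (F (\<tau> k)) \<and> bounded (\<xi> k ` space (F (\<tau> k))))"

definition simple_value ::
  "nat \<Rightarrow> (nat \<Rightarrow> real) \<Rightarrow> (nat \<Rightarrow> 'w \<Rightarrow> real ^ 'q ^ 'd) \<Rightarrow> real \<Rightarrow> 'w \<Rightarrow> real ^ 'q ^ 'd" where
  "simple_value n \<tau> \<xi> s \<omega> = (\<Sum>k<n. indicat_real {\<tau> k<..\<tau> (Suc k)} s *\<^sub>R \<xi> k \<omega>)"

definition simple_integral ::
  "(real \<Rightarrow> 'w \<Rightarrow> real ^ 'q) \<Rightarrow> real \<Rightarrow> nat \<Rightarrow> (nat \<Rightarrow> real) \<Rightarrow> (nat \<Rightarrow> 'w \<Rightarrow> real ^ 'q ^ 'd)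
     \<Rightarrow> 'w \<Rightarrow> real ^ 'd" where
  "simple_integral W t n \<tau> \<xi> \<omega> =
     (\<Sum>k<n. \<xi> k \<omega> *v (W (min t (\<tau> (Suc k))) \<omega> - W (min t (\<tau> k)) \<omega>))"

definition progressive ::
  "(real \<Rightarrow> 'w measure) \<Rightarrow> real \<Rightarrow> (real \<Rightarrow> 'w \<Rightarrow> 'e::topological_space) \<Rightarrow> bool" where
  "progressive F t H \<longleftrightarrow>
     (\<forall>u\<in>{0..t}. (\<lambda>(s, \<omega>). H s \<omega>) \<in> borel_measurable (restrict_space borel {0..u} \<Otimes>\<^sub>M F u))"

text \<open>\<open>I\<close> is a version of the integral of \<open>H\<close> against \<open>W\<close> over \<open>[0, t]\<close>: the limit in
  probability of the integrals of simple processes that approximate \<open>H\<close> in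
  \<open>L\<^sup>2([0, t])\<close>, in probability. It exists and is unique up to null sets when \<open>H\<close> is
  progressive with almost surely square integrable paths, and \<open>W\<close> is a Brownian motion
  relative to \<open>F\<close>.\<close>

definition has_ito_integral ::
  "'w measure \<Rightarrow> (real \<Rightarrow> 'w measure) \<Rightarrow> (real \<Rightarrow> 'w \<Rightarrow> real ^ 'q) \<Rightarrow> real \<Rightarrow>
   (real \<Rightarrow> 'w \<Rightarrow> real ^ 'q ^ 'd) \<Rightarrow> ('w \<Rightarrow> real ^ 'd) \<Rightarrow> bool" where
  "has_ito_integral M F W t H I \<longleftrightarrow>
     progressive F t H \<and> I \<in> borel_measurable M \<and>
     (\<exists>n \<tau> \<xi>. (\<forall>j::nat. simple_process F (n j) (\<tau> j) (\<xi> j)) \<and>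
        to_zero_in_probability M
          (\<lambda>j \<omega>. \<integral>\<^sup>+ s\<in>{0..t}. ennreal ((norm (simple_value (n j) (\<tau> j) (\<xi> j) s \<omega> - H s \<omega>))\<^sup>2)
                    \<partial>lborel) \<and>
        to_zero_in_probability M
          (\<lambda>j \<omega>. ennreal (norm (simple_integral W t (n j) (\<tau> j) (\<xi> j) \<omega> - I \<omega>))))"

section \<open>The SDE and its Euler scheme\<close>

definition sde_coefficients ::
  "real \<Rightarrow> (real \<Rightarrow> real ^ 'd \<Rightarrow> real ^ 'd) \<Rightarrow> (real \<Rightarrow> real ^ 'd \<Rightarrow> real ^ 'q ^ 'd) \<Rightarrow> bool" where
  "sde_coefficients T b \<sigma> \<longleftrightarrow>
     continuous_on ({0..T} \<times> UNIV) (\<lambda>(t, y). b t y) \<and>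
     continuous_on ({0..T} \<times> UNIV) (\<lambda>(t, y). \<sigma> t y) \<and>
     (\<exists>L. \<forall>t\<in>{0..T}. L-lipschitz_on UNIV (b t) \<and> L-lipschitz_on UNIV (\<sigma> t)) \<and>
     bounded ((\<lambda>t. b t 0) ` {0..T}) \<and> bounded ((\<lambda>t. \<sigma> t 0) ` {0..T})"

definition strong_solution ::
  "real \<Rightarrow> (real \<Rightarrow> real ^ 'd \<Rightarrow> real ^ 'd) \<Rightarrow> (real \<Rightarrow> real ^ 'd \<Rightarrow> real ^ 'q ^ 'd) \<Rightarrow> real ^ 'd \<Rightarrow>
   'w measure \<Rightarrow> (real \<Rightarrow> 'w \<Rightarrow> real ^ 'q) \<Rightarrow> (real \<Rightarrow> 'w \<Rightarrow> real ^ 'd) \<Rightarrow> bool" where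
  "strong_solution T b \<sigma> x M W X \<longleftrightarrow>
     (\<forall>t\<in>{0..T}. X t \<in> borel_measurable (augmented_filtration M W t)) \<and>
     (\<forall>\<omega>\<in>space M. continuous_on {0..T} (\<lambda>t. X t \<omega>)) \<and>
     (AE \<omega> in M. X 0 \<omega> = x) \<and>
     (\<forall>t\<in>{0..T}. has_ito_integral M (augmented_filtration M W) W t
        (\<lambda>s \<omega>. \<sigma> s (X s \<omega>))
        (\<lambda>\<omega>. X t \<omega> - x - (LBINT s:{0..t}. b s (X s \<omega>))))"

text \<open>\<open>euler T b \<sigma> x W m k\<close> is the value at time \<open>k T / m\<close> of the scheme with step \<open>T / m\<close>.\<close>

primrec euler ::
  "real \<Rightarrow> (real \<Rightarrow> real ^ 'd \<Rightarrow> real ^ 'd) \<Rightarrow> (real \<Rightarrow> real ^ 'd \<Rightarrow> real ^ 'q ^ 'd) \<Rightarrow> real ^ 'd \<Rightarrow>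
   (real \<Rightarrow> 'w \<Rightarrow> real ^ 'q) \<Rightarrow> nat \<Rightarrow> nat \<Rightarrow> 'w \<Rightarrow> real ^ 'd" where
  "euler T b \<sigma> x W m 0 \<omega> = x"
| "euler T b \<sigma> x W m (Suc k) \<omega> =
     (let t = real k * T / real m; t' = real (Suc k) * T / real m; y = euler T b \<sigma> x W m k \<omega>
      in y + (T / real m) *\<^sub>R b t y + \<sigma> t y *v (W t' \<omega> - W t \<omega>))"

definition euler_terminal ::
  "real \<Rightarrow> (real \<Rightarrow> real ^ 'd \<Rightarrow> real ^ 'd) \<Rightarrow> (real \<Rightarrow> real ^ 'd \<Rightarrow> real ^ 'q ^ 'd) \<Rightarrow> real ^ 'd \<Rightarrow>
   (real \<Rightarrow> 'w \<Rightarrow> real ^ 'q) \<Rightarrow> nat \<Rightarrow> 'w \<Rightarrow> real ^ 'd" where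
  "euler_terminal T b \<sigma> x W m = euler T b \<sigma> x W m m"

section \<open>Classes of test functions\<close>

definition function_subspace :: "('a \<Rightarrow> real) set \<Rightarrow> bool" where
  "function_subspace V \<longleftrightarrow>
     (\<lambda>_. 0) \<in> V \<and> (\<forall>f\<in>V. \<forall>g\<in>V. (\<lambda>y. f y + g y) \<in> V) \<and> (\<forall>c. \<forall>f\<in>V. (\<lambda>y. c * f y) \<in> V)"

definition linear_growth :: "(real ^ 'd \<Rightarrow> real) \<Rightarrow> bool" where
  "linear_growth f \<longleftrightarrow> (\<exists>C. \<forall>y. \<bar>f y\<bar> \<le> C * (1 + norm y))"

definition weak_error_expansion2 ::
  "real \<Rightarrow> (real \<Rightarrow> real ^ 'd \<Rightarrow> real ^ 'd) \<Rightarrow> (real \<Rightarrow> real ^ 'd \<Rightarrow> real ^ 'q ^ 'd) \<Rightarrow> real ^ 'd \<Rightarrow>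
   'w measure \<Rightarrow> (real \<Rightarrow> 'w \<Rightarrow> real ^ 'q) \<Rightarrow> (real \<Rightarrow> 'w \<Rightarrow> real ^ 'd) \<Rightarrow>
   (real ^ 'd \<Rightarrow> real) set \<Rightarrow> bool" where
  "weak_error_expansion2 T b \<sigma> x M W X V \<longleftrightarrow>
     (\<forall>f\<in>V. \<exists>c\<^sub>1.
        (\<lambda>n. (\<integral>\<omega>. f (X T \<omega>) \<partial>M) - ((\<integral>\<omega>. f (euler_terminal T b \<sigma> x W n \<omega>) \<partial>M) + c\<^sub>1 / real n))
          \<in> O(\<lambda>n. 1 / (real n)\<^sup>2))"

text \<open>HOL cannot quantify over sample types inside a formula. The type of pairs used here
  loses nothing: the property only depends on the joint law of \<open>(Y, Z)\<close>, and every joint law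
  is realized on this type by the coordinate maps.\<close>

definition characterizing_as_equality :: "(real ^ 'd \<Rightarrow> real) set \<Rightarrow> bool" where
  "characterizing_as_equality V \<longleftrightarrow>
     (\<forall>(N :: ((real ^ 'd) \<times> (real ^ 'd)) measure) Y Z.
        prob_space N \<and> Y \<in> borel_measurable N \<and> Z \<in> borel_measurable N \<and>
        (\<forall>f\<in>V. AE \<omega> in N. f (Y \<omega>) = f (Z \<omega>))
        \<longrightarrow> (AE \<omega> in N. Y \<omega> = Z \<omega>))"

section \<open>Asymptotic variance of the Richardson-Romberg estimator\<close>

definition richardson_variance ::
  "real \<Rightarrow> (real \<Rightarrow> real ^ 'd \<Rightarrow> real ^ 'd) \<Rightarrow> (real \<Rightarrow> real ^ 'd \<Rightarrow> real ^ 'q ^ 'd) \<Rightarrow> real ^ 'd \<Rightarrow>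
   (real ^ 'd \<Rightarrow> real) \<Rightarrow> 'w measure \<Rightarrow> (real \<Rightarrow> 'w \<Rightarrow> real ^ 'q) \<Rightarrow> (real \<Rightarrow> 'w \<Rightarrow> real ^ 'q) \<Rightarrow>
   nat \<Rightarrow> real" where
  "richardson_variance T b \<sigma> x f M W1 W2 n =
     prob_space.variance M
       (\<lambda>\<omega>. 2 * f (euler_terminal T b \<sigma> x W2 (2 * n) \<omega>) - f (euler_terminal T b \<sigma> x W1 n \<omega>))"

text \<open>For coefficients as in \<open>sde_coefficients\<close>, continuous \<open>f\<close> of linear growth and any two
  Brownian motions the limit below exists, because each Euler scheme converges in \<open>L\<^sup>2\<close>.\<close>

definition asymptotic_variance ::
  "real \<Rightarrow> (real \<Rightarrow> real ^ 'd \<Rightarrow> real ^ 'd) \<Rightarrow> (real \<Rightarrow> real ^ 'd \<Rightarrow> real ^ 'q ^ 'd) \<Rightarrow> real ^ 'd \<Rightarrow>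
   (real ^ 'd \<Rightarrow> real) \<Rightarrow> 'w measure \<Rightarrow> (real \<Rightarrow> 'w \<Rightarrow> real ^ 'q) \<Rightarrow> (real \<Rightarrow> 'w \<Rightarrow> real ^ 'q) \<Rightarrow>
   real" where
  "asymptotic_variance T b \<sigma> x f M W1 W2 = lim (richardson_variance T b \<sigma> x f M W1 W2)"

text \<open>The competing pairs live on \<open>N\<close>, which may differ from \<open>M\<close>.\<close>

definition minimizes_asymptotic_variance ::
  "real \<Rightarrow> (real \<Rightarrow> real ^ 'd \<Rightarrow> real ^ 'd) \<Rightarrow> (real \<Rightarrow> real ^ 'd \<Rightarrow> real ^ 'q ^ 'd) \<Rightarrow> real ^ 'd \<Rightarrow>
   (real ^ 'd \<Rightarrow> real) \<Rightarrow> 'w measure \<Rightarrow> (real \<Rightarrow> 'w \<Rightarrow> real ^ 'q) \<Rightarrow> (real \<Rightarrow> 'w \<Rightarrow> real ^ 'q) \<Rightarrow>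
   'v measure \<Rightarrow> bool" where
  "minimizes_asymptotic_variance T b \<sigma> x f M W1 W2 N \<longleftrightarrow>
     (\<forall>B1 B2. standard_BM N B1 \<and> standard_BM N B2 \<longrightarrow>
        asymptotic_variance T b \<sigma> x f M W1 W2 \<le> asymptotic_variance T b \<sigma> x f N B1 B2)"

end

theory Submission
  imports Defs
begin

text \<open>
  Write \<open>E\<^sub>n\<close> for the terminal value of the Euler scheme with \<open>n\<close> steps. The statement on optimal
  pairs is elementary Hilbert space geometry once \<open>f (E\<^sub>n)\<close> is known to converge to \<open>f (X T)\<close> in \<open>L\<^sup>2\<close>. For square
  integrable \<open>a\<close> and \<open>c\<close>,
  \<open>Var (2 a - c) = 2 Var a - Var c + 2 Var (a - c)\<close>
  (\<open>variance_extrapolation\<close>). Take for \<open>a\<close> the scheme with \<open>2 n\<close> steps driven by one Brownian motion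
  and for \<open>c\<close> the scheme with \<open>n\<close> steps driven by the other. The law of \<open>E\<^sub>n\<close> is the same for all
  Brownian motions (\<open>euler_law_eq\<close>), so for every pair the first two terms tend to
  \<open>2 v - v = v\<close>, where \<open>v = Var (f (X T))\<close>. The asymptotic variance is therefore at least \<open>v\<close>, and it is
  exactly \<open>v\<close> for a pair of equal Brownian motions. For the pair \<open>(W1, W2)\<close> the excess over \<open>v\<close> is
  \<open>2 Var (f (X2 T) - f (X1 T))\<close>. Both means agree, hence the excess vanishes if and only if
  \<open>f (X2 T) = f (X1 T)\<close> almost surely, and when this holds for all \<open>f\<close> in \<open>V\<close> the characterizing
  property gives \<open>X2 T = X1 T\<close>.

  The analytic work is the \<open>L\<^sup>2\<close> convergence, which has two halves.

  First, \<open>f (E\<^sub>n)\<close> is an \<open>L\<^sup>2\<close> Cauchy sequence on every probability space with a Brownian motion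
  (\<open>test_function_cauchy_L2\<close>). This has to be proved without reference to a solution, since a competing
  pair comes without one. The schemes with \<open>n\<close> and \<open>n m\<close> steps are compared on the fine grid by a discrete
  Gronwall argument (\<open>frozen_compare\<close>, \<open>euler_refinement_L2\<close>). Bounded fourth moments
  (\<open>euler_fourth_moment\<close>) make up for the fact that the coefficients are continuous in time only locally
  uniformly in space.

  Second, the limit is \<open>f (X T)\<close>. The solution is not known beforehand to be square integrable, and
  its stochastic integral is given only as a limit in probability. The comparison is therefore localized
  to the events \<open>confined R t\<close>, on which \<open>X\<close> has stayed in a ball up to time \<open>t\<close>; they decrease in time,
  so their indicators pass through the one-step estimates. An inequality of Lenglart type
  (\<open>discrete_lenglart\<close>) shows that the Riemann sums of \<open>\<sigma> s (X s)\<close> against the increments of \<open>W\<close>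
  converge in probability to the integral (\<open>ito_riemann_bound\<close>, \<open>riemann_converges\<close>). On a refinement
  of the Euler grid these sums are a discrete process of the same kind as the scheme, so \<open>frozen_compare\<close>
  applies to them as well. Letting the refinement tend to infinity before the Euler step tends to zero gives
  convergence on \<open>confined R T\<close> for every \<open>R\<close> (\<open>confined_convergence\<close>), and the Cauchy property,
  whose bounds do not involve \<open>R\<close>, removes the localization (\<open>test_function_converges_L2\<close>).
\<close>

section \<open>Elementary inequalities\<close>

lemma discrete_gronwall_step:
  fixes a r :: "nat \<Rightarrow> real"
  assumes "a 0 \<le> 0" "\<And>j. j < k \<Longrightarrow> a (Suc j) \<le> (1 + c) * a j + r j" "0 \<le> c" "\<And>j. j < k \<Longrightarrow> 0 \<le> r j"
  shows "a k \<le> exp (c * real k) * (\<Sum>j<k. r j)"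
  using assms(2,4)
proof (induction k)
  case 0 then show ?case using assms by simp
next
  case (Suc k)
  have "a (Suc k) \<le> (1 + c) * a k + r k" using Suc by simp
  also have "\<dots> \<le> exp c * (exp (c * real k) * (\<Sum>j<k. r j)) + r k"
  proof -
    have s: "0 \<le> (\<Sum>j<k. r j)" using Suc.prems by (intro sum_nonneg) auto
    have "(1 + c) * a k \<le> (1 + c) * (exp (c * real k) * (\<Sum>j<k. r j))"
      using Suc \<open>0 \<le> c\<close> by (intro mult_left_mono) auto
    also have "\<dots> \<le> exp c * (exp (c * real k) * (\<Sum>j<k. r j))"
      using s by (intro mult_right_mono) auto
    finally show ?thesis by simp
  qed
  also have "\<dots> = exp (c * real (Suc k)) * (\<Sum>j<k. r j) + r k"
    by (simp add: exp_add algebra_simps)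
  also have "\<dots> \<le> exp (c * real (Suc k)) * (\<Sum>j<k. r j) + exp (c * real (Suc k)) * r k"
    using Suc.prems(2)[of k] \<open>0 \<le> c\<close> by (intro add_left_mono) (simp add: mult_le_cancel_right1)
  finally show ?case by (simp add: algebra_simps)
qed

lemma discrete_gronwall_sum:
  fixes a :: "nat \<Rightarrow> real"
  assumes "\<And>k. k \<le> n \<Longrightarrow> a k \<le> \<alpha> + \<kappa> * (\<Sum>j<k. a j)" "0 \<le> \<kappa>" "0 \<le> \<alpha>" "k \<le> n"
  shows "a k \<le> \<alpha> * exp (\<kappa> * real k)"
proof -
  have S: "\<alpha> + \<kappa> * (\<Sum>j<k. a j) \<le> \<alpha> * (1 + \<kappa>) ^ k" if "k \<le> n" for k
    using that
  proof (induction k)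
    case (Suc k)
    have "\<alpha> + \<kappa> * (\<Sum>j<Suc k. a j) = \<alpha> + \<kappa> * (\<Sum>j<k. a j) + \<kappa> * a k" by (simp add: algebra_simps)
    also have "\<dots> \<le> \<alpha> * (1 + \<kappa>) ^ k + \<kappa> * (\<alpha> * (1 + \<kappa>) ^ k)"
      using Suc assms(1)[of k] \<open>0 \<le> \<kappa>\<close> by (intro add_mono mult_left_mono) auto
    finally show ?case by (simp add: algebra_simps)
  qed simp
  have "(1 + \<kappa>) ^ k \<le> exp \<kappa> ^ k" using assms by (intro power_mono) auto
  also have "\<dots> = exp (\<kappa> * real k)" by (simp add: exp_of_nat2_mult)
  finally have "\<alpha> * (1 + \<kappa>) ^ k \<le> \<alpha> * exp (\<kappa> * real k)" using \<open>0 \<le> \<alpha>\<close> by (intro mult_left_mono)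
  with S[OF \<open>k \<le> n\<close>] assms(1)[OF \<open>k \<le> n\<close>] show ?thesis by simp
qed

lemma mult_le_sum_squares: "x * y \<le> x\<^sup>2 + (y::real)\<^sup>2"
proof -
  have "0 \<le> (x - y)\<^sup>2 + x\<^sup>2 + y\<^sup>2" by simp
  then show ?thesis unfolding power2_diff by linarith
qed

lemma norm_add_sq: "(norm (u + v))\<^sup>2 = (norm u)\<^sup>2 + 2 * (u \<bullet> v) + (norm (v :: 'a::real_inner))\<^sup>2"
  by (simp add: dot_norm field_simps)

lemma norm_add_sq_le: "(norm (u + v))\<^sup>2 \<le> 2 * (norm u)\<^sup>2 + 2 * (norm (v :: 'a::real_normed_vector))\<^sup>2"
proof -
  have "(norm (u + v))\<^sup>2 \<le> (norm u + norm v)\<^sup>2" by (intro power_mono norm_triangle_ineq) auto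
  moreover have "0 \<le> (norm u - norm v)\<^sup>2" by simp
  ultimately show ?thesis by (simp add: power2_sum power2_diff)
qed

lemma norm_diff_sq_le: "(norm (u - v))\<^sup>2 \<le> 2 * (norm u)\<^sup>2 + 2 * (norm (v :: 'a::real_normed_vector))\<^sup>2"
  using norm_add_sq_le[of u "- v"] by simp

lemma square_integrable_diff:
  fixes u v :: "'w \<Rightarrow> 'a::{real_normed_vector, second_countable_topology}"
  assumes "integrable M (\<lambda>\<omega>. (norm (u \<omega>))\<^sup>2)" "integrable M (\<lambda>\<omega>. (norm (v \<omega>))\<^sup>2)"
    and [measurable]: "(\<lambda>\<omega>. u \<omega> - v \<omega>) \<in> borel_measurable M"
  shows "integrable M (\<lambda>\<omega>. (norm (u \<omega> - v \<omega>))\<^sup>2)"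
proof (rule Bochner_Integration.integrable_bound)
  show "integrable M (\<lambda>\<omega>. 2 * (norm (u \<omega>))\<^sup>2 + 2 * (norm (v \<omega>))\<^sup>2)" using assms by simp
  show "AE \<omega> in M. norm ((norm (u \<omega> - v \<omega>))\<^sup>2) \<le> norm (2 * (norm (u \<omega>))\<^sup>2 + 2 * (norm (v \<omega>))\<^sup>2)"
    using norm_diff_sq_le by (auto intro!: AE_I2)
qed measurable

lemma norm_add_scaleR_sq_le:
  fixes u v :: "'a::real_inner"
  assumes "0 \<le> h"
  shows "(norm (u + h *\<^sub>R v))\<^sup>2 \<le> (1 + h) * (norm u)\<^sup>2 + (h + h\<^sup>2) * (norm v)\<^sup>2"
proof -
  have "0 \<le> h * (norm (u - v))\<^sup>2" using assms by simp
  moreover have "(norm (u + h *\<^sub>R v))\<^sup>2 = (norm u)\<^sup>2 + h\<^sup>2 * (norm v)\<^sup>2 + 2 * h * (u \<bullet> v)"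
    unfolding power2_norm_eq_inner
    by (simp add: inner_add_left inner_add_right inner_commute power2_eq_square algebra_simps)
  moreover have "(norm (u - v))\<^sup>2 = (norm u)\<^sup>2 + (norm v)\<^sup>2 - 2 * (u \<bullet> v)"
    by (simp add: power2_norm_eq_inner inner_diff_left inner_diff_right inner_commute)
  ultimately show ?thesis by (simp add: algebra_simps)
qed

lemma norm_matrix_vector_mult_le:
  fixes A :: "real ^ 'q ^ 'd"
  shows "norm (A *v w) \<le> norm A * norm w"
proof -
  have "norm (A *v w) \<le> L2_set (\<lambda>i. norm w * norm (A $ i)) UNIV"
    unfolding norm_vec_def[of "A *v w"]
  proof (intro L2_set_mono)
    show "norm ((A *v w) $ i) \<le> norm w * norm (A $ i)" for i
      using Cauchy_Schwarz_ineq2[of "A $ i" w] by (simp add: matrix_vector_mul_component mult.commute)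
  qed auto
  also have "\<dots> = norm A * norm w"
    by (simp add: L2_set_right_distrib[symmetric] norm_vec_def[of A] mult.commute)
  finally show ?thesis .
qed

lemma measurable_vec_nth [measurable]:
  fixes f :: "'w \<Rightarrow> 'a::topological_space ^ 'n"
  assumes [measurable]: "f \<in> borel_measurable M"
  shows "(\<lambda>x. f x $ i) \<in> borel_measurable M"
  by (rule measurable_compose[OF assms borel_measurable_continuous_onI]) (intro continuous_intros)

lemma measurable_matrix_vector_mult [measurable]:
  fixes A :: "'w \<Rightarrow> real ^ 'q ^ 'd"
  assumes [measurable]: "A \<in> borel_measurable M" "w \<in> borel_measurable M"
  shows "(\<lambda>x. A x *v w x) \<in> borel_measurable M"
proof (rule borel_measurable_continuous_Pair[where H = "(*v)"])
  show "continuous_on UNIV (\<lambda>p :: (real ^ 'q ^ 'd) \<times> (real ^ 'q). fst p *v snd p)"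
    unfolding matrix_vector_mult_def by (intro continuous_intros)
qed fact+

lemma sum_three_sq: "(norm (u + v + w))\<^sup>2 \<le> 3 * ((norm u)\<^sup>2 + (norm v)\<^sup>2 + (norm (w :: 'a::real_normed_vector))\<^sup>2)"
proof -
  have "norm (u + v + w) \<le> norm u + norm v + norm w" using norm_triangle_ineq norm_triangle_le add_right_mono by blast
  then have "(norm (u + v + w))\<^sup>2 \<le> (norm u + norm v + norm w)\<^sup>2" by (intro power_mono) auto
  moreover have "0 \<le> (norm u - norm v)\<^sup>2 + (norm u - norm w)\<^sup>2 + (norm v - norm w)\<^sup>2" by simp
  ultimately show ?thesis by (simp add: power2_eq_square algebra_simps)
qed

lemma linear_growth_sq: "(c * (1 + r))\<^sup>2 \<le> 2 * c\<^sup>2 * (1 + (r::real)\<^sup>2)"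
proof -
  have "0 \<le> (1 - r)\<^sup>2" by simp
  then have "(1 + r)\<^sup>2 \<le> 2 * (1 + r\<^sup>2)" unfolding power2_diff power2_sum by simp
  from mult_left_mono[OF this, of "c\<^sup>2"] show ?thesis
    unfolding power_mult_distrib by (simp add: algebra_simps)
qed

lemma le_own_square: "1 + (r::real)\<^sup>2 \<le> (1 + r\<^sup>2)\<^sup>2"
  using mult_left_mono[of 1 "1 + r\<^sup>2" "1 + r\<^sup>2"] by (simp add: power2_eq_square)

text \<open>On a large ball uniform continuity applies. Outside of it the square of a function of linear growth
  is a small multiple of the fourth power of the norm, which the fourth moments of the scheme control.\<close>

lemma uniform_modulus:
  fixes g :: "real \<Rightarrow> 'a::euclidean_space \<Rightarrow> 'b::real_normed_vector"
  assumes g: "continuous_on ({0..T} \<times> UNIV) (\<lambda>(t, y). g t y)" and "0 < K"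
    and growth: "\<And>t y. t \<in> {0..T} \<Longrightarrow> norm (g t y) \<le> K * (1 + norm y)" and "0 < \<epsilon>"
  obtains \<delta> where "0 < \<delta>"
    "\<And>s t y. s \<in> {0..T} \<Longrightarrow> t \<in> {0..T} \<Longrightarrow> \<bar>s - t\<bar> < \<delta> \<Longrightarrow> (norm (g s y - g t y))\<^sup>2 \<le> \<epsilon> * (1 + (norm y)\<^sup>2)\<^sup>2"
proof -
  define R where "R = 8 * K\<^sup>2 / \<epsilon>"
  have R: "0 < R" using assms by (simp add: R_def)
  let ?C = "{0..T} \<times> cball (0::'a) R"
  have "uniformly_continuous_on ?C (\<lambda>(t, y). g t y)"
    by (intro compact_uniformly_continuous continuous_on_subset[OF g] compact_Times) auto
  then obtain \<delta> where \<delta>: "0 < \<delta>" "\<And>p p'. p \<in> ?C \<Longrightarrow> p' \<in> ?C \<Longrightarrow> dist p' p < \<delta> \<Longrightarrow>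
      dist ((\<lambda>(t, y). g t y) p') ((\<lambda>(t, y). g t y) p) < sqrt \<epsilon>"
    unfolding uniformly_continuous_on_def using \<open>0 < \<epsilon>\<close> by (metis real_sqrt_gt_zero)
  show ?thesis
  proof (rule that[OF \<delta>(1)])
    fix s t and y :: 'a assume st: "s \<in> {0..T}" "t \<in> {0..T}" "\<bar>s - t\<bar> < \<delta>"
    let ?a = "1 + (norm y)\<^sup>2"
    show "(norm (g s y - g t y))\<^sup>2 \<le> \<epsilon> * ?a\<^sup>2"
    proof (cases "norm y \<le> R")
      case True
      have "norm (g s y - g t y) < sqrt \<epsilon>"
        using \<delta>(2)[of "(t, y)" "(s, y)"] st True by (simp add: dist_norm norm_Pair)
      then have "(norm (g s y - g t y))\<^sup>2 \<le> (sqrt \<epsilon>)\<^sup>2" by (intro power_mono) auto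
      also have "\<dots> \<le> \<epsilon> * ?a\<^sup>2" using \<open>0 < \<epsilon>\<close> by (simp add: mult_le_cancel_left1)
      finally show ?thesis .
    next
      case False
      have "(norm (g s y - g t y))\<^sup>2 \<le> 2 * (norm (g s y))\<^sup>2 + 2 * (norm (g t y))\<^sup>2" by (rule norm_diff_sq_le)
      also have "\<dots> \<le> 2 * (K * (1 + norm y))\<^sup>2 + 2 * (K * (1 + norm y))\<^sup>2"
        using growth st by (intro add_mono mult_left_mono power_mono) auto
      also have "\<dots> \<le> 8 * K\<^sup>2 * ?a"
        using linear_growth_sq[of K "norm y"] by simp
      also have "8 * K\<^sup>2 = \<epsilon> * R" using \<open>0 < \<epsilon>\<close> by (simp add: R_def)
      also have "\<epsilon> * R * ?a \<le> \<epsilon> * ?a * ?a"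
      proof -
        have "2 * norm y \<le> 1 + (norm y)\<^sup>2" using sum_squares_bound[of 1 "norm y"] by simp
        then have "R \<le> ?a" using False norm_ge_zero[of y] by linarith
        then show ?thesis using \<open>0 < \<epsilon>\<close> by (intro mult_right_mono mult_left_mono) auto
      qed
      finally show ?thesis by (simp add: power2_eq_square mult.assoc)
    qed
  qed
qed

text \<open>For random vectors with bounded fourth moments this turns closeness in \<open>L\<^sup>2\<close> into closeness in \<open>L\<^sup>2\<close>
  of their images under \<open>f\<close>. The two cases of the proof are the same as above: both points
  in a large ball, or one of them outside.\<close>

lemma continuous_quadratic_domination:
  fixes f :: "real ^ 'd \<Rightarrow> real"
  assumes f: "continuous_on UNIV f" "linear_growth f" and "0 < \<epsilon>"
  obtains L where "0 \<le> L" 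
    "\<And>y z. (f y - f z)\<^sup>2 \<le> \<epsilon> * ((1 + (norm y)\<^sup>2)\<^sup>2 + (1 + (norm z)\<^sup>2)\<^sup>2) + L * (norm (y - z))\<^sup>2"
proof -
  obtain C0 where C0: "\<And>y. \<bar>f y\<bar> \<le> C0 * (1 + norm y)" using f(2) by (auto simp: linear_growth_def)
  define C where "C = \<bar>C0\<bar>"
  let ?a = "\<lambda>y :: real ^ 'd. 1 + (norm y)\<^sup>2"
  have fsq: "(f y)\<^sup>2 \<le> 2 * C\<^sup>2 * ?a y" for y
  proof -
    have "C0 * (1 + norm y) \<le> C * (1 + norm y)" unfolding C_def by (intro mult_right_mono) auto
    then have "(f y)\<^sup>2 \<le> (C * (1 + norm y))\<^sup>2" using C0[of y] by (intro power2_le_iff_abs_le[THEN iffD2]) (auto simp: C_def)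
    also have "\<dots> \<le> 2 * C\<^sup>2 * ?a y"
      by (rule linear_growth_sq)
    finally show ?thesis .
  qed
  have diff: "(f y - f z)\<^sup>2 \<le> 4 * C\<^sup>2 * (?a y + ?a z)" for y z
    using norm_diff_sq_le[of "f y" "f z"] fsq[of y] fsq[of z] by (simp add: algebra_simps)
  define \<rho> where "\<rho> = 8 * C\<^sup>2 / \<epsilon> + 1"
  have \<rho>: "1 \<le> \<rho>" "8 * C\<^sup>2 \<le> \<epsilon> * \<rho>" using \<open>0 < \<epsilon>\<close> by (simp_all add: \<rho>_def field_simps)
  have "uniformly_continuous_on (cball 0 (sqrt \<rho>)) f"
    by (intro compact_uniformly_continuous continuous_on_subset[OF f(1)]) auto
  then obtain \<delta> where \<delta>: "0 < \<delta>" "\<And>y z. y \<in> cball 0 (sqrt \<rho>) \<Longrightarrow> z \<in> cball 0 (sqrt \<rho>) \<Longrightarrow> dist y z < \<delta> \<Longrightarrow>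
      dist (f y) (f z) < sqrt \<epsilon>"
    unfolding uniformly_continuous_on_def using \<open>0 < \<epsilon>\<close> by (metis real_sqrt_gt_zero)
  define L where "L = 8 * C\<^sup>2 * \<rho> / \<delta>\<^sup>2"
  show ?thesis
  proof (rule that[of L])
    show L0: "0 \<le> L" using \<rho> by (simp add: L_def)
    fix y z :: "real ^ 'd"
    have big: "4 * C\<^sup>2 * (a + c) \<le> \<epsilon> * (a\<^sup>2 + c\<^sup>2)" if "\<rho> \<le> a" "c \<le> a" "0 \<le> c" for a c
    proof -
      have "4 * C\<^sup>2 * (a + c) \<le> 4 * C\<^sup>2 * (2 * a)" using that by (intro mult_left_mono) auto
      also have "\<dots> = 8 * C\<^sup>2 * a" by simp
      also have "\<dots> \<le> (\<epsilon> * \<rho>) * a" using \<rho> that by (intro mult_right_mono) auto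
      also have "\<dots> \<le> (\<epsilon> * a) * a" using \<rho> that \<open>0 < \<epsilon>\<close> by (intro mult_right_mono mult_left_mono) auto
      also have "\<dots> \<le> \<epsilon> * (a\<^sup>2 + c\<^sup>2)" using \<open>0 < \<epsilon>\<close> by (simp add: power2_eq_square algebra_simps)
      finally show ?thesis .
    qed
    have "0 \<le> L * (norm (y - z))\<^sup>2" using L0 by simp
    moreover have "0 \<le> \<epsilon> * ((?a y)\<^sup>2 + (?a z)\<^sup>2)" using \<open>0 < \<epsilon>\<close> by simp
    moreover consider "\<rho> \<le> ?a y" "?a z \<le> ?a y" | "\<rho> \<le> ?a z" "?a y \<le> ?a z" | "?a y < \<rho>" "?a z < \<rho>" by linarith
    then have "(f y - f z)\<^sup>2 \<le> \<epsilon> * ((?a y)\<^sup>2 + (?a z)\<^sup>2) \<or> (f y - f z)\<^sup>2 \<le> L * (norm (y - z))\<^sup>2"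
    proof cases
      case 1 then show ?thesis using big[of "?a y" "?a z"] diff[of y z] by auto
    next
      case 2 then show ?thesis using big[of "?a z" "?a y"] diff[of y z] by (auto simp: add.commute)
    next
      case 3
      then have yz: "y \<in> cball 0 (sqrt \<rho>)" "z \<in> cball 0 (sqrt \<rho>)"
        by (auto intro!: real_le_rsqrt)
      show ?thesis
      proof (cases "norm (y - z) < \<delta>")
        case True
        then have "\<bar>f y - f z\<bar> < sqrt \<epsilon>" using \<delta>(2)[OF yz] by (simp add: dist_norm)
        then have "(f y - f z)\<^sup>2 \<le> \<epsilon>" using \<open>0 < \<epsilon>\<close>
          by (metis abs_ge_zero less_imp_le power2_abs power_mono real_sqrt_pow2)
        also have "\<epsilon> * 1 \<le> \<epsilon> * ((?a y)\<^sup>2 + (?a z)\<^sup>2)"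
        proof (intro mult_left_mono)
          have "1 \<le> (?a y)\<^sup>2" by (intro one_le_power) simp
          then show "1 \<le> (?a y)\<^sup>2 + (?a z)\<^sup>2" by (smt (verit) zero_le_power2)
        qed (use \<open>0 < \<epsilon>\<close> in auto)
        finally show ?thesis by simp
      next
        case False
        have "(f y - f z)\<^sup>2 \<le> 4 * C\<^sup>2 * (?a y + ?a z)" by (rule diff)
        also have "\<dots> \<le> 4 * C\<^sup>2 * (2 * \<rho>)" using 3 by (intro mult_left_mono) auto
        also have "\<dots> = L * \<delta>\<^sup>2" using \<open>0 < \<delta>\<close> by (simp add: L_def)
        also have "\<dots> \<le> L * (norm (y - z))\<^sup>2" using False \<open>0 < \<delta>\<close> L0 by (intro mult_left_mono power_mono) auto
        finally show ?thesis by simp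
      qed
    qed
    ultimately show "(f y - f z)\<^sup>2 \<le> \<epsilon> * ((?a y)\<^sup>2 + (?a z)\<^sup>2) + L * (norm (y - z))\<^sup>2" by linarith
  qed
qed

section \<open>Gaussian increments\<close>

text \<open>Lebesgue measure on a Euclidean space is the image of a product of one-dimensional Lebesgue measures under
  the basis expansion, so this is the corresponding statement for product measures.\<close>

lemma lborel_vec_integral_prod:
  fixes g :: "'q::finite \<Rightarrow> real \<Rightarrow> real"
  assumes g: "\<And>i. integrable lborel (g i)"
  shows "integrable (lborel :: (real ^ 'q) measure) (\<lambda>y. \<Prod>i\<in>UNIV. g i (y $ i))"
    and "(\<integral>y. (\<Prod>i\<in>UNIV. g i ((y :: real ^ 'q) $ i)) \<partial>lborel) = (\<Prod>i\<in>UNIV. integral\<^sup>L lborel (g i))"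
proof -
  interpret product_sigma_finite "\<lambda>_ :: real ^ 'q. lborel :: real measure" by standard
  have [measurable]: "g i \<in> borel_measurable borel" for i using borel_measurable_integrable[OF g[of i]] by simp
  let ?E = "\<lambda>i. axis i (1::real) :: real ^ 'q"
  have B: "(Basis :: (real ^ 'q) set) = range ?E"
    by (auto simp: Basis_vec_def)
  have inj: "inj ?E" by (auto simp: inj_on_def axis_eq_axis)
  define G where "G b = g (THE i. b = ?E i)" for b
  have GE: "G (?E i) = g i" for i by (simp add: G_def axis_eq_axis)
  have Gint: "integrable lborel (G b)" for b by (simp add: G_def g)
  have [measurable]: "G b \<in> borel_measurable borel" for b by (simp add: G_def)
  have P: "(\<Prod>i\<in>UNIV. g i (y $ i)) = (\<Prod>b\<in>Basis. G b (y \<bullet> b))" for y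
    unfolding B by (subst prod.reindex[OF inj]) (simp add: GE inner_axis)
  have Q: "(\<Prod>i\<in>UNIV. integral\<^sup>L lborel (g i)) = (\<Prod>b\<in>Basis. integral\<^sup>L lborel (G b))"
    unfolding B by (subst prod.reindex[OF inj]) (simp add: GE)
  have C: "(\<Prod>b\<in>Basis. G b ((\<Sum>c\<in>Basis. f c *\<^sub>R c) \<bullet> b)) = (\<Prod>b\<in>Basis. G b (f b))" for f
    by (intro prod.cong refl) (simp add: inner_sum_left inner_Basis if_distrib cong: if_cong)
  show "integrable (lborel :: (real ^ 'q) measure) (\<lambda>y. \<Prod>i\<in>UNIV. g i (y $ i))"
    unfolding P by (subst lborel_eq, subst integrable_distr_eq)
      (simp_all add: C product_integrable_prod Gint)
  show "(\<integral>y. (\<Prod>i\<in>UNIV. g i ((y :: real ^ 'q) $ i)) \<partial>lborel) = (\<Prod>i\<in>UNIV. integral\<^sup>L lborel (g i))"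
    unfolding P Q by (subst lborel_eq, subst integral_distr)
      (simp_all add: C product_integral_prod Gint)
qed

abbreviation gaussian_vec_density :: "real \<Rightarrow> real ^ 'q \<Rightarrow> real" where
  "gaussian_vec_density h y \<equiv> \<Prod>i\<in>UNIV. normal_density 0 (sqrt h) (y $ i)"

text \<open>All factors of the density except the one with index \<open>i\<close> integrate to 1.\<close>

lemma gaussian_vec_coordinate:
  fixes g :: "real \<Rightarrow> real" and w :: "'w \<Rightarrow> real ^ 'q"
  assumes D: "distributed M lborel w (\<lambda>y. ennreal (gaussian_vec_density h y))" and "0 < h"
    and [measurable]: "g \<in> borel_measurable borel"
    and g: "has_bochner_integral lborel (\<lambda>z. normal_density 0 (sqrt h) z * g z) c"
  shows "has_bochner_integral M (\<lambda>\<omega>. g (w \<omega> $ i)) c"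
proof -
  define G where "G j z = normal_density 0 (sqrt h) z * (if j = i then g z else 1)" for j z
  have nn: "0 \<le> gaussian_vec_density h y" for y :: "real ^ 'q" by (intro prod_nonneg) auto
  have G: "integrable lborel (G j)" for j
    using g \<open>0 < h\<close> by (cases "j = i") (auto simp: G_def[abs_def] has_bochner_integral_iff)
  have "integral\<^sup>L lborel (G j) = (if j = i then c else 1)" for j
    using g \<open>0 < h\<close> by (cases "j = i") (auto simp: G_def[abs_def] has_bochner_integral_iff)
  then have c: "(\<Prod>j\<in>UNIV. integral\<^sup>L lborel (G j)) = c" by simp
  have P: "(\<Prod>j\<in>UNIV. G j (y $ j)) = gaussian_vec_density h y * g (y $ i)" for y
    by (simp add: G_def prod.distrib)
  have "integrable lborel (\<lambda>y. gaussian_vec_density h y * g (y $ i))"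
    "(\<integral>y. gaussian_vec_density h y * g (y $ i) \<partial>lborel) = c"
    using lborel_vec_integral_prod[of G, OF G] by (simp_all add: P c)
  then show ?thesis
    using distributed_integral[OF D, of "\<lambda>y. g (y $ i)"] distributed_integrable[OF D, of "\<lambda>y. g (y $ i)"] nn
    by (simp add: has_bochner_integral_iff)
qed

text \<open>Moments of the norm suffice later on, because \<open>norm (A *v w) \<le> norm A * norm w\<close>; covariances of
  distinct coordinates do not occur. The price is the factor \<open>CARD('q)\<close>.\<close>

lemma gaussian_vec_moments:
  fixes w :: "'w \<Rightarrow> real ^ 'q" and h :: real
  assumes D: "distributed M lborel w (\<lambda>y. ennreal (gaussian_vec_density h y))" and "0 < h"
  shows "has_bochner_integral M (\<lambda>\<omega>. w \<omega> $ i) 0"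
    and "has_bochner_integral M (\<lambda>\<omega>. (norm (w \<omega>))\<^sup>2) (CARD('q) * h)"
    and "integrable M (\<lambda>\<omega>. (norm (w \<omega>)) ^ 4)"
    and "(\<integral>\<omega>. (norm (w \<omega>)) ^ 4 \<partial>M) \<le> 3 * (CARD('q))\<^sup>2 * h\<^sup>2"
proof -
  have s: "0 < sqrt h" using \<open>0 < h\<close> by simp
  have m: "w \<in> borel_measurable M" using distributed_measurable[OF D] by simp
  show "has_bochner_integral M (\<lambda>\<omega>. w \<omega> $ i) 0"
    using normal_moment_odd[OF s, of 0 0] by (intro gaussian_vec_coordinate[OF D \<open>0 < h\<close>]) auto
  have two: "has_bochner_integral M (\<lambda>\<omega>. (w \<omega> $ i)\<^sup>2) h" for i
    using normal_moment_even[OF s, of 0 1] \<open>0 < h\<close> by (intro gaussian_vec_coordinate[OF D \<open>0 < h\<close>]) auto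
  have four: "has_bochner_integral M (\<lambda>\<omega>. (w \<omega> $ i) ^ 4) (3 * h\<^sup>2)" for i
    using normal_moment_even[OF s, of 0 2] \<open>0 < h\<close>
    by (intro gaussian_vec_coordinate[OF D \<open>0 < h\<close>]) (auto simp: fact_numeral power_divide)
  have nsq: "(norm (y :: real ^ 'q))\<^sup>2 = (\<Sum>i\<in>UNIV. (y $ i)\<^sup>2)" for y
    by (simp add: norm_vec_def L2_set_def sum_nonneg)
  show "has_bochner_integral M (\<lambda>\<omega>. (norm (w \<omega>))\<^sup>2) (CARD('q) * h)"
    unfolding nsq using has_bochner_integral_sum[of UNIV M "\<lambda>i \<omega>. (w \<omega> $ i)\<^sup>2" "\<lambda>_. h"] two by simp
  have "(norm (y :: real ^ 'q)) ^ 4 = ((norm y)\<^sup>2)\<^sup>2" for y by simp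
  then have nf: "(norm (y :: real ^ 'q)) ^ 4 \<le> CARD('q) * (\<Sum>i\<in>UNIV. (y $ i) ^ 4)" for y
    unfolding nsq using sum_squared_le_sum_of_squares[of "\<lambda>i. (y $ i)\<^sup>2" UNIV]
    by (simp del: power2_eq_square) (simp add: mult.commute)
  have S: "has_bochner_integral M (\<lambda>\<omega>. CARD('q) * (\<Sum>i\<in>UNIV. (w \<omega> $ i) ^ 4)) (CARD('q) * (\<Sum>i\<in>(UNIV::'q set). 3 * h\<^sup>2))"
    using four by (intro has_bochner_integral_mult_right has_bochner_integral_sum) auto
  show I: "integrable M (\<lambda>\<omega>. (norm (w \<omega>)) ^ 4)"
    using m nf by (intro Bochner_Integration.integrable_bound[OF integrable.intros[OF S]])
      (auto simp: abs_of_nonneg sum_nonneg)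
  have "(\<integral>\<omega>. (norm (w \<omega>)) ^ 4 \<partial>M) \<le> CARD('q) * (\<Sum>i\<in>(UNIV::'q set). 3 * h\<^sup>2)"
    unfolding has_bochner_integral_integral_eq[OF S, symmetric]
    using nf by (intro integral_mono I integrable.intros[OF S])
  then show "(\<integral>\<omega>. (norm (w \<omega>)) ^ 4 \<partial>M) \<le> 3 * (CARD('q))\<^sup>2 * h\<^sup>2"
    by (simp add: power2_eq_square algebra_simps)
qed

section \<open>Brownian motion relative to a filtration\<close>

text \<open>The filtration is a parameter because the strong solution is adapted to the augmented filtration, which
  may be larger than the natural one.\<close>

locale brownian_filtration = prob_space M for M :: "'w measure" +
  fixes F :: "real \<Rightarrow> 'w measure" and W :: "real \<Rightarrow> 'w \<Rightarrow> real ^ 'q"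
  assumes filtration_subalgebra: "0 \<le> t \<Longrightarrow> subalgebra M (F t)"
    and filtration_mono: "0 \<le> s \<Longrightarrow> s \<le> t \<Longrightarrow> sets (F s) \<subseteq> sets (F t)"
    and adapted: "0 \<le> t \<Longrightarrow> W t \<in> borel_measurable (F t)"
    and indep_increment: "0 \<le> s \<Longrightarrow> s < t \<Longrightarrow>
      indep_set (sets (F s)) {(\<lambda>\<omega>. W t \<omega> - W s \<omega>) -` A \<inter> space M | A. A \<in> sets borel}"
    and gaussian_increment: "0 \<le> s \<Longrightarrow> s < t \<Longrightarrow>
      distributed M lborel (\<lambda>\<omega>. W t \<omega> - W s \<omega>) (\<lambda>y. ennreal (gaussian_vec_density (t - s) y))"
begin

lemma space_filtration: "0 \<le> t \<Longrightarrow> space (F t) = space M"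
  using filtration_subalgebra[of t] by (simp add: subalgebra_def)

lemma measurable_filtration_M: "0 \<le> t \<Longrightarrow> f \<in> measurable (F t) N \<Longrightarrow> f \<in> measurable M N"
  using filtration_subalgebra measurable_from_subalg by blast

lemma measurable_filtration_mono:
  "0 \<le> s \<Longrightarrow> s \<le> t \<Longrightarrow> f \<in> measurable (F s) N \<Longrightarrow> f \<in> measurable (F t) N"
  using filtration_mono[of s t] space_filtration[of s] space_filtration[of t]
  by (intro measurable_from_subalg[of "F t" "F s"]) (auto simp: subalgebra_def)

lemma sets_filtration_M: "0 \<le> t \<Longrightarrow> A \<in> sets (F t) \<Longrightarrow> A \<in> sets M"
  using filtration_subalgebra[of t] by (auto simp: subalgebra_def)

lemma measurable_W: "0 \<le> t \<Longrightarrow> W t \<in> borel_measurable M"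
  using adapted measurable_filtration_M by blast

lemma adapted_le: "0 \<le> s \<Longrightarrow> s \<le> t \<Longrightarrow> W s \<in> borel_measurable (F t)"
  using adapted measurable_filtration_mono by blast

lemma indep_var_increment:
  fixes g :: "real ^ 'q \<Rightarrow> 'b::topological_space" and Y :: "'w \<Rightarrow> 'b"
  assumes st: "0 \<le> s" "s < t" and Y: "Y \<in> borel_measurable (F s)"
    and g: "g \<in> borel_measurable borel"
  shows "indep_var borel Y borel (\<lambda>\<omega>. g (W t \<omega> - W s \<omega>))"
  unfolding indep_var_eq
proof (intro conjI)
  have [measurable]: "W s \<in> borel_measurable M" "W t \<in> borel_measurable M" using st measurable_W by auto
  show "random_variable borel Y" using measurable_filtration_M st Y by auto
  show "random_variable borel (\<lambda>\<omega>. g (W t \<omega> - W s \<omega>))" using g by measurable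
  have 1: "sigma_sets (space M) {Y -` A \<inter> space M |A. A \<in> sets borel} \<subseteq> sets (F s)"
    unfolding space_filtration[OF st(1), symmetric]
    by (intro sets.sigma_sets_subset) (auto intro: measurable_sets[OF Y])
  let ?G = "{(\<lambda>\<omega>. W t \<omega> - W s \<omega>) -` A \<inter> space M | A. A \<in> sets borel}"
  have "sigma_sets (space M) {(\<lambda>\<omega>. g (W t \<omega> - W s \<omega>)) -` A \<inter> space M |A. A \<in> sets borel} \<subseteq> sigma_sets (space M) ?G"
  proof (intro sigma_sets_mono' subsetI)
    fix B assume "B \<in> {(\<lambda>\<omega>. g (W t \<omega> - W s \<omega>)) -` A \<inter> space M |A. A \<in> sets borel}"
    then obtain A where A: "A \<in> sets borel" "B = (\<lambda>\<omega>. g (W t \<omega> - W s \<omega>)) -` A \<inter> space M" by auto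
    then have "g -` A \<in> sets borel" using measurable_sets[OF g] by force
    then show "B \<in> ?G" using A by (auto intro!: exI[of _ "g -` A"])
  qed
  also have "\<dots> = ?G"
  proof -
    have "sets (vimage_algebra (space M) (\<lambda>\<omega>. W t \<omega> - W s \<omega>) borel) = ?G"
      by (rule sets_vimage_algebra2) auto
    then show ?thesis
      using sets.sigma_sets_eq[of "vimage_algebra (space M) (\<lambda>\<omega>. W t \<omega> - W s \<omega>) borel"] by simp
  qed
  finally have 2: "sigma_sets (space M) {(\<lambda>\<omega>. g (W t \<omega> - W s \<omega>)) -` A \<inter> space M |A. A \<in> sets borel} \<subseteq> ?G" .
  show "indep_set (sigma_sets (space M) {Y -` A \<inter> space M |A. A \<in> sets borel})
     (sigma_sets (space M) {(\<lambda>\<omega>. g (W t \<omega> - W s \<omega>)) -` A \<inter> space M |A. A \<in> sets borel})"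
    unfolding indep_set_def
  proof (rule indep_sets_mono_sets[OF indep_increment[OF st, unfolded indep_set_def]])
    fix i show "(case i of True \<Rightarrow> sigma_sets (space M) {Y -` A \<inter> space M |A. A \<in> sets borel}
       | False \<Rightarrow> sigma_sets (space M) {(\<lambda>\<omega>. g (W t \<omega> - W s \<omega>)) -` A \<inter> space M |A. A \<in> sets borel})
      \<subseteq> (case i of True \<Rightarrow> sets (F s) | False \<Rightarrow> ?G)"
      using 1 2 by (cases i) simp_all
  qed
qed

lemma expectation_increment_mult:
  fixes g :: "real ^ 'q \<Rightarrow> real"
  assumes st: "0 \<le> s" "s < t" and Y: "Y \<in> borel_measurable (F s)" "integrable M Y"
    and g: "g \<in> borel_measurable borel" "integrable M (\<lambda>\<omega>. g (W t \<omega> - W s \<omega>))"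
  shows "has_bochner_integral M (\<lambda>\<omega>. Y \<omega> * g (W t \<omega> - W s \<omega>))
           (expectation Y * expectation (\<lambda>\<omega>. g (W t \<omega> - W s \<omega>)))"
  using indep_var_integrable[OF indep_var_increment[OF st Y(1) g(1)] Y(2) g(2)]
    indep_var_lebesgue_integral[OF indep_var_increment[OF st Y(1) g(1)] Y(2) g(2)]
  by (simp add: has_bochner_integral_iff)

lemma expectation_inner_increment:
  assumes st: "0 \<le> s" "s < t" and Y: "Y \<in> borel_measurable (F s)" "integrable M (\<lambda>\<omega>. norm (Y \<omega>))"
  shows "has_bochner_integral M (\<lambda>\<omega>. Y \<omega> \<bullet> (W t \<omega> - W s \<omega>)) 0"
proof -
  have [measurable]: "Y \<in> borel_measurable M" using Y st measurable_filtration_M by blast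
  have "has_bochner_integral M (\<lambda>\<omega>. Y \<omega> $ i * (W t \<omega> - W s \<omega>) $ i) 0" for i
  proof -
    have w: "has_bochner_integral M (\<lambda>\<omega>. (W t \<omega> - W s \<omega>) $ i) 0"
      using gaussian_vec_moments(1)[OF gaussian_increment[OF st]] st by simp
    have "integrable M (\<lambda>\<omega>. Y \<omega> $ i)"
      by (rule Bochner_Integration.integrable_bound[OF Y(2)]) (auto simp: component_le_norm_cart)
    with w expectation_increment_mult[OF st, of "\<lambda>\<omega>. Y \<omega> $ i" "\<lambda>w. w $ i"] Y(1)
    show ?thesis by (simp add: has_bochner_integral_iff)
  qed
  from has_bochner_integral_sum[of UNIV, OF this] show ?thesis
    by (simp add: inner_vec_def)
qed

text \<open>The martingale property in the form in which every cross term below vanishes: the factor \<open>u v* \<xi>\<close> is known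
  at time \<open>s\<close>, and the increment is independent of it and centred.\<close>

lemma expectation_vector_matrix_increment:
  fixes u :: "'w \<Rightarrow> real ^ 'd" and \<xi> :: "'w \<Rightarrow> real ^ 'q ^ 'd" and s t :: real
  assumes st: "0 \<le> s" "s < t" and [measurable]: "u \<in> borel_measurable (F s)" "\<xi> \<in> borel_measurable (F s)"
    and i: "integrable M (\<lambda>\<omega>. norm (u \<omega>) * norm (\<xi> \<omega>))"
  shows "has_bochner_integral M (\<lambda>\<omega>. u \<omega> \<bullet> (\<xi> \<omega> *v (W t \<omega> - W s \<omega>))) 0"
proof -
  have [measurable]: "(\<lambda>\<omega>. u \<omega> v* \<xi> \<omega>) \<in> borel_measurable (F s)"
  proof (rule borel_measurable_continuous_Pair[where H = "(v*)"])
    show "continuous_on UNIV (\<lambda>p :: (real ^ 'd) \<times> (real ^ 'q ^ 'd). fst p v* snd p)"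
      unfolding vector_matrix_mult_def by (intro continuous_intros)
  qed fact+
  have n: "norm (u \<omega> v* \<xi> \<omega>) \<le> norm (u \<omega>) * norm (\<xi> \<omega>)" for \<omega>
  proof -
    let ?y = "u \<omega> v* \<xi> \<omega>"
    have "(norm ?y)\<^sup>2 = u \<omega> \<bullet> (\<xi> \<omega> *v ?y)" by (simp add: power2_norm_eq_inner dot_lmul_matrix)
    also have "\<dots> \<le> norm (u \<omega>) * norm (\<xi> \<omega> *v ?y)" by (rule norm_cauchy_schwarz)
    also have "\<dots> \<le> norm (u \<omega>) * (norm (\<xi> \<omega>) * norm ?y)"
      by (intro mult_left_mono norm_matrix_vector_mult_le) auto
    finally show ?thesis by (cases "?y = 0") (simp_all add: power2_eq_square)
  qed
  have "integrable M (\<lambda>\<omega>. norm (u \<omega> v* \<xi> \<omega>))"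
    using n measurable_filtration_M[OF st(1), of "\<lambda>\<omega>. u \<omega> v* \<xi> \<omega>" borel]
    by (intro Bochner_Integration.integrable_bound[OF i]) auto
  from expectation_inner_increment[OF st _ this] show ?thesis by (simp add: dot_lmul_matrix)
qed

lemma increment_step_L2:
  fixes u :: "'w \<Rightarrow> real ^ 'd" and \<xi> :: "'w \<Rightarrow> real ^ 'q ^ 'd" and s t :: real
  assumes st: "0 \<le> s" "s \<le> t" and ux [measurable]: "u \<in> borel_measurable (F s)" "\<xi> \<in> borel_measurable (F s)"
    and u: "integrable M (\<lambda>\<omega>. (norm (u \<omega>))\<^sup>2)" and \<xi>: "integrable M (\<lambda>\<omega>. (norm (\<xi> \<omega>))\<^sup>2)"
  shows "integrable M (\<lambda>\<omega>. (norm (u \<omega> + \<xi> \<omega> *v (W t \<omega> - W s \<omega>)))\<^sup>2)" (is ?I)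
    and "expectation (\<lambda>\<omega>. (norm (u \<omega> + \<xi> \<omega> *v (W t \<omega> - W s \<omega>)))\<^sup>2)
        \<le> expectation (\<lambda>\<omega>. (norm (u \<omega>))\<^sup>2) + CARD('q) * (t - s) * expectation (\<lambda>\<omega>. (norm (\<xi> \<omega>))\<^sup>2)" (is ?E)
proof -
  have "?I \<and> ?E"
  proof (cases "s = t")
    case True then show ?thesis using u by simp
  next
    case False
    then have st': "0 \<le> s" "s < t" using st by auto
    have "0 \<le> t" using st by simp
    note [measurable] = measurable_filtration_M[OF st(1) ux(1)] measurable_filtration_M[OF st(1) ux(2)]
      measurable_W[OF st(1)] measurable_W[OF \<open>0 \<le> t\<close>]
    let ?w = "\<lambda>\<omega>. W t \<omega> - W s \<omega>"
    have "integrable M (\<lambda>\<omega>. norm (u \<omega>) * norm (\<xi> \<omega>))"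
      by (rule Bochner_Integration.integrable_bound[OF Bochner_Integration.integrable_add[OF u \<xi>]])
        (auto simp: mult_le_sum_squares)
    from expectation_vector_matrix_increment[OF st' _ _ this]
    have c: "has_bochner_integral M (\<lambda>\<omega>. u \<omega> \<bullet> (\<xi> \<omega> *v ?w \<omega>)) 0" by simp
    have w2: "has_bochner_integral M (\<lambda>\<omega>. (norm (?w \<omega>))\<^sup>2) (CARD('q) * (t - s))"
      using gaussian_vec_moments(2)[OF gaussian_increment[OF st']] st' by simp
    have q: "has_bochner_integral M (\<lambda>\<omega>. (norm (\<xi> \<omega>))\<^sup>2 * (norm (?w \<omega>))\<^sup>2)
        (expectation (\<lambda>\<omega>. (norm (\<xi> \<omega>))\<^sup>2) * (CARD('q) * (t - s)))"
      using expectation_increment_mult[OF st', of "\<lambda>\<omega>. (norm (\<xi> \<omega>))\<^sup>2" "\<lambda>w. (norm w)\<^sup>2"] w2 \<xi>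
      by (simp add: has_bochner_integral_iff)
    let ?R = "\<lambda>\<omega>. (norm (u \<omega>))\<^sup>2 + 2 * (u \<omega> \<bullet> (\<xi> \<omega> *v ?w \<omega>)) + (norm (\<xi> \<omega>))\<^sup>2 * (norm (?w \<omega>))\<^sup>2"
    have R: "has_bochner_integral M ?R (expectation (\<lambda>\<omega>. (norm (u \<omega>))\<^sup>2) + 2 * 0
        + expectation (\<lambda>\<omega>. (norm (\<xi> \<omega>))\<^sup>2) * (CARD('q) * (t - s)))"
      using u by (intro has_bochner_integral_add has_bochner_integral_mult_right c q) (simp add: has_bochner_integral_iff)
    have le: "(norm (u \<omega> + \<xi> \<omega> *v ?w \<omega>))\<^sup>2 \<le> ?R \<omega>" for \<omega>
    proof -
      have "(norm (\<xi> \<omega> *v ?w \<omega>))\<^sup>2 \<le> (norm (\<xi> \<omega>) * norm (?w \<omega>))\<^sup>2"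
        by (intro power_mono norm_matrix_vector_mult_le) auto
      then show ?thesis
        unfolding norm_add_sq by (simp add: power_mult_distrib)
    qed
    have I: ?I
      using le by (intro Bochner_Integration.integrable_bound[OF integrable.intros[OF R]])
        (auto intro: order_trans[OF _ abs_ge_self])
    moreover have "expectation (\<lambda>\<omega>. (norm (u \<omega> + \<xi> \<omega> *v ?w \<omega>))\<^sup>2) \<le> expectation ?R"
      using le by (intro integral_mono I integrable.intros[OF R])
    ultimately show ?thesis
      using R by (simp add: has_bochner_integral_iff mult_ac)
  qed
  then show ?I ?E by auto
qed

text \<open>Write \<open>v\<close> for the stochastic term and expand the square of \<open>1 + (norm (u + v))\<^sup>2\<close>. The term linear
  in \<open>v\<close> has mean zero, and the one of third order in \<open>v\<close> is absorbed by those of second and fourth order.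
  The summand 1 makes the quantity comparable with the squared linear growth bound of the coefficients.\<close>

lemma increment_step_L4:
  fixes u :: "'w \<Rightarrow> real ^ 'd" and \<xi> :: "'w \<Rightarrow> real ^ 'q ^ 'd" and s t :: real
  assumes st: "0 \<le> s" "s < t" and ux [measurable]: "u \<in> borel_measurable (F s)" "\<xi> \<in> borel_measurable (F s)"
    and u: "integrable M (\<lambda>\<omega>. (1 + (norm (u \<omega>))\<^sup>2)\<^sup>2)" and \<xi>: "integrable M (\<lambda>\<omega>. (norm (\<xi> \<omega>)) ^ 4)"
  shows "integrable M (\<lambda>\<omega>. (1 + (norm (u \<omega> + \<xi> \<omega> *v (W t \<omega> - W s \<omega>)))\<^sup>2)\<^sup>2)" (is ?I)
    and "expectation (\<lambda>\<omega>. (1 + (norm (u \<omega> + \<xi> \<omega> *v (W t \<omega> - W s \<omega>)))\<^sup>2)\<^sup>2)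
        \<le> expectation (\<lambda>\<omega>. (1 + (norm (u \<omega>))\<^sup>2)\<^sup>2)
          + 8 * CARD('q) * (t - s) * expectation (\<lambda>\<omega>. (1 + (norm (u \<omega>))\<^sup>2) * (norm (\<xi> \<omega>))\<^sup>2)
          + 9 * (CARD('q))\<^sup>2 * (t - s)\<^sup>2 * expectation (\<lambda>\<omega>. (norm (\<xi> \<omega>)) ^ 4)" (is ?E)
proof -
  have "0 \<le> t" using st by simp
  note [measurable] = measurable_filtration_M[OF st(1) ux(1)] measurable_filtration_M[OF st(1) ux(2)]
    measurable_W[OF st(1)] measurable_W[OF \<open>0 \<le> t\<close>]
  let ?w = "\<lambda>\<omega>. W t \<omega> - W s \<omega>"
  let ?a = "\<lambda>\<omega>. 1 + (norm (u \<omega>))\<^sup>2"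
  have ax: "integrable M (\<lambda>\<omega>. ?a \<omega> * (norm (\<xi> \<omega>))\<^sup>2)"
  proof (rule Bochner_Integration.integrable_bound[OF Bochner_Integration.integrable_add[OF u \<xi>]])
    show "AE \<omega> in M. norm (?a \<omega> * (norm (\<xi> \<omega>))\<^sup>2) \<le> norm ((?a \<omega>)\<^sup>2 + (norm (\<xi> \<omega>)) ^ 4)"
    proof (rule AE_I2)
      show "norm (?a \<omega> * (norm (\<xi> \<omega>))\<^sup>2) \<le> norm ((?a \<omega>)\<^sup>2 + (norm (\<xi> \<omega>)) ^ 4)" for \<omega>
        using mult_le_sum_squares[of "?a \<omega>" "(norm (\<xi> \<omega>))\<^sup>2"] by simp
    qed
  qed simp
  have "integrable M (\<lambda>\<omega>. norm (?a \<omega> *\<^sub>R u \<omega>) * norm (\<xi> \<omega>))"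
  proof (rule Bochner_Integration.integrable_bound[OF Bochner_Integration.integrable_add[OF u ax]])
    have "x * (y * z) \<le> x\<^sup>2 + x * z\<^sup>2" if "x = 1 + y\<^sup>2" "0 \<le> y" "0 \<le> z" for x y z :: real
    proof -
      have "y * z \<le> x + z\<^sup>2"
        using mult_le_sum_squares[of y z] that by linarith
      then have "x * (y * z) \<le> x * (x + z\<^sup>2)" using that by (intro mult_left_mono) auto
      then show ?thesis by (simp add: power2_eq_square algebra_simps)
    qed
    from this[OF refl norm_ge_zero norm_ge_zero]
    have *: "?a \<omega> * (norm (u \<omega>) * norm (\<xi> \<omega>)) \<le> (?a \<omega>)\<^sup>2 + ?a \<omega> * (norm (\<xi> \<omega>))\<^sup>2" for \<omega> .
    show "AE \<omega> in M. norm (norm (?a \<omega> *\<^sub>R u \<omega>) * norm (\<xi> \<omega>)) \<le> norm ((?a \<omega>)\<^sup>2 + ?a \<omega> * (norm (\<xi> \<omega>))\<^sup>2)"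
    proof (rule AE_I2)
      show "norm (norm (?a \<omega> *\<^sub>R u \<omega>) * norm (\<xi> \<omega>)) \<le> norm ((?a \<omega>)\<^sup>2 + ?a \<omega> * (norm (\<xi> \<omega>))\<^sup>2)" for \<omega>
        using *[of \<omega>] by (simp add: abs_mult mult.assoc)
    qed
  qed simp
  from expectation_vector_matrix_increment[OF st _ _ this]
  have c: "has_bochner_integral M (\<lambda>\<omega>. (?a \<omega> *\<^sub>R u \<omega>) \<bullet> (\<xi> \<omega> *v ?w \<omega>)) 0" by simp
  have w2: "has_bochner_integral M (\<lambda>\<omega>. (norm (?w \<omega>))\<^sup>2) (CARD('q) * (t - s))"
    using gaussian_vec_moments(2)[OF gaussian_increment[OF st]] st by simp
  have w4: "integrable M (\<lambda>\<omega>. (norm (?w \<omega>)) ^ 4)"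
      "expectation (\<lambda>\<omega>. (norm (?w \<omega>)) ^ 4) \<le> 3 * (CARD('q))\<^sup>2 * (t - s)\<^sup>2"
    using gaussian_vec_moments(3,4)[OF gaussian_increment[OF st]] st by simp_all
  have q: "has_bochner_integral M (\<lambda>\<omega>. (?a \<omega> * (norm (\<xi> \<omega>))\<^sup>2) * (norm (?w \<omega>))\<^sup>2)
      (expectation (\<lambda>\<omega>. ?a \<omega> * (norm (\<xi> \<omega>))\<^sup>2) * (CARD('q) * (t - s)))"
    using expectation_increment_mult[OF st, of "\<lambda>\<omega>. ?a \<omega> * (norm (\<xi> \<omega>))\<^sup>2" "\<lambda>w. (norm w)\<^sup>2"] w2 ax
    by (simp add: has_bochner_integral_iff)
  have p: "has_bochner_integral M (\<lambda>\<omega>. (norm (\<xi> \<omega>)) ^ 4 * (norm (?w \<omega>)) ^ 4)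
      (expectation (\<lambda>\<omega>. (norm (\<xi> \<omega>)) ^ 4) * expectation (\<lambda>\<omega>. (norm (?w \<omega>)) ^ 4))"
    using expectation_increment_mult[OF st, of "\<lambda>\<omega>. (norm (\<xi> \<omega>)) ^ 4" "\<lambda>w. (norm w) ^ 4"] w4 \<xi>
    by simp
  let ?R = "\<lambda>\<omega>. (?a \<omega>)\<^sup>2 + 4 * ((?a \<omega> *\<^sub>R u \<omega>) \<bullet> (\<xi> \<omega> *v ?w \<omega>))
      + 8 * ((?a \<omega> * (norm (\<xi> \<omega>))\<^sup>2) * (norm (?w \<omega>))\<^sup>2) + 3 * ((norm (\<xi> \<omega>)) ^ 4 * (norm (?w \<omega>)) ^ 4)"
  have R: "has_bochner_integral M ?R (expectation (\<lambda>\<omega>. (?a \<omega>)\<^sup>2) + 4 * 0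
      + 8 * (expectation (\<lambda>\<omega>. ?a \<omega> * (norm (\<xi> \<omega>))\<^sup>2) * (CARD('q) * (t - s)))
      + 3 * (expectation (\<lambda>\<omega>. (norm (\<xi> \<omega>)) ^ 4) * expectation (\<lambda>\<omega>. (norm (?w \<omega>)) ^ 4)))"
    using u by (intro has_bochner_integral_add has_bochner_integral_mult_right c q p) (simp add: has_bochner_integral_iff)
  have le: "(1 + (norm (u \<omega> + \<xi> \<omega> *v ?w \<omega>))\<^sup>2)\<^sup>2 \<le> ?R \<omega>" for \<omega>
  proof -
    define v where "v = \<xi> \<omega> *v ?w \<omega>"
    define a where "a = ?a \<omega>"
    define c where "c = u \<omega> \<bullet> v"
    define e where "e = (norm v)\<^sup>2"
    define n where "n = (norm (\<xi> \<omega>))\<^sup>2 * (norm (?w \<omega>))\<^sup>2"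
    have "norm v ^ 2 \<le> (norm (\<xi> \<omega>) * norm (?w \<omega>))\<^sup>2"
      unfolding v_def by (intro power_mono norm_matrix_vector_mult_le) auto
    then have en: "0 \<le> e" "e \<le> n" by (simp_all add: e_def n_def power_mult_distrib)
    have a: "1 \<le> a" by (simp add: a_def)
    have c2: "c\<^sup>2 \<le> a * e"
    proof -
      have "c\<^sup>2 \<le> (norm (u \<omega>))\<^sup>2 * (norm v)\<^sup>2"
        unfolding c_def using Cauchy_Schwarz_ineq[of "u \<omega>" v] by (simp add: power2_norm_eq_inner)
      also have "\<dots> \<le> a * e" unfolding a_def e_def by (intro mult_right_mono) auto
      finally show ?thesis .
    qed
    have "1 + (norm (u \<omega> + v))\<^sup>2 = a + 2 * c + e"
      unfolding a_def c_def e_def norm_add_sq by simp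
    then have "(1 + (norm (u \<omega> + v))\<^sup>2)\<^sup>2 = a\<^sup>2 + 4 * (a * c) + (4 * c\<^sup>2 + e\<^sup>2 + 2 * a * e + 4 * c * e)"
      by (simp add: power2_eq_square algebra_simps)
    also have "4 * c\<^sup>2 + e\<^sup>2 + 2 * a * e + 4 * c * e \<le> 8 * (a * e) + 3 * e\<^sup>2"
    proof -
      have "0 \<le> (c - e)\<^sup>2" by simp
      then have "2 * c * e \<le> c\<^sup>2 + e\<^sup>2" by (simp add: power2_diff)
      with c2 show ?thesis by linarith
    qed
    also have "8 * (a * e) + 3 * e\<^sup>2 \<le> 8 * (a * n) + 3 * n\<^sup>2"
      using a en by (intro add_mono mult_left_mono power_mono) auto
    finally show ?thesis
      by (simp add: v_def a_def c_def n_def mult.assoc power_mult_distrib)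
  qed
  show I: ?I
  proof (intro Bochner_Integration.integrable_bound[OF integrable.intros[OF R]] AE_I2)
    show "norm ((1 + (norm (u \<omega> + \<xi> \<omega> *v ?w \<omega>))\<^sup>2)\<^sup>2) \<le> norm (?R \<omega>)" for \<omega>
      using le[of \<omega>] by simp
  qed simp
  have "expectation (\<lambda>\<omega>. (1 + (norm (u \<omega> + \<xi> \<omega> *v ?w \<omega>))\<^sup>2)\<^sup>2) \<le> expectation ?R"
    using le by (intro integral_mono I integrable.intros[OF R])
  also have "\<dots> = expectation (\<lambda>\<omega>. (?a \<omega>)\<^sup>2) 
      + 8 * (expectation (\<lambda>\<omega>. ?a \<omega> * (norm (\<xi> \<omega>))\<^sup>2) * (CARD('q) * (t - s)))
      + 3 * (expectation (\<lambda>\<omega>. (norm (\<xi> \<omega>)) ^ 4) * expectation (\<lambda>\<omega>. (norm (?w \<omega>)) ^ 4))"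
    using R by (simp add: has_bochner_integral_iff)
  also have "\<dots> \<le> expectation (\<lambda>\<omega>. (?a \<omega>)\<^sup>2) 
      + 8 * (expectation (\<lambda>\<omega>. ?a \<omega> * (norm (\<xi> \<omega>))\<^sup>2) * (CARD('q) * (t - s)))
      + 3 * (expectation (\<lambda>\<omega>. (norm (\<xi> \<omega>)) ^ 4) * (3 * (CARD('q))\<^sup>2 * (t - s)\<^sup>2))"
    using w4(2) by (intro add_left_mono mult_left_mono) (auto intro!: integral_nonneg)
  finally show ?E by (simp add: mult_ac)
qed

text \<open>As \<open>A j\<close> is known at time \<open>s j\<close> and the events decrease, \<open>u\<close> and \<open>\<xi>\<close> in the one-step estimate may both be
  multiplied by the indicator of \<open>A j\<close>. This localizes the Gronwall argument without stopping times.\<close>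

lemma stability:
  fixes D \<beta> :: "nat \<Rightarrow> 'w \<Rightarrow> real ^ 'd" and \<sigma> :: "nat \<Rightarrow> 'w \<Rightarrow> real ^ 'q ^ 'd"
  assumes h: "0 < h" and s: "\<And>j. 0 \<le> s j" "\<And>j. s (Suc j) = s j + h"
    and D0: "\<And>\<omega>. \<omega> \<in> space M \<Longrightarrow> D 0 \<omega> = 0"
    and step: "\<And>j \<omega>. j < k \<Longrightarrow> \<omega> \<in> space M \<Longrightarrow>
      D (Suc j) \<omega> = D j \<omega> + h *\<^sub>R \<beta> j \<omega> + \<sigma> j \<omega> *v (W (s (Suc j)) \<omega> - W (s j) \<omega>)"
    and \<beta>: "\<And>j. j < k \<Longrightarrow> \<beta> j \<in> borel_measurable (F (s j))" "\<And>j. j < k \<Longrightarrow> integrable M (\<lambda>\<omega>. (norm (\<beta> j \<omega>))\<^sup>2)"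
    and \<sigma>: "\<And>j. j < k \<Longrightarrow> \<sigma> j \<in> borel_measurable (F (s j))" "\<And>j. j < k \<Longrightarrow> integrable M (\<lambda>\<omega>. (norm (\<sigma> j \<omega>))\<^sup>2)"
    and A: "\<And>j. j < k \<Longrightarrow> A j \<in> sets (F (s j))" "\<And>j. j < k \<Longrightarrow> A (Suc j) \<subseteq> A j"
    and Ak: "A k \<in> sets M"
  shows "D k \<in> borel_measurable (F (s k))"
    and "integrable M (\<lambda>\<omega>. (norm (D k \<omega>))\<^sup>2)"
    and "expectation (\<lambda>\<omega>. indicat_real (A k) \<omega> * (norm (D k \<omega>))\<^sup>2) \<le> exp (h * real k) *
      (\<Sum>j<k. (1 + h + CARD('q)) * h * expectation (\<lambda>\<omega>. indicat_real (A j) \<omega> * ((norm (\<beta> j \<omega>))\<^sup>2 + (norm (\<sigma> j \<omega>))\<^sup>2)))"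
proof -
  have smono: "s j \<le> s (Suc j)" for j using s h by simp
  have AM: "A j \<in> sets M" if "j \<le> k" for j
    using that A(1)[of j] sets_filtration_M[OF s(1)[of j]] Ak by (cases "j = k") auto
  have D: "D j \<in> borel_measurable (F (s j)) \<and> integrable M (\<lambda>\<omega>. (norm (D j \<omega>))\<^sup>2)" if "j \<le> k" for j
    using that
  proof (induction j)
    case 0
    have "D 0 \<in> borel_measurable (F (s 0)) \<longleftrightarrow> (\<lambda>\<omega>. 0::real^'d) \<in> borel_measurable (F (s 0))"
      using D0 space_filtration[OF s(1)] by (intro measurable_cong) auto
    moreover have "integrable M (\<lambda>\<omega>. (norm (D 0 \<omega>))\<^sup>2) \<longleftrightarrow> integrable M (\<lambda>\<omega>. 0::real)"
      using D0 by (intro Bochner_Integration.integrable_cong) auto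
    ultimately show ?case by simp
  next
    case (Suc j)
    let ?R = "\<lambda>\<omega>. D j \<omega> + h *\<^sub>R \<beta> j \<omega> + \<sigma> j \<omega> *v (W (s (Suc j)) \<omega> - W (s j) \<omega>)"
    have IH: "D j \<in> borel_measurable (F (s j))" "integrable M (\<lambda>\<omega>. (norm (D j \<omega>))\<^sup>2)" using Suc by auto
    have [measurable]: "D j \<in> borel_measurable (F (s (Suc j)))" "\<beta> j \<in> borel_measurable (F (s (Suc j)))"
      "\<sigma> j \<in> borel_measurable (F (s (Suc j)))" "W (s j) \<in> borel_measurable (F (s (Suc j)))"
      using IH Suc.prems \<beta>(1)[of j] \<sigma>(1)[of j] adapted[OF s(1)[of j]]
      by (auto intro!: measurable_filtration_mono[OF s(1) smono])
    have [measurable]: "W (s (Suc j)) \<in> borel_measurable (F (s (Suc j)))" by (rule adapted[OF s(1)])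
    have 1: "?R \<in> borel_measurable (F (s (Suc j)))" by measurable
    have m [measurable]: "D j \<in> borel_measurable (F (s j))" "\<beta> j \<in> borel_measurable (F (s j))" "\<sigma> j \<in> borel_measurable (F (s j))"
      using IH \<beta> \<sigma> Suc.prems by auto
    note [measurable] = measurable_filtration_M[OF s(1) m(1)] measurable_filtration_M[OF s(1) m(2)]
    have 2: "integrable M (\<lambda>\<omega>. (norm (D j \<omega> + h *\<^sub>R \<beta> j \<omega>))\<^sup>2)"
    proof (rule Bochner_Integration.integrable_bound)
      show "integrable M (\<lambda>\<omega>. (1 + h) * (norm (D j \<omega>))\<^sup>2 + (h + h\<^sup>2) * (norm (\<beta> j \<omega>))\<^sup>2)"
        using IH \<beta> Suc.prems by auto
    qed (auto intro!: AE_I2 order_trans[OF norm_add_scaleR_sq_le abs_ge_self] less_imp_le[OF h])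
    have 3: "integrable M (\<lambda>\<omega>. (norm (?R \<omega>))\<^sup>2)"
      using Suc.prems by (intro increment_step_L2[OF s(1) smono] 2 \<sigma>) auto
    have "D (Suc j) \<in> borel_measurable (F (s (Suc j))) \<longleftrightarrow> ?R \<in> borel_measurable (F (s (Suc j)))"
      using step Suc.prems space_filtration[OF s(1)] by (intro measurable_cong) auto
    moreover have "integrable M (\<lambda>\<omega>. (norm (D (Suc j) \<omega>))\<^sup>2) \<longleftrightarrow> integrable M (\<lambda>\<omega>. (norm (?R \<omega>))\<^sup>2)"
      using step Suc.prems by (intro Bochner_Integration.integrable_cong) auto
    ultimately show ?case using 1 3 by simp
  qed
  from D[of k] show "D k \<in> borel_measurable (F (s k))" "integrable M (\<lambda>\<omega>. (norm (D k \<omega>))\<^sup>2)" by auto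
  have int_ind: "integrable M (\<lambda>\<omega>. indicat_real (A j) \<omega> * f \<omega>)" if "integrable M f" "j \<le> k" for f j
    using integrable_mult_indicator[OF AM[OF that(2)] that(1)] by simp
  define a where "a j = expectation (\<lambda>\<omega>. indicat_real (A j) \<omega> * (norm (D j \<omega>))\<^sup>2)" for j
  define r where "r j = (1 + h + CARD('q)) * h * expectation (\<lambda>\<omega>. indicat_real (A j) \<omega> * ((norm (\<beta> j \<omega>))\<^sup>2 + (norm (\<sigma> j \<omega>))\<^sup>2))" for j
  have "a k \<le> exp (h * real k) * (\<Sum>j<k. r j)"
  proof (rule discrete_gronwall_step)
    have "a 0 = expectation (\<lambda>_. 0)" unfolding a_def using D0
      by (intro Bochner_Integration.integral_cong) auto
    then show "a 0 \<le> 0" by simp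
    show "0 \<le> r j" for j unfolding r_def using h by (auto intro!: mult_nonneg_nonneg integral_nonneg)
    fix j assume j: "j < k"
    let ?I = "\<lambda>\<omega>. indicat_real (A j) \<omega>"
    let ?u = "\<lambda>\<omega>. ?I \<omega> *\<^sub>R (D j \<omega> + h *\<^sub>R \<beta> j \<omega>)"
    have m [measurable]: "D j \<in> borel_measurable (F (s j))" "\<beta> j \<in> borel_measurable (F (s j))" "\<sigma> j \<in> borel_measurable (F (s j))"
      "A j \<in> sets (F (s j))"
      using j D \<beta> \<sigma> A by auto
    note [measurable] = measurable_filtration_M[OF s(1) m(1)] measurable_filtration_M[OF s(1) m(2)]
      measurable_filtration_M[OF s(1) m(3)] AM[OF less_imp_le[OF j]]
    have Di: "integrable M (\<lambda>\<omega>. ?I \<omega> * (norm (D j \<omega>))\<^sup>2)" 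
      and bi: "integrable M (\<lambda>\<omega>. ?I \<omega> * (norm (\<beta> j \<omega>))\<^sup>2)" 
      and si: "integrable M (\<lambda>\<omega>. ?I \<omega> * (norm (\<sigma> j \<omega>))\<^sup>2)"
      using j D \<beta> \<sigma> by (auto intro!: int_ind)
    have I2: "(?I \<omega>)\<^sup>2 = ?I \<omega>" for \<omega> by (simp add: indicator_def)
    have ule: "(norm (?u \<omega>))\<^sup>2 \<le> (1 + h) * (?I \<omega> * (norm (D j \<omega>))\<^sup>2) + (h + h\<^sup>2) * (?I \<omega> * (norm (\<beta> j \<omega>))\<^sup>2)" for \<omega>
      using norm_add_scaleR_sq_le[of h "D j \<omega>" "\<beta> j \<omega>"] h by (auto simp: indicator_def)
    have ui: "integrable M (\<lambda>\<omega>. (norm (?u \<omega>))\<^sup>2)"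
    proof (rule Bochner_Integration.integrable_bound)
      show "integrable M (\<lambda>\<omega>. (1 + h) * (?I \<omega> * (norm (D j \<omega>))\<^sup>2) + (h + h\<^sup>2) * (?I \<omega> * (norm (\<beta> j \<omega>))\<^sup>2))"
        using Di bi by auto
      show "AE \<omega> in M. norm ((norm (?u \<omega>))\<^sup>2) \<le> norm ((1 + h) * (?I \<omega> * (norm (D j \<omega>))\<^sup>2) + (h + h\<^sup>2) * (?I \<omega> * (norm (\<beta> j \<omega>))\<^sup>2))"
        using ule by (auto intro!: AE_I2 intro: order_trans[OF _ abs_ge_self])
    qed simp
    have xi: "integrable M (\<lambda>\<omega>. (norm (?I \<omega> *\<^sub>R \<sigma> j \<omega>))\<^sup>2)"
      using si by (simp add: power_mult_distrib I2)
    let ?v = "\<lambda>\<omega>. ?u \<omega> + (?I \<omega> *\<^sub>R \<sigma> j \<omega>) *v (W (s (Suc j)) \<omega> - W (s j) \<omega>)"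
    have um: "?u \<in> borel_measurable (F (s j))" "(\<lambda>\<omega>. ?I \<omega> *\<^sub>R \<sigma> j \<omega>) \<in> borel_measurable (F (s j))" by measurable
    note st = increment_step_L2[OF s(1) smono um ui xi]
    have "a (Suc j) \<le> expectation (\<lambda>\<omega>. (norm (?v \<omega>))\<^sup>2)"
      unfolding a_def
    proof (intro integral_mono st(1))
      show "integrable M (\<lambda>\<omega>. indicat_real (A (Suc j)) \<omega> * (norm (D (Suc j) \<omega>))\<^sup>2)"
        using D[of "Suc j"] j by (intro int_ind) auto
      fix \<omega> assume "\<omega> \<in> space M"
      then show "indicat_real (A (Suc j)) \<omega> * (norm (D (Suc j) \<omega>))\<^sup>2 \<le> (norm (?v \<omega>))\<^sup>2"
        using step[OF j] A(2)[OF j] by (auto simp: indicator_def)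
    qed
    also have "\<dots> \<le> expectation (\<lambda>\<omega>. (norm (?u \<omega>))\<^sup>2) + CARD('q) * h * expectation (\<lambda>\<omega>. (norm (?I \<omega> *\<^sub>R \<sigma> j \<omega>))\<^sup>2)"
      using st(2) by (simp add: s(2))
    also have "expectation (\<lambda>\<omega>. (norm (?u \<omega>))\<^sup>2) \<le> expectation (\<lambda>\<omega>. (1 + h) * (?I \<omega> * (norm (D j \<omega>))\<^sup>2) + (h + h\<^sup>2) * (?I \<omega> * (norm (\<beta> j \<omega>))\<^sup>2))"
      using Di bi ule by (intro integral_mono ui) auto
    also have "\<dots> = (1 + h) * a j + (h + h\<^sup>2) * expectation (\<lambda>\<omega>. ?I \<omega> * (norm (\<beta> j \<omega>))\<^sup>2)"
      using Di bi by (simp add: a_def)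
    also have "expectation (\<lambda>\<omega>. (norm (?I \<omega> *\<^sub>R \<sigma> j \<omega>))\<^sup>2) = expectation (\<lambda>\<omega>. ?I \<omega> * (norm (\<sigma> j \<omega>))\<^sup>2)"
      by (simp add: power_mult_distrib I2)
    finally have up: "a (Suc j) \<le> (1 + h) * a j + (h + h\<^sup>2) * expectation (\<lambda>\<omega>. ?I \<omega> * (norm (\<beta> j \<omega>))\<^sup>2)
      + CARD('q) * h * expectation (\<lambda>\<omega>. ?I \<omega> * (norm (\<sigma> j \<omega>))\<^sup>2)" by simp
    have "(h + h\<^sup>2) * expectation (\<lambda>\<omega>. ?I \<omega> * (norm (\<beta> j \<omega>))\<^sup>2)
      + CARD('q) * h * expectation (\<lambda>\<omega>. ?I \<omega> * (norm (\<sigma> j \<omega>))\<^sup>2) \<le> r j"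
    proof -
      have "r j = (1 + h + CARD('q)) * h * (expectation (\<lambda>\<omega>. ?I \<omega> * (norm (\<beta> j \<omega>))\<^sup>2) + expectation (\<lambda>\<omega>. ?I \<omega> * (norm (\<sigma> j \<omega>))\<^sup>2))"
        unfolding r_def using bi si by (simp add: distrib_left)
      moreover have "0 \<le> CARD('q) * h * expectation (\<lambda>\<omega>. ?I \<omega> * (norm (\<beta> j \<omega>))\<^sup>2)"
        "0 \<le> (h + h\<^sup>2) * expectation (\<lambda>\<omega>. ?I \<omega> * (norm (\<sigma> j \<omega>))\<^sup>2)"
        using h by (auto intro!: mult_nonneg_nonneg integral_nonneg)
      ultimately show ?thesis by (simp add: algebra_simps power2_eq_square)
    qed
    with up show "a (Suc j) \<le> (1 + h) * a j + r j" by simp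
  qed (use h in auto)
  then show "expectation (\<lambda>\<omega>. indicat_real (A k) \<omega> * (norm (D k \<omega>))\<^sup>2) \<le> exp (h * real k) *
      (\<Sum>j<k. (1 + h + CARD('q)) * h * expectation (\<lambda>\<omega>. indicat_real (A j) \<omega> * ((norm (\<beta> j \<omega>))\<^sup>2 + (norm (\<sigma> j \<omega>))\<^sup>2)))"
    unfolding a_def r_def .
qed

end

text \<open>The sets that differ by a null set from a set of the natural filtration form a \<sigma>-algebra. Independence of
  the increments therefore passes to the augmented filtration.\<close>

lemma augmented_set_AE_natural:
  assumes "A \<in> sets (augmented_filtration M W t)" and nat: "sets (natural_filtration M W t) \<subseteq> sets M"
  shows "A \<in> sets M \<and> (\<exists>B\<in>sets (natural_filtration M W t). AE \<omega> in M. \<omega> \<in> A \<longleftrightarrow> \<omega> \<in> B)"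
proof -
  let ?N = "natural_filtration M W t"
  have sp: "space ?N = space M" by (simp add: natural_filtration_def space_measure_of_conv)
  have "sets ?N \<union> null_sets M \<subseteq> Pow (space M)"
    using nat sets.sets_into_space by (auto dest: sets.sets_into_space)
  then have "A \<in> sigma_sets (space M) (sets ?N \<union> null_sets M)"
    using assms(1) by (simp add: augmented_filtration_def)
  then show ?thesis
  proof induction
    case (Basic a)
    then show ?case
    proof
      assume "a \<in> null_sets M"
      then have "AE \<omega> in M. \<omega> \<notin> a" by (rule AE_not_in)
      then show ?thesis using \<open>a \<in> null_sets M\<close> by (auto intro!: bexI[of _ "{}"])
    qed (use nat in auto)
  next
    case Empty then show ?case by (auto intro!: bexI[of _ "{}"])
  next
    case (Compl a)
    then obtain B where B: "B \<in> sets ?N" "AE \<omega> in M. \<omega> \<in> a \<longleftrightarrow> \<omega> \<in> B" by auto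
    have "AE \<omega> in M. \<omega> \<in> space M - a \<longleftrightarrow> \<omega> \<in> space M - B" using B(2) by eventually_elim auto
    moreover have "space M - B \<in> sets ?N" using B(1) sp by (metis sets.compl_sets)
    ultimately show ?case using Compl by (intro conjI bexI[of _ "space M - B"]) auto
  next
    case (Union a)
    then obtain B where B: "\<And>i. B i \<in> sets ?N" "\<And>i. AE \<omega> in M. \<omega> \<in> a i \<longleftrightarrow> \<omega> \<in> B i" by metis
    have "AE \<omega> in M. \<forall>i::nat. \<omega> \<in> a i \<longleftrightarrow> \<omega> \<in> B i" using B(2) by (simp add: AE_all_countable)
    then have "AE \<omega> in M. \<omega> \<in> (\<Union>i. a i) \<longleftrightarrow> \<omega> \<in> (\<Union>i. B i)" by eventually_elim auto
    moreover have "(\<Union>i. B i) \<in> sets ?N" using B(1) by auto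
    ultimately show ?case using Union by blast
  qed
qed

lemma standard_BM_brownian_filtration:
  assumes "prob_space M" and BM: "standard_BM M W"
  shows "brownian_filtration M (augmented_filtration M W) W"
proof -
  interpret prob_space M by fact
  let ?N = "natural_filtration M W" and ?F = "augmented_filtration M W"
  have Wm: "W t \<in> borel_measurable M" if "0 \<le> t" for t using BM that by (auto simp: standard_BM_def)
  let ?G = "\<lambda>t. {W s -` A \<inter> space M | s A. s \<in> {0..t} \<and> A \<in> sets borel}"
  have setsN: "sets (?N t) = sigma_sets (space M) (?G t)" for t
    by (auto simp: natural_filtration_def intro!: sets_measure_of)
  have spN: "space (?N t) = space M" for t by (simp add: natural_filtration_def space_measure_of_conv)
  have NM: "sets (?N t) \<subseteq> sets M" for t
    unfolding setsN using Wm by (intro sets.sigma_sets_subset) (auto intro!: measurable_sets)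
  have spF: "space (?F t) = space M" for t by (simp add: augmented_filtration_def space_measure_of_conv)
  have setsF: "sets (?F t) = sigma_sets (space M) (sets (?N t) \<union> null_sets M)" for t
    unfolding augmented_filtration_def using NM[of t]
    by (intro sets_measure_of) (auto dest: sets.sets_into_space)
  show ?thesis
  proof (unfold_locales)
    fix t :: real assume "0 \<le> t"
    show "subalgebra M (?F t)"
      using augmented_set_AE_natural[OF _ NM, of _ t] by (auto simp: subalgebra_def spF)
    have "W t \<in> borel_measurable (?N t)"
      using \<open>0 \<le> t\<close> by (intro measurableI) (auto simp: spN setsN intro!: sigma_sets.Basic exI[of _ t])
    then show "W t \<in> borel_measurable (?F t)"
      by (rule measurable_from_subalg[rotated]) (auto simp: subalgebra_def spF spN setsF)
  next
    fix s t :: real assume st: "0 \<le> s" "s \<le> t"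
    have "sets (?N s) \<subseteq> sets (?N t)"
      unfolding setsN using st by (intro sigma_sets_mono') force
    then show "sets (?F s) \<subseteq> sets (?F t)" unfolding setsF by (intro sigma_sets_mono') auto
  next
    fix s t :: real assume st: "0 \<le> s" "s < t"
    let ?D = "{(\<lambda>\<omega>. W t \<omega> - W s \<omega>) -` A \<inter> space M |A. A \<in> sets borel}"
    have ind: "indep_set (sets (?N s)) ?D" using BM st by (auto simp: standard_BM_def)
    show "indep_set (sets (?F s)) ?D"
      unfolding indep_sets2_eq
    proof (intro conjI ballI)
      show "sets (?F s) \<subseteq> events" using augmented_set_AE_natural[OF _ NM, of _ s] by auto
      show D: "?D \<subseteq> events" using ind unfolding indep_sets2_eq by blast
      fix a c assume a: "a \<in> sets (?F s)" and c: "c \<in> ?D"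
      obtain B where B: "B \<in> sets (?N s)" "AE \<omega> in M. \<omega> \<in> a \<longleftrightarrow> \<omega> \<in> B" and am: "a \<in> events"
        using augmented_set_AE_natural[OF a NM] by auto
      have Bm: "B \<in> events" using B NM by auto
      have cm: "c \<in> events" using c D by auto
      have "prob (a \<inter> c) = prob (B \<inter> c)"
        using B(2) am Bm cm by (intro measure_eq_AE) auto
      also have "\<dots> = prob B * prob c" using ind B(1) c unfolding indep_sets2_eq by blast
      also have "prob B = prob a" using B(2) am Bm by (intro measure_eq_AE) auto
      finally show "prob (a \<inter> c) = prob a * prob c" .
    qed
  next
    fix s t :: real assume "0 \<le> s" "s < t"
    then show "distributed M lborel (\<lambda>\<omega>. W t \<omega> - W s \<omega>) (\<lambda>y. ennreal (gaussian_vec_density (t - s) y))"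
      using BM by (auto simp: standard_BM_def)
  qed
qed

section \<open>Moments of the Euler scheme\<close>

locale lipschitz_sde =
  fixes T :: real and b :: "real \<Rightarrow> real ^ 'd \<Rightarrow> real ^ 'd" and \<sigma> :: "real \<Rightarrow> real ^ 'd \<Rightarrow> real ^ 'q ^ 'd"
    and x :: "real ^ 'd" and K :: real
  assumes T_pos: "0 < T" and K_pos: "0 < K"
    and b_cont: "continuous_on ({0..T} \<times> UNIV) (\<lambda>(t, y). b t y)"
    and \<sigma>_cont: "continuous_on ({0..T} \<times> UNIV) (\<lambda>(t, y). \<sigma> t y)"
    and b_growth: "t \<in> {0..T} \<Longrightarrow> norm (b t y) \<le> K * (1 + norm y)"
    and \<sigma>_growth: "t \<in> {0..T} \<Longrightarrow> norm (\<sigma> t y) \<le> K * (1 + norm y)"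
    and b_lip: "t \<in> {0..T} \<Longrightarrow> norm (b t y - b t z) \<le> K * norm (y - z)"
    and \<sigma>_lip: "t \<in> {0..T} \<Longrightarrow> norm (\<sigma> t y - \<sigma> t z) \<le> K * norm (y - z)"

lemma lipschitz_sde_exists:
  assumes "0 < T" "sde_coefficients T b \<sigma>"
  shows "\<exists>K. lipschitz_sde T b \<sigma> K"
proof -
  from assms(2) obtain L B1 B2 where L: "\<And>t. t \<in> {0..T} \<Longrightarrow> L-lipschitz_on UNIV (b t)"
      "\<And>t. t \<in> {0..T} \<Longrightarrow> L-lipschitz_on UNIV (\<sigma> t)"
    and B: "\<And>t. t \<in> {0..T} \<Longrightarrow> norm (b t 0) \<le> B1" "\<And>t. t \<in> {0..T} \<Longrightarrow> norm (\<sigma> t 0) \<le> B2"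
    unfolding sde_coefficients_def bounded_iff by (metis imageI)
  define K where "K = \<bar>L\<bar> + \<bar>B1\<bar> + \<bar>B2\<bar> + 1"
  have lip: "norm (b t y - b t z) \<le> K * norm (y - z)" "norm (\<sigma> t y - \<sigma> t z) \<le> K * norm (y - z)"
    if "t \<in> {0..T}" for t y z
  proof -
    have "L * norm (y - z) \<le> K * norm (y - z)" unfolding K_def by (intro mult_right_mono) auto
    then show "norm (b t y - b t z) \<le> K * norm (y - z)" "norm (\<sigma> t y - \<sigma> t z) \<le> K * norm (y - z)"
      using lipschitz_onD[OF L(1)[OF that], of y z] lipschitz_onD[OF L(2)[OF that], of y z]
      by (auto simp: dist_norm)
  qed
  have growth: "norm (b t y) \<le> K * (1 + norm y)" "norm (\<sigma> t y) \<le> K * (1 + norm y)" if "t \<in> {0..T}" for t y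
  proof -
    have "norm (b t y) \<le> norm (b t y - b t 0) + norm (b t 0)" "norm (\<sigma> t y) \<le> norm (\<sigma> t y - \<sigma> t 0) + norm (\<sigma> t 0)"
      using norm_triangle_ineq[of "b t y - b t 0" "b t 0"] norm_triangle_ineq[of "\<sigma> t y - \<sigma> t 0" "\<sigma> t 0"] by simp_all
    moreover have "B1 \<le> K" "B2 \<le> K" unfolding K_def by auto
    ultimately show "norm (b t y) \<le> K * (1 + norm y)" "norm (\<sigma> t y) \<le> K * (1 + norm y)"
      using lip[OF that, of y 0] B[OF that] by (auto simp: algebra_simps)
  qed
  have "0 < K" unfolding K_def by auto
  with lip growth assms show ?thesis by (intro exI[of _ K]) (auto simp: lipschitz_sde_def sde_coefficients_def)
qed

context lipschitz_sde begin

lemma b_measurable: "t \<in> {0..T} \<Longrightarrow> b t \<in> borel_measurable borel"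
  using b_lip[of t] K_pos
  by (intro borel_measurable_continuous_onI lipschitz_on_continuous_on[of K] lipschitz_onI) (auto simp: dist_norm)

lemma \<sigma>_measurable: "t \<in> {0..T} \<Longrightarrow> \<sigma> t \<in> borel_measurable borel"
  using \<sigma>_lip[of t] K_pos
  by (intro borel_measurable_continuous_onI lipschitz_on_continuous_on[of K] lipschitz_onI) (auto simp: dist_norm)

lemma b_growth_sq: "t \<in> {0..T} \<Longrightarrow> (norm (b t y))\<^sup>2 \<le> 2 * K\<^sup>2 * (1 + (norm y)\<^sup>2)"
  using power_mono[OF b_growth[of t y], of 2] linear_growth_sq[of K "norm y"] by simp

lemma \<sigma>_growth_sq: "t \<in> {0..T} \<Longrightarrow> (norm (\<sigma> t y))\<^sup>2 \<le> 2 * K\<^sup>2 * (1 + (norm y)\<^sup>2)"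
  using power_mono[OF \<sigma>_growth[of t y], of 2] linear_growth_sq[of K "norm y"] by simp

lemma drift_step_growth:
  assumes "t \<in> {0..T}" "0 \<le> h" "h \<le> T"
  shows "1 + (norm (y + h *\<^sub>R b t y))\<^sup>2 \<le> (1 + (4 * K + 2 * K\<^sup>2 * T) * h) * (1 + (norm y)\<^sup>2)"
proof -
  have "norm y * norm (b t y) \<le> norm y * (K * (1 + norm y))"
    using assms by (intro mult_left_mono b_growth) auto
  also have "\<dots> \<le> 2 * K * (1 + (norm y)\<^sup>2)"
  proof -
    have "norm y * (1 + norm y) \<le> 2 * (1 + (norm y)\<^sup>2)"
      using sum_squares_bound[of 1 "norm y"] zero_le_power2[of "norm y"]
      unfolding power2_eq_square distrib_left by linarith
    from mult_left_mono[OF this, of K] K_pos show ?thesis by (simp add: mult_ac)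
  qed
  finally have 1: "y \<bullet> b t y \<le> 2 * K * (1 + (norm y)\<^sup>2)" using norm_cauchy_schwarz[of y "b t y"] by linarith
  have "(norm (y + h *\<^sub>R b t y))\<^sup>2 = (norm y)\<^sup>2 + 2 * h * (y \<bullet> b t y) + h\<^sup>2 * (norm (b t y))\<^sup>2"
    by (simp add: norm_add_sq power_mult_distrib)
  also have "\<dots> \<le> (norm y)\<^sup>2 + 2 * h * (2 * K * (1 + (norm y)\<^sup>2)) + (h * T) * (2 * K\<^sup>2 * (1 + (norm y)\<^sup>2))"
  proof (intro add_mono order_refl)
    show "2 * h * (y \<bullet> b t y) \<le> 2 * h * (2 * K * (1 + (norm y)\<^sup>2))"
      using 1 assms by (intro mult_left_mono) auto
    show "h\<^sup>2 * (norm (b t y))\<^sup>2 \<le> (h * T) * (2 * K\<^sup>2 * (1 + (norm y)\<^sup>2))"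
      using assms b_growth_sq[OF assms(1), of y] unfolding power2_eq_square[of h]
      by (intro mult_mono) auto
  qed
  finally show ?thesis by (simp add: algebra_simps)
qed

lemma grid_time_mem: "k \<le> m \<Longrightarrow> real k * T / real m \<in> {0..T}"
  using T_pos by (auto simp: divide_le_eq mult_right_mono)

end

locale brownian_sde = lipschitz_sde T b \<sigma> x K + brownian_filtration M F W
  for T b and \<sigma> :: "real \<Rightarrow> real ^ 'd \<Rightarrow> real ^ 'q ^ 'd" and x K and M :: "'w measure" and F and W :: "real \<Rightarrow> 'w \<Rightarrow> real ^ 'q"
begin

abbreviation grid :: "nat \<Rightarrow> nat \<Rightarrow> real" where "grid m k \<equiv> real k * T / real m"

abbreviation E :: "nat \<Rightarrow> nat \<Rightarrow> 'w \<Rightarrow> real ^ 'd" where "E m k \<equiv> euler T b \<sigma> x W m k"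

lemma grid_nonneg: "0 \<le> grid m k" using T_pos by simp

lemma grid_mono: "k \<le> l \<Longrightarrow> grid m k \<le> grid m l"
  using T_pos by (intro divide_right_mono mult_right_mono) auto

lemma grid_Suc: "grid m (Suc k) = grid m k + T / real m"
  by (simp add: add_divide_distrib distrib_right)

lemma grid_refine: "0 < m \<Longrightarrow> grid (n * m) (c * m) = grid n c"
  by simp

lemma euler_Suc: "E m (Suc k) \<omega> = (E m k \<omega> + (T / real m) *\<^sub>R b (grid m k) (E m k \<omega>))
    + \<sigma> (grid m k) (E m k \<omega>) *v (W (grid m (Suc k)) \<omega> - W (grid m k) \<omega>)"
  by (simp add: Let_def)

declare euler.simps(2) [simp del]

lemma euler_adapted: "k \<le> m \<Longrightarrow> E m k \<in> borel_measurable (F (grid m k))"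
proof (induction k)
  case 0
  have "E m 0 = (\<lambda>\<omega>. x)" by (rule ext) simp
  then show ?case by simp
next
  case (Suc k)
  then have km: "k \<le> m" by simp
  have le: "grid m k \<le> grid m (Suc k)" by (intro grid_mono) simp
  note [measurable] = measurable_filtration_mono[OF grid_nonneg le Suc.IH[OF km]]
    adapted[OF grid_nonneg[where m = m and k = "Suc k"]] adapted_le[OF grid_nonneg le]
    b_measurable[OF grid_time_mem[OF km]] \<sigma>_measurable[OF grid_time_mem[OF km]]
  show ?case unfolding euler_Suc[abs_def] by measurable
qed

lemma coeff_adapted:
  assumes "k \<le> m"
  shows "(\<lambda>\<omega>. b (grid m k) (E m k \<omega>)) \<in> borel_measurable (F (grid m k))"
    "(\<lambda>\<omega>. \<sigma> (grid m k) (E m k \<omega>)) \<in> borel_measurable (F (grid m k))"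
  using measurable_compose[OF euler_adapted[OF assms] b_measurable[OF grid_time_mem[OF assms]]]
    measurable_compose[OF euler_adapted[OF assms] \<sigma>_measurable[OF grid_time_mem[OF assms]]] by auto

lemma euler_measurable: "k \<le> m \<Longrightarrow> E m k \<in> borel_measurable M"
  using euler_adapted measurable_filtration_M[OF grid_nonneg] by blast

text \<open>One step multiplies the expectation by at most \<open>1 + C * T / m\<close>, where \<open>C\<close> does not depend on \<open>m\<close>.\<close>

lemma euler_fourth_moment:
  "\<exists>C>0. \<forall>m k. 0 < m \<longrightarrow> k \<le> m \<longrightarrow>
     integrable M (\<lambda>\<omega>. (1 + (norm (E m k \<omega>))\<^sup>2)\<^sup>2) \<and> expectation (\<lambda>\<omega>. (1 + (norm (E m k \<omega>))\<^sup>2)\<^sup>2) \<le> C"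
proof -
  define c where "c = 4 * K + 2 * K\<^sup>2 * T"
  define q where "q = real CARD('q)"
  define C where "C = 2 * c + c\<^sup>2 * T + 16 * q * (1 + c * T) * K\<^sup>2 + 36 * q\<^sup>2 * T * K ^ 4"
  have c0: "0 \<le> c" using K_pos T_pos by (simp add: c_def)
  have q0: "0 \<le> q" by (simp add: q_def)
  have C0: "0 \<le> C" using c0 q0 T_pos by (simp add: C_def)
  have "integrable M (\<lambda>\<omega>. (1 + (norm (E m k \<omega>))\<^sup>2)\<^sup>2) \<and>
    expectation (\<lambda>\<omega>. (1 + (norm (E m k \<omega>))\<^sup>2)\<^sup>2) \<le> (1 + (norm x)\<^sup>2)\<^sup>2 * (1 + C * (T / m)) ^ k"
    if "0 < m" "k \<le> m" for m k
    using that(2)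
  proof (induction k)
    case 0 show ?case by (simp add: prob_space)
  next
    case (Suc k)
    then have km: "k \<le> m" by simp
    define h where "h = T / real m"
    have h: "0 \<le> h" "h \<le> T" "0 < h" using T_pos that by (auto simp: h_def divide_le_eq mult_le_cancel_left1)
    let ?t = "grid m k"
    have t: "?t \<in> {0..T}" using km by (rule grid_time_mem)
    let ?y = "E m k"
    let ?a = "\<lambda>\<omega>. 1 + (norm (?y \<omega>))\<^sup>2"
    let ?u = "\<lambda>\<omega>. ?y \<omega> + h *\<^sub>R b ?t (?y \<omega>)" and ?\<xi> = "\<lambda>\<omega>. \<sigma> ?t (?y \<omega>)"
    have ai: "integrable M (\<lambda>\<omega>. (?a \<omega>)\<^sup>2)" 
      and am: "expectation (\<lambda>\<omega>. (?a \<omega>)\<^sup>2) \<le> (1 + (norm x)\<^sup>2)\<^sup>2 * (1 + C * h) ^ k"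
      using Suc km by (auto simp: h_def)
    note [measurable] = euler_adapted[OF km] b_measurable[OF t] \<sigma>_measurable[OF t]
    have um: "?u \<in> borel_measurable (F ?t)" "?\<xi> \<in> borel_measurable (F ?t)" by measurable
    note [measurable] = measurable_filtration_M[OF grid_nonneg um(1)] measurable_filtration_M[OF grid_nonneg um(2)] euler_measurable[OF km]
    have ua: "1 + (norm (?u \<omega>))\<^sup>2 \<le> (1 + c * h) * ?a \<omega>" for \<omega>
      using drift_step_growth[OF t h(1,2)] by (simp add: c_def)
    have ua2: "(1 + (norm (?u \<omega>))\<^sup>2)\<^sup>2 \<le> (1 + c * h)\<^sup>2 * (?a \<omega>)\<^sup>2" for \<omega>
      using power_mono[OF ua[of \<omega>], of 2] by (simp add: power_mult_distrib)
    have xa: "(norm (?\<xi> \<omega>))\<^sup>2 \<le> 2 * K\<^sup>2 * ?a \<omega>" for \<omega> using \<sigma>_growth_sq[OF t] .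
    have xa4: "(norm (?\<xi> \<omega>)) ^ 4 \<le> 4 * K ^ 4 * (?a \<omega>)\<^sup>2" for \<omega>
      using power_mono[OF xa[of \<omega>], of 2] by (simp add: power_mult_distrib)
    have ux: "(1 + (norm (?u \<omega>))\<^sup>2) * (norm (?\<xi> \<omega>))\<^sup>2 \<le> ((1 + c * h) * 2 * K\<^sup>2) * (?a \<omega>)\<^sup>2" for \<omega>
    proof -
      have "(1 + (norm (?u \<omega>))\<^sup>2) * (norm (?\<xi> \<omega>))\<^sup>2 \<le> ((1 + c * h) * ?a \<omega>) * (2 * K\<^sup>2 * ?a \<omega>)"
        using c0 h by (intro mult_mono ua xa) auto
      moreover have "(p * a) * (2 * K\<^sup>2 * a) = (p * 2 * K\<^sup>2) * a\<^sup>2" for p a by (simp add: power2_eq_square)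
      ultimately show ?thesis by metis
    qed
    have dom: "integrable M f \<and> expectation f \<le> B * expectation (\<lambda>\<omega>. (?a \<omega>)\<^sup>2)"
      if [measurable]: "f \<in> borel_measurable M" and f: "\<And>\<omega>. 0 \<le> f \<omega>" "\<And>\<omega>. f \<omega> \<le> B * (?a \<omega>)\<^sup>2" for f B
    proof -
      have i: "integrable M (\<lambda>\<omega>. B * (?a \<omega>)\<^sup>2)" using ai by simp
      have "integrable M f"
        using f by (intro Bochner_Integration.integrable_bound[OF i]) (auto intro!: AE_I2 intro: order_trans[OF _ abs_ge_self])
      moreover from this have "expectation f \<le> expectation (\<lambda>\<omega>. B * (?a \<omega>)\<^sup>2)" by (intro integral_mono i f)
      ultimately show ?thesis by simp
    qed
    have d1: "integrable M (\<lambda>\<omega>. (1 + (norm (?u \<omega>))\<^sup>2)\<^sup>2) \<and>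
      expectation (\<lambda>\<omega>. (1 + (norm (?u \<omega>))\<^sup>2)\<^sup>2) \<le> (1 + c * h)\<^sup>2 * expectation (\<lambda>\<omega>. (?a \<omega>)\<^sup>2)"
      using ua2 by (intro dom) auto
    have d2: "integrable M (\<lambda>\<omega>. (norm (?\<xi> \<omega>)) ^ 4) \<and>
      expectation (\<lambda>\<omega>. (norm (?\<xi> \<omega>)) ^ 4) \<le> (4 * K ^ 4) * expectation (\<lambda>\<omega>. (?a \<omega>)\<^sup>2)"
      using xa4 by (intro dom) auto
    have d3: "integrable M (\<lambda>\<omega>. (1 + (norm (?u \<omega>))\<^sup>2) * (norm (?\<xi> \<omega>))\<^sup>2) \<and>
      expectation (\<lambda>\<omega>. (1 + (norm (?u \<omega>))\<^sup>2) * (norm (?\<xi> \<omega>))\<^sup>2) \<le> ((1 + c * h) * 2 * K\<^sup>2) * expectation (\<lambda>\<omega>. (?a \<omega>)\<^sup>2)"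
      using ux by (intro dom) auto
    have lt: "grid m k < grid m (Suc k)" and hd: "grid m (Suc k) - grid m k = h"
      using h by (simp_all only: grid_Suc h_def)
    note st = increment_step_L4[OF grid_nonneg lt um conjunct1[OF d1] conjunct1[OF d2], unfolded hd]
    have st2: "expectation (\<lambda>\<omega>. (1 + (norm (?u \<omega> + ?\<xi> \<omega> *v (W (grid m (Suc k)) \<omega> - W ?t \<omega>)))\<^sup>2)\<^sup>2)
      \<le> expectation (\<lambda>\<omega>. (1 + (norm (?u \<omega>))\<^sup>2)\<^sup>2)
        + 8 * q * h * expectation (\<lambda>\<omega>. (1 + (norm (?u \<omega>))\<^sup>2) * (norm (?\<xi> \<omega>))\<^sup>2)
        + 9 * q\<^sup>2 * h\<^sup>2 * expectation (\<lambda>\<omega>. (norm (?\<xi> \<omega>)) ^ 4)"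
      using st(2) by (simp add: q_def)
    let ?A = "expectation (\<lambda>\<omega>. (?a \<omega>)\<^sup>2)"
    have A0: "0 \<le> ?A" by (intro Bochner_Integration.integral_nonneg) auto
    have "expectation (\<lambda>\<omega>. (1 + (norm (E m (Suc k) \<omega>))\<^sup>2)\<^sup>2) \<le> (1 + c * h)\<^sup>2 * ?A + 8 * q * h * (((1 + c * h) * 2 * K\<^sup>2) * ?A)
      + 9 * q\<^sup>2 * h\<^sup>2 * ((4 * K ^ 4) * ?A)"
      unfolding euler_Suc h_def[symmetric]
      using h q0 by (intro order_trans[OF st2] add_mono mult_left_mono conjunct2[OF d1] conjunct2[OF d2] conjunct2[OF d3]) auto
    also have "\<dots> = ((1 + c * h)\<^sup>2 + 8 * q * h * ((1 + c * h) * 2 * K\<^sup>2) + 9 * q\<^sup>2 * h\<^sup>2 * (4 * K ^ 4)) * ?A"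
      by (simp add: algebra_simps)
    also have "\<dots> \<le> (1 + C * h) * ?A"
    proof (intro mult_right_mono A0)
      have hh: "h * h \<le> T * h" using h by (intro mult_right_mono) auto
      have "c\<^sup>2 * (h * h) \<le> c\<^sup>2 * (T * h)" "16 * q * c * K\<^sup>2 * (h * h) \<le> 16 * q * c * K\<^sup>2 * (T * h)"
        "36 * q\<^sup>2 * K ^ 4 * (h * h) \<le> 36 * q\<^sup>2 * K ^ 4 * (T * h)"
        using hh c0 q0 by (auto intro!: mult_left_mono)
      then show "(1 + c * h)\<^sup>2 + 8 * q * h * ((1 + c * h) * 2 * K\<^sup>2) + 9 * q\<^sup>2 * h\<^sup>2 * (4 * K ^ 4) \<le> 1 + C * h"
        unfolding C_def power2_eq_square by (simp add: algebra_simps)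
    qed
    also have "\<dots> \<le> (1 + C * h) * ((1 + (norm x)\<^sup>2)\<^sup>2 * (1 + C * h) ^ k)"
      using am C0 h by (intro mult_left_mono) auto
    finally show ?case
      using st(1) unfolding euler_Suc h_def[symmetric] by (simp add: mult_ac)
  qed
  moreover have "(1 + (norm x)\<^sup>2)\<^sup>2 * (1 + C * (T / m)) ^ k \<le> (1 + (norm x)\<^sup>2)\<^sup>2 * exp (C * T)" if "0 < m" "k \<le> m" for m k :: nat
  proof (intro mult_left_mono)
    have "(1 + C * (T / m)) ^ k \<le> (1 + C * (T / m)) ^ m"
      using that C0 T_pos by (intro power_increasing) auto
    also have "\<dots> \<le> exp (C * (T / m)) ^ m" using C0 T_pos by (intro power_mono) auto
    also have "\<dots> = exp (C * T)" using that by (simp flip: exp_of_nat_mult)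
    finally show "(1 + C * (T / m)) ^ k \<le> exp (C * T)" .
  qed simp
  moreover have "0 < (1 + (norm x)\<^sup>2)\<^sup>2 * exp (C * T)" by (smt (verit) exp_gt_zero mult_pos_pos zero_le_power2 zero_less_power2)
  ultimately show ?thesis
    by (intro exI[of _ "(1 + (norm x)\<^sup>2)\<^sup>2 * exp (C * T)"]) (blast intro: order_trans)
qed

end

section \<open>Euler schemes on nested grids\<close>

context brownian_sde begin

text \<open>The scheme with \<open>n\<close> steps, interpolated to the grid with \<open>n * m\<close> steps. Within each coarse cell
  the coefficients keep their values at its left end point, so that coarse and fine processes have increments
  over the same time intervals and can be subtracted.\<close>

definition frozen :: "nat \<Rightarrow> nat \<Rightarrow> nat \<Rightarrow> 'w \<Rightarrow> real ^ 'd" where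
  "frozen n m j \<omega> = (let c = j div m; t = grid n c; y = E n c \<omega>; s = grid (n * m) j
     in y + (s - t) *\<^sub>R b t y + \<sigma> t y *v (W s \<omega> - W t \<omega>))"

lemma frozen_coarse: "0 < m \<Longrightarrow> frozen n m (c * m) \<omega> = E n c \<omega>"
  by (simp add: frozen_def Let_def)

text \<open>At the last fine step of a coarse cell the interpolation formula reproduces the next value of the coarse
  scheme, so the recursion has the same shape there as inside the cell.\<close>

lemma frozen_Suc:
  assumes "0 < m"
  defines "c \<equiv> \<lambda>j. j div m"
  shows "frozen n m (Suc j) \<omega> = frozen n m j \<omega> + (T / real (n * m)) *\<^sub>R b (grid n (c j)) (E n (c j) \<omega>)
     + \<sigma> (grid n (c j)) (E n (c j) \<omega>) *v (W (grid (n * m) (Suc j)) \<omega> - W (grid (n * m) j) \<omega>)"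
proof -
  let ?t = "grid n (c j)" and ?y = "E n (c j) \<omega>" and ?s = "grid (n * m)"
  have "frozen n m (Suc j) \<omega> = ?y + (?s (Suc j) - ?t) *\<^sub>R b ?t ?y + \<sigma> ?t ?y *v (W (?s (Suc j)) \<omega> - W ?t \<omega>)"
  proof (cases "Suc j mod m = 0")
    case True
    then have d: "Suc j div m = Suc (c j)" by (simp add: div_Suc c_def)
    then have e: "Suc j = Suc (c j) * m" using True by (metis div_mult_mod_eq add.right_neutral)
    have s: "?s (Suc j) = grid n (Suc (c j))" unfolding e using grid_refine[OF \<open>0 < m\<close>] .
    have "frozen n m (Suc j) \<omega> = E n (Suc (c j)) \<omega>" unfolding e using frozen_coarse[OF \<open>0 < m\<close>] .
    also have "\<dots> = ?y + (?s (Suc j) - ?t) *\<^sub>R b ?t ?y + \<sigma> ?t ?y *v (W (?s (Suc j)) \<omega> - W ?t \<omega>)"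
      unfolding s euler_Suc by (simp only: grid_Suc add_diff_cancel_left')
    finally show ?thesis .
  next
    case False
    then have "Suc j div m = c j" by (simp add: div_Suc c_def)
    then show ?thesis unfolding frozen_def Let_def by (simp only:)
  qed
  also have "\<dots> = (?y + (?s j - ?t) *\<^sub>R b ?t ?y + \<sigma> ?t ?y *v (W (?s j) \<omega> - W ?t \<omega>)) + (T / real (n * m)) *\<^sub>R b ?t ?y
     + \<sigma> ?t ?y *v (W (?s (Suc j)) \<omega> - W (?s j) \<omega>)"
  proof -
    have e: "?s (Suc j) - ?t = (?s j - ?t) + T / real (n * m)" by (simp only: grid_Suc)
    show ?thesis unfolding e scaleR_left_distrib matrix_vector_mult_diff_distrib by simp
  qed
  also have "?y + (?s j - ?t) *\<^sub>R b ?t ?y + \<sigma> ?t ?y *v (W (?s j) \<omega> - W ?t \<omega>) = frozen n m j \<omega>"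
    unfolding frozen_def Let_def c_def ..
  finally show ?thesis .
qed

lemma block_bounds:
  assumes "0 < m"
  shows "grid n (j div m) \<le> grid (n * m) j" "grid (n * m) j \<le> grid n (j div m) + T / real n"
proof -
  have 1: "j div m * m \<le> j" by simp
  have 2: "j \<le> Suc (j div m) * m"
    using assms by (metis dividend_less_div_times less_imp_le mult.commute mult_Suc)
  show "grid n (j div m) \<le> grid (n * m) j"
    using grid_mono[OF 1, of "n * m"] unfolding grid_refine[OF assms] .
  show "grid (n * m) j \<le> grid n (j div m) + T / real n"
    using grid_mono[OF 2, of "n * m"] unfolding grid_refine[OF assms] grid_Suc .
qed

lemma integrable_fourth_dominated:
  assumes "0 < n" "k \<le> n" and [measurable]: "f \<in> borel_measurable M"
    and f: "\<And>\<omega>. 0 \<le> f \<omega>" "\<And>\<omega>. f \<omega> \<le> B * (1 + (norm (E n k \<omega>))\<^sup>2)\<^sup>2"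
  shows "integrable M f" "expectation f \<le> B * expectation (\<lambda>\<omega>. (1 + (norm (E n k \<omega>))\<^sup>2)\<^sup>2)"
proof -
  have "integrable M (\<lambda>\<omega>. (1 + (norm (E n k \<omega>))\<^sup>2)\<^sup>2)" using euler_fourth_moment assms by blast
  then have i: "integrable M (\<lambda>\<omega>. B * (1 + (norm (E n k \<omega>))\<^sup>2)\<^sup>2)" by simp
  show "integrable M f"
    using f by (intro Bochner_Integration.integrable_bound[OF i]) (auto intro!: AE_I2 intro: order_trans[OF _ abs_ge_self])
  then have "expectation f \<le> expectation (\<lambda>\<omega>. B * (1 + (norm (E n k \<omega>))\<^sup>2)\<^sup>2)" by (intro integral_mono i f)
  then show "expectation f \<le> B * expectation (\<lambda>\<omega>. (1 + (norm (E n k \<omega>))\<^sup>2)\<^sup>2)" by simp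
qed

lemma coeff_square_le:
  assumes "t \<in> {0..T}"
  shows "(norm (b t y))\<^sup>2 \<le> 2 * K\<^sup>2 * (1 + (norm y)\<^sup>2)\<^sup>2" "(norm (\<sigma> t y))\<^sup>2 \<le> 2 * K\<^sup>2 * (1 + (norm y)\<^sup>2)\<^sup>2"
  using order_trans[OF b_growth_sq[OF assms, of y] mult_left_mono[OF le_own_square[of "norm y"], of "2 * K\<^sup>2"]]
    order_trans[OF \<sigma>_growth_sq[OF assms, of y] mult_left_mono[OF le_own_square[of "norm y"], of "2 * K\<^sup>2"]] by auto

lemma coeff_euler_L2:
  assumes "0 < n" "k \<le> n"
  shows "integrable M (\<lambda>\<omega>. (norm (b (grid n k) (E n k \<omega>)))\<^sup>2)"
    "integrable M (\<lambda>\<omega>. (norm (\<sigma> (grid n k) (E n k \<omega>)))\<^sup>2)"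
proof -
  have t: "grid n k \<in> {0..T}" using assms(2) by (rule grid_time_mem)
  note [measurable] = measurable_filtration_M[OF grid_nonneg coeff_adapted(1)[OF assms(2)]]
    measurable_filtration_M[OF grid_nonneg coeff_adapted(2)[OF assms(2)]]
  show "integrable M (\<lambda>\<omega>. (norm (b (grid n k) (E n k \<omega>)))\<^sup>2)"
    "integrable M (\<lambda>\<omega>. (norm (\<sigma> (grid n k) (E n k \<omega>)))\<^sup>2)"
    using coeff_square_le[OF t] by (intro integrable_fourth_dominated(1)[OF assms, where B = "2 * K\<^sup>2"]; simp)+
qed

lemma euler_L2:
  assumes "0 < n" "k \<le> n"
  shows "integrable M (\<lambda>\<omega>. (norm (E n k \<omega>))\<^sup>2)"
proof -
  note [measurable] = euler_measurable[OF assms(2)]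
  have "(norm y)\<^sup>2 \<le> 1 * (1 + (norm y)\<^sup>2)\<^sup>2" for y :: "real ^ 'd" using le_own_square[of "norm y"] by linarith
  then show ?thesis by (intro integrable_fourth_dominated(1)[OF assms, where B = 1]) auto
qed

text \<open>The fine process \<open>Q\<close> is left general since two processes are compared with the coarse scheme: the
  Euler scheme of the fine grid, and localized Riemann sums of the solution.\<close>

lemma frozen_compare:
  fixes Q \<beta> :: "nat \<Rightarrow> 'w \<Rightarrow> real ^ 'd" and \<tau> :: "nat \<Rightarrow> 'w \<Rightarrow> real ^ 'q ^ 'd"
  assumes nm: "0 < n" "0 < m" "k \<le> n * m"
    and Q0: "\<And>\<omega>. \<omega> \<in> space M \<Longrightarrow> Q 0 \<omega> = x"
    and step: "\<And>j \<omega>. j < k \<Longrightarrow> \<omega> \<in> space M \<Longrightarrow>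
      Q (Suc j) \<omega> = Q j \<omega> + (T / real (n * m)) *\<^sub>R \<beta> j \<omega> + \<tau> j \<omega> *v (W (grid (n * m) (Suc j)) \<omega> - W (grid (n * m) j) \<omega>)"
    and \<beta>: "\<And>j. j < k \<Longrightarrow> \<beta> j \<in> borel_measurable (F (grid (n * m) j))" "\<And>j. j < k \<Longrightarrow> integrable M (\<lambda>\<omega>. (norm (\<beta> j \<omega>))\<^sup>2)"
    and \<tau>: "\<And>j. j < k \<Longrightarrow> \<tau> j \<in> borel_measurable (F (grid (n * m) j))" "\<And>j. j < k \<Longrightarrow> integrable M (\<lambda>\<omega>. (norm (\<tau> j \<omega>))\<^sup>2)"
    and A: "\<And>j. j < k \<Longrightarrow> A j \<in> sets (F (grid (n * m) j))" "\<And>j. j < k \<Longrightarrow> A (Suc j) \<subseteq> A j" "A k \<in> sets M"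
  defines "db \<equiv> \<lambda>j \<omega>. b (grid n (j div m)) (E n (j div m) \<omega>) - \<beta> j \<omega>"
    and "ds \<equiv> \<lambda>j \<omega>. \<sigma> (grid n (j div m)) (E n (j div m) \<omega>) - \<tau> j \<omega>"
  shows "integrable M (\<lambda>\<omega>. (norm (frozen n m k \<omega> - Q k \<omega>))\<^sup>2)"
    and "expectation (\<lambda>\<omega>. indicat_real (A k) \<omega> * (norm (frozen n m k \<omega> - Q k \<omega>))\<^sup>2) \<le>
      exp T * (1 + T + CARD('q)) *
      (\<Sum>j<k. (T / real (n * m)) * expectation (\<lambda>\<omega>. indicat_real (A j) \<omega> * ((norm (db j \<omega>))\<^sup>2 + (norm (ds j \<omega>))\<^sup>2)))"
    and "\<And>j. j < k \<Longrightarrow> integrable M (\<lambda>\<omega>. (norm (db j \<omega>))\<^sup>2)" "\<And>j. j < k \<Longrightarrow> integrable M (\<lambda>\<omega>. (norm (ds j \<omega>))\<^sup>2)"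
proof -
  define h where "h = T / real (n * m)"
  have h: "0 < h" using nm T_pos by (simp add: h_def)
  have "0 < n * m" using nm by simp
  then have "1 \<le> real (n * m)" by linarith
  then have hT: "h \<le> T" using T_pos divide_left_mono[of 1 "real (n * m)" T] by (simp add: h_def)
  let ?D = "\<lambda>j \<omega>. frozen n m j \<omega> - Q j \<omega>"
  have c: "j div m \<le> n" if "j < k" for j
    using that nm by (metis div_le_mono div_mult_self_is_m less_imp_le order_trans)
  have ad: "db j \<in> borel_measurable (F (grid (n * m) j))" "ds j \<in> borel_measurable (F (grid (n * m) j))" if "j < k" for j
    unfolding db_def ds_def using that \<beta>(1) \<tau>(1)
    by (intro borel_measurable_diff measurable_filtration_mono[OF grid_nonneg block_bounds(1)[OF nm(2)] coeff_adapted(1)[OF c]]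
      measurable_filtration_mono[OF grid_nonneg block_bounds(1)[OF nm(2)] coeff_adapted(2)[OF c]]; simp)+
  have adM: "db j \<in> borel_measurable M" "ds j \<in> borel_measurable M" if "j < k" for j
    using measurable_filtration_M[OF grid_nonneg ad(1)[OF that]] measurable_filtration_M[OF grid_nonneg ad(2)[OF that]] by auto
  show L2: "integrable M (\<lambda>\<omega>. (norm (db j \<omega>))\<^sup>2)" "integrable M (\<lambda>\<omega>. (norm (ds j \<omega>))\<^sup>2)" if "j < k" for j
    unfolding db_def ds_def using coeff_euler_L2[OF nm(1) c[OF that]] \<beta>(2)[OF that] \<tau>(2)[OF that]
      adM[OF that] unfolding db_def ds_def by (intro square_integrable_diff; simp)+
  have D0: "?D 0 \<omega> = 0" if "\<omega> \<in> space M" for \<omega>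
    using Q0[OF that] frozen_coarse[OF nm(2), of n 0 \<omega>] by simp
  have st: "?D (Suc j) \<omega> = ?D j \<omega> + h *\<^sub>R db j \<omega> + ds j \<omega> *v (W (grid (n * m) (Suc j)) \<omega> - W (grid (n * m) j) \<omega>)"
    if "j < k" "\<omega> \<in> space M" for j \<omega>
    unfolding step[OF that] frozen_Suc[OF nm(2)] db_def ds_def h_def matrix_vector_mult_diff_rdistrib
    by (simp add: scaleR_diff_right)
  note S = stability[where s = "grid (n * m)" and D = ?D and \<beta> = db and \<sigma> = ds and A = A and k = k, OF h grid_nonneg
     grid_Suc[where m = "n * m", folded h_def] D0 st ad(1) L2(1) ad(2) L2(2) A, simplified]
  show "integrable M (\<lambda>\<omega>. (norm (?D k \<omega>))\<^sup>2)" by (rule S(2))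
  let ?e = "\<lambda>j. expectation (\<lambda>\<omega>. indicat_real (A j) \<omega> * ((norm (db j \<omega>))\<^sup>2 + (norm (ds j \<omega>))\<^sup>2))"
  have "expectation (\<lambda>\<omega>. indicat_real (A k) \<omega> * (norm (?D k \<omega>))\<^sup>2)
    \<le> exp (h * real k) * (\<Sum>j<k. (1 + h + CARD('q)) * h * ?e j)" by (rule S(3))
  also have "\<dots> \<le> exp T * (\<Sum>j<k. (1 + T + CARD('q)) * h * ?e j)"
  proof (intro mult_mono sum_mono sum_nonneg)
    have "h * real k \<le> h * real (n * m)" using h nm(3) by (intro mult_left_mono) (simp_all only: of_nat_le_iff less_imp_le)
    also have "\<dots> = T" using nm by (simp add: h_def)
    finally show "exp (h * real k) \<le> exp T" by simp
    show "0 \<le> ?e j" for j by (intro Bochner_Integration.integral_nonneg) auto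
    then show "0 \<le> (1 + h + real CARD('q)) * h * ?e j" for j
      using h by (intro mult_nonneg_nonneg) auto
  qed (use h hT T_pos in \<open>auto intro!: Bochner_Integration.integral_nonneg\<close>)
  also have "\<dots> = exp T * (1 + T + CARD('q)) * (\<Sum>j<k. h * ?e j)"
    by (simp add: sum_distrib_left mult_ac)
  finally show "expectation (\<lambda>\<omega>. indicat_real (A k) \<omega> * (norm (?D k \<omega>))\<^sup>2) \<le>
      exp T * (1 + T + CARD('q)) * (\<Sum>j<k. (T / real (n * m)) * ?e j)" unfolding h_def .
qed

text \<open>Within a coarse cell the interpolated scheme moves by the order of the square root of the step.\<close>

lemma frozen_increment_L2:
  assumes nm: "0 < n" "0 < m" "j \<le> n * m"
    and C: "\<And>k. k \<le> n \<Longrightarrow> expectation (\<lambda>\<omega>. (1 + (norm (E n k \<omega>))\<^sup>2)\<^sup>2) \<le> C"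
  shows "integrable M (\<lambda>\<omega>. (norm (frozen n m j \<omega> - E n (j div m) \<omega>))\<^sup>2)"
    and "expectation (\<lambda>\<omega>. (norm (frozen n m j \<omega> - E n (j div m) \<omega>))\<^sup>2) \<le> (T + CARD('q)) * (2 * K\<^sup>2) * C * (T / real n)"
proof -
  have c: "j div m \<le> n" using nm by (metis div_le_mono div_mult_self_is_m)
  let ?t = "grid n (j div m)" and ?s = "grid (n * m) j"
  note bb = block_bounds[OF nm(2), where n = n and j = j]
  have tT: "?t \<in> {0..T}" using c by (rule grid_time_mem)
  let ?b = "\<lambda>\<omega>. b ?t (E n (j div m) \<omega>)" and ?\<sigma> = "\<lambda>\<omega>. \<sigma> ?t (E n (j div m) \<omega>)"
  note ad = coeff_adapted[OF c]
  note L2 = coeff_euler_L2[OF nm(1) c]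
  note [measurable] = ad
  have um: "(\<lambda>\<omega>. (?s - ?t) *\<^sub>R ?b \<omega>) \<in> borel_measurable (F ?t)" by measurable
  have ui: "integrable M (\<lambda>\<omega>. (norm ((?s - ?t) *\<^sub>R ?b \<omega>))\<^sup>2)" using L2(1) by (simp add: power_mult_distrib)
  note st = increment_step_L2[OF grid_nonneg bb(1) um ad(2) ui L2(2)]
  have eq: "frozen n m j \<omega> - E n (j div m) \<omega> = (?s - ?t) *\<^sub>R ?b \<omega> + ?\<sigma> \<omega> *v (W ?s \<omega> - W ?t \<omega>)" for \<omega>
    by (simp add: frozen_def Let_def)
  show "integrable M (\<lambda>\<omega>. (norm (frozen n m j \<omega> - E n (j div m) \<omega>))\<^sup>2)" unfolding eq by (rule st(1))
  have C0: "0 \<le> C" using C[of 0] by (smt (verit) Bochner_Integration.integral_nonneg zero_le_power2 zero_le)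
  note mM = measurable_filtration_M[OF grid_nonneg ad(1)] measurable_filtration_M[OF grid_nonneg ad(2)]
  have Eb: "expectation (\<lambda>\<omega>. (norm (?b \<omega>))\<^sup>2) \<le> 2 * K\<^sup>2 * C"
    using mM coeff_square_le[OF tT]
    by (intro order_trans[OF integrable_fourth_dominated(2)[OF nm(1) c] mult_left_mono[OF C[OF c]]]) auto
  have Es: "expectation (\<lambda>\<omega>. (norm (?\<sigma> \<omega>))\<^sup>2) \<le> 2 * K\<^sup>2 * C"
    using mM coeff_square_le[OF tT]
    by (intro order_trans[OF integrable_fourth_dominated(2)[OF nm(1) c] mult_left_mono[OF C[OF c]]]) auto
  have d: "0 \<le> ?s - ?t" "?s - ?t \<le> T / real n" using bb by simp_all
  have nT: "T / real n \<le> T" using nm T_pos by (simp add: field_simps)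
  have "expectation (\<lambda>\<omega>. (norm (frozen n m j \<omega> - E n (j div m) \<omega>))\<^sup>2)
    \<le> (?s - ?t)\<^sup>2 * expectation (\<lambda>\<omega>. (norm (?b \<omega>))\<^sup>2) + CARD('q) * (?s - ?t) * expectation (\<lambda>\<omega>. (norm (?\<sigma> \<omega>))\<^sup>2)"
    unfolding eq using st(2) by (simp add: power_mult_distrib)
  also have "\<dots> \<le> (T * (T / real n)) * (2 * K\<^sup>2 * C) + CARD('q) * (T / real n) * (2 * K\<^sup>2 * C)"
    using d nT T_pos Eb Es C0 unfolding power2_eq_square[of "?s - ?t"]
    by (intro add_mono mult_mono) (auto intro!: Bochner_Integration.integral_nonneg)
  finally show "expectation (\<lambda>\<omega>. (norm (frozen n m j \<omega> - E n (j div m) \<omega>))\<^sup>2) \<le> (T + CARD('q)) * (2 * K\<^sup>2) * C * (T / real n)"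
    by (simp add: algebra_simps)
qed

text \<open>The difference of the coefficients is split into an increment in time, the movement within a coarse cell,
  and the error itself. The first is small by \<open>uniform_modulus\<close>, the second by \<open>frozen_increment_L2\<close>, and
  the third is handled by Gronwall's lemma.\<close>

lemma euler_refinement_L2:
  assumes "0 < \<epsilon>"
  shows "\<exists>n0>0. \<forall>n\<ge>n0. \<forall>m>0. integrable M (\<lambda>\<omega>. (norm (E n n \<omega> - E (n * m) (n * m) \<omega>))\<^sup>2) \<and>
     expectation (\<lambda>\<omega>. (norm (E n n \<omega> - E (n * m) (n * m) \<omega>))\<^sup>2) \<le> \<epsilon>"
proof -
  obtain C where C: "0 < C" "\<And>m k. 0 < m \<Longrightarrow> k \<le> m \<Longrightarrow> integrable M (\<lambda>\<omega>. (1 + (norm (E m k \<omega>))\<^sup>2)\<^sup>2)"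
    "\<And>m k. 0 < m \<Longrightarrow> k \<le> m \<Longrightarrow> expectation (\<lambda>\<omega>. (1 + (norm (E m k \<omega>))\<^sup>2)\<^sup>2) \<le> C"
    using euler_fourth_moment by blast
  define G where "G = exp T * (1 + T + CARD('q))"
  define B where "B = (T + CARD('q)) * (2 * K\<^sup>2) * C * T"
  define \<Lambda> where "\<Lambda> = exp (6 * G * K\<^sup>2 * T)"
  have G: "0 < G" using T_pos by (simp add: G_def)
  have B: "0 \<le> B" using T_pos C by (simp add: B_def)
  have \<Lambda>: "0 < \<Lambda>" by (simp add: \<Lambda>_def)
  \<comment> \<open>the error bound reads \<open>6 G T \<Lambda> (\<eta> C + K\<^sup>2 B / n)\<close>, and each part is made at most \<open>\<epsilon> / 2\<close>\<close>
  define \<eta> where "\<eta> = \<epsilon> / (12 * G * T * \<Lambda> * C)"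
  have \<eta>: "0 < \<eta>" using assms G T_pos \<Lambda> C by (simp add: \<eta>_def)
  obtain \<delta>1 where \<delta>1: "0 < \<delta>1" "\<And>s t y. s \<in> {0..T} \<Longrightarrow> t \<in> {0..T} \<Longrightarrow> \<bar>s - t\<bar> < \<delta>1 \<Longrightarrow>
     (norm (b s y - b t y))\<^sup>2 \<le> \<eta> * (1 + (norm y)\<^sup>2)\<^sup>2"
    using uniform_modulus[OF b_cont K_pos b_growth \<eta>] by blast
  obtain \<delta>2 where \<delta>2: "0 < \<delta>2" "\<And>s t y. s \<in> {0..T} \<Longrightarrow> t \<in> {0..T} \<Longrightarrow> \<bar>s - t\<bar> < \<delta>2 \<Longrightarrow>
     (norm (\<sigma> s y - \<sigma> t y))\<^sup>2 \<le> \<eta> * (1 + (norm y)\<^sup>2)\<^sup>2"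
    using uniform_modulus[OF \<sigma>_cont K_pos \<sigma>_growth \<eta>] by blast
  obtain n1 where n1: "0 < n1" "T / real n1 < min \<delta>1 \<delta>2"
  proof -
    obtain k :: nat where "T / min \<delta>1 \<delta>2 < real k" using reals_Archimedean2 by blast
    moreover from this have "0 < k" using T_pos \<delta>1(1) \<delta>2(1) by (metis divide_pos_pos less_trans min_less_iff_conj of_nat_0_less_iff)
    moreover have "0 < min \<delta>1 \<delta>2" using \<delta>1(1) \<delta>2(1) by simp
    ultimately have "T / real k < min \<delta>1 \<delta>2" by (simp only: pos_divide_less_eq of_nat_0_less_iff mult.commute)
    with \<open>0 < k\<close> show ?thesis using that[of k] by blast
  qed
  obtain n2 :: nat where n2: "12 * G * T * \<Lambda> * K\<^sup>2 * B / \<epsilon> \<le> real n2" using real_arch_simple by blast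
  show ?thesis
  proof (intro exI[of _ "max n1 n2"] conjI allI impI)
    show "0 < max n1 n2" using n1 by simp
    fix n m :: nat assume n: "max n1 n2 \<le> n" and m: "0 < m"
    then have n0: "0 < n" using n1 by simp
    define N where "N = n * m"
    have N: "0 < N" using n0 m by (simp add: N_def)
    define h where "h = T / real N"
    have h: "0 < h" using N T_pos by (simp add: h_def)
    have nd: "T / real n < min \<delta>1 \<delta>2"
      using n n1 T_pos by (intro le_less_trans[OF _ n1(2)] divide_left_mono) auto
    let ?P = "frozen n m" and ?Q = "E N"
    let ?c = "\<lambda>j. j div m"
    let ?d = "\<lambda>k. expectation (\<lambda>\<omega>. (norm (?P k \<omega> - ?Q k \<omega>))\<^sup>2)"
    define db where "db j \<omega> = b (grid n (j div m)) (E n (j div m) \<omega>) - b (grid N j) (E N j \<omega>)" for j \<omega>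
    define ds where "ds j \<omega> = \<sigma> (grid n (j div m)) (E n (j div m) \<omega>) - \<sigma> (grid N j) (E N j \<omega>)" for j \<omega>
    have cmp: "integrable M (\<lambda>\<omega>. (norm (?P k \<omega> - ?Q k \<omega>))\<^sup>2)"
       "?d k \<le> G * (\<Sum>j<k. h * expectation (\<lambda>\<omega>. (norm (db j \<omega>))\<^sup>2 + (norm (ds j \<omega>))\<^sup>2))"
       "\<And>j. j < k \<Longrightarrow> integrable M (\<lambda>\<omega>. (norm (db j \<omega>))\<^sup>2)" "\<And>j. j < k \<Longrightarrow> integrable M (\<lambda>\<omega>. (norm (ds j \<omega>))\<^sup>2)"
      if k: "k \<le> N" for k
    proof -
      note * = frozen_compare[OF n0 m k[unfolded N_def], of ?Q "\<lambda>j \<omega>. b (grid N j) (E N j \<omega>)" "\<lambda>j \<omega>. \<sigma> (grid N j) (E N j \<omega>)" "\<lambda>j. space M",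
        folded N_def db_def ds_def h_def G_def, OF _ euler_Suc[of N, folded h_def] coeff_adapted(1) coeff_euler_L2(1)[OF N] coeff_adapted(2) coeff_euler_L2(2)[OF N]]
      have sp: "space M \<in> sets (F (grid N j))" for j using sets.top[of "F (grid N j)"] space_filtration[OF grid_nonneg] by simp
      have ind: "expectation (\<lambda>\<omega>. indicat_real (space M) \<omega> * f \<omega>) = expectation f" for f
        by (intro Bochner_Integration.integral_cong) auto
      show "integrable M (\<lambda>\<omega>. (norm (?P k \<omega> - ?Q k \<omega>))\<^sup>2)"
        "?d k \<le> G * (\<Sum>j<k. h * expectation (\<lambda>\<omega>. (norm (db j \<omega>))\<^sup>2 + (norm (ds j \<omega>))\<^sup>2))"
        "\<And>j. j < k \<Longrightarrow> integrable M (\<lambda>\<omega>. (norm (db j \<omega>))\<^sup>2)" "\<And>j. j < k \<Longrightarrow> integrable M (\<lambda>\<omega>. (norm (ds j \<omega>))\<^sup>2)"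
        using *[unfolded ind] k sp by auto
    qed
    have pw: "(norm (db j \<omega>))\<^sup>2 \<le> 3 * (\<eta> * (1 + (norm (E n (?c j) \<omega>))\<^sup>2)\<^sup>2 + K\<^sup>2 * (norm (?P j \<omega> - E n (?c j) \<omega>))\<^sup>2
         + K\<^sup>2 * (norm (?P j \<omega> - ?Q j \<omega>))\<^sup>2)"
       "(norm (ds j \<omega>))\<^sup>2 \<le> 3 * (\<eta> * (1 + (norm (E n (?c j) \<omega>))\<^sup>2)\<^sup>2 + K\<^sup>2 * (norm (?P j \<omega> - E n (?c j) \<omega>))\<^sup>2
         + K\<^sup>2 * (norm (?P j \<omega> - ?Q j \<omega>))\<^sup>2)" if j: "j \<le> N" for j \<omega>
    proof -
      have c: "?c j \<le> n" using j m unfolding N_def by (metis div_le_mono div_mult_self_is_m)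
      let ?t = "grid n (?c j)" and ?s = "grid N j" and ?y = "E n (?c j) \<omega>"
      have t: "?t \<in> {0..T}" "?s \<in> {0..T}" using c j by (auto intro: grid_time_mem simp del: atLeastAtMost_iff)
      have ts: "\<bar>?t - ?s\<bar> < \<delta>1" "\<bar>?t - ?s\<bar> < \<delta>2"
        using block_bounds[OF m, where n = n and j = j] nd unfolding N_def by auto
      have sq: "a\<^sup>2 \<le> K\<^sup>2 * r\<^sup>2" if "a \<le> K * r" "0 \<le> a" for a r :: real
        using power_mono[OF that, of 2] by (simp add: power_mult_distrib)
      have e: "db j \<omega> = (b ?t ?y - b ?s ?y) + (b ?s ?y - b ?s (?P j \<omega>)) + (b ?s (?P j \<omega>) - b ?s (?Q j \<omega>))"
        "ds j \<omega> = (\<sigma> ?t ?y - \<sigma> ?s ?y) + (\<sigma> ?s ?y - \<sigma> ?s (?P j \<omega>)) + (\<sigma> ?s (?P j \<omega>) - \<sigma> ?s (?Q j \<omega>))"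
        by (simp_all add: db_def ds_def)
      show "(norm (db j \<omega>))\<^sup>2 \<le> 3 * (\<eta> * (1 + (norm ?y)\<^sup>2)\<^sup>2 + K\<^sup>2 * (norm (?P j \<omega> - ?y))\<^sup>2 + K\<^sup>2 * (norm (?P j \<omega> - ?Q j \<omega>))\<^sup>2)"
        unfolding e(1) using \<delta>1(2)[OF t ts(1), of ?y] sq[OF b_lip[OF t(2), of ?y "?P j \<omega>"]] sq[OF b_lip[OF t(2), of "?P j \<omega>" "?Q j \<omega>"]]
        by (intro order_trans[OF sum_three_sq] mult_left_mono add_mono) (simp_all add: norm_minus_commute)
      show "(norm (ds j \<omega>))\<^sup>2 \<le> 3 * (\<eta> * (1 + (norm ?y)\<^sup>2)\<^sup>2 + K\<^sup>2 * (norm (?P j \<omega> - ?y))\<^sup>2 + K\<^sup>2 * (norm (?P j \<omega> - ?Q j \<omega>))\<^sup>2)"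
        unfolding e(2) using \<delta>2(2)[OF t ts(2), of ?y] sq[OF \<sigma>_lip[OF t(2), of ?y "?P j \<omega>"]] sq[OF \<sigma>_lip[OF t(2), of "?P j \<omega>" "?Q j \<omega>"]]
        by (intro order_trans[OF sum_three_sq] mult_left_mono add_mono) (simp_all add: norm_minus_commute)
    qed
    have ex: "expectation (\<lambda>\<omega>. (norm (db j \<omega>))\<^sup>2 + (norm (ds j \<omega>))\<^sup>2) \<le> 6 * (\<eta> * C + K\<^sup>2 * (B / real n) + K\<^sup>2 * ?d j)"
      if j: "j < N" for j
    proof -
      have c: "?c j \<le> n" using j m unfolding N_def by (metis div_le_mono div_mult_self_is_m less_imp_le)
      have j': "j \<le> n * m" using j by (simp add: N_def)
      note fi = frozen_increment_L2[OF n0 m j' C(3)[OF n0]]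
      let ?R = "\<lambda>\<omega>. 6 * (\<eta> * (1 + (norm (E n (?c j) \<omega>))\<^sup>2)\<^sup>2 + K\<^sup>2 * (norm (?P j \<omega> - E n (?c j) \<omega>))\<^sup>2
         + K\<^sup>2 * (norm (?P j \<omega> - ?Q j \<omega>))\<^sup>2)"
      have "expectation (\<lambda>\<omega>. (norm (db j \<omega>))\<^sup>2 + (norm (ds j \<omega>))\<^sup>2) \<le> expectation ?R"
      proof (rule integral_mono)
        show "integrable M (\<lambda>\<omega>. (norm (db j \<omega>))\<^sup>2 + (norm (ds j \<omega>))\<^sup>2)"
          using cmp(3,4)[of "Suc j" j] j by auto
        show "integrable M ?R" using C(2)[OF n0 c] fi(1) cmp(1)[of j] j by simp
        show "(norm (db j \<omega>))\<^sup>2 + (norm (ds j \<omega>))\<^sup>2 \<le> ?R \<omega>" for \<omega>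
          using pw[of j \<omega>] j by linarith
      qed
      also have "\<dots> = 6 * (\<eta> * expectation (\<lambda>\<omega>. (1 + (norm (E n (?c j) \<omega>))\<^sup>2)\<^sup>2)
          + K\<^sup>2 * expectation (\<lambda>\<omega>. (norm (?P j \<omega> - E n (?c j) \<omega>))\<^sup>2) + K\<^sup>2 * ?d j)"
        using C(2)[OF n0 c] fi(1) cmp(1)[of j] j by simp
      also have "\<dots> \<le> 6 * (\<eta> * C + K\<^sup>2 * (B / real n) + K\<^sup>2 * ?d j)"
        using C(3)[OF n0 c] fi(2) \<eta>
        by (intro mult_left_mono add_mono order_refl) (auto simp: B_def)
      finally show ?thesis .
    qed
    define \<alpha> where "\<alpha> = 6 * G * T * (\<eta> * C + K\<^sup>2 * (B / real n))"
    have \<alpha>0: "0 \<le> \<alpha>" using G T_pos \<eta> C B by (simp add: \<alpha>_def)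
    have "?d N \<le> \<alpha> * exp ((6 * G * K\<^sup>2 * h) * real N)"
    proof (rule discrete_gronwall_sum[where n = N and a = ?d])
      fix k assume k: "k \<le> N"
      have "?d k \<le> G * (\<Sum>j<k. h * (6 * (\<eta> * C + K\<^sup>2 * (B / real n) + K\<^sup>2 * ?d j)))"
        using k h G by (intro order_trans[OF cmp(2)[OF k]] mult_left_mono sum_mono ex) auto
      also have "\<dots> = 6 * G * (h * real k) * (\<eta> * C + K\<^sup>2 * (B / real n)) + 6 * G * K\<^sup>2 * h * (\<Sum>j<k. ?d j)"
        by (simp add: sum.distrib sum_distrib_left distrib_left mult_ac)
      also have "\<dots> \<le> \<alpha> + 6 * G * K\<^sup>2 * h * (\<Sum>j<k. ?d j)"
      proof -
        have "h * real k \<le> h * real N" using h k by (intro mult_left_mono) auto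
        also have "\<dots> = T" using N by (simp add: h_def)
        finally have "6 * G * (h * real k) * (\<eta> * C + K\<^sup>2 * (B / real n)) \<le> 6 * G * T * (\<eta> * C + K\<^sup>2 * (B / real n))"
          using G \<eta> C B by (intro mult_right_mono mult_left_mono) auto
        then show ?thesis by (simp add: \<alpha>_def)
      qed
      finally show "?d k \<le> \<alpha> + (6 * G * K\<^sup>2 * h) * (\<Sum>j<k. ?d j)" .
    qed (use G h \<alpha>0 in auto)
    also have "(6 * G * K\<^sup>2 * h) * real N = 6 * G * K\<^sup>2 * T" using N by (simp add: h_def)
    also have "\<alpha> * exp (6 * G * K\<^sup>2 * T) = 6 * G * T * \<Lambda> * \<eta> * C + 6 * G * T * \<Lambda> * K\<^sup>2 * B / real n"
      by (simp add: \<alpha>_def \<Lambda>_def algebra_simps)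
    also have "6 * G * T * \<Lambda> * \<eta> * C = \<epsilon> / 2"
      using G T_pos \<Lambda> C by (simp add: \<eta>_def)
    also have "6 * G * T * \<Lambda> * K\<^sup>2 * B / real n \<le> \<epsilon> / 2"
    proof -
      have "12 * G * T * \<Lambda> * K\<^sup>2 * B / \<epsilon> \<le> real n" using n n2 by linarith
      then show ?thesis using assms n0 by (simp add: field_simps)
    qed
    finally have "?d N \<le> \<epsilon>" by simp
    moreover have "?P N \<omega> = E n n \<omega>" for \<omega> unfolding N_def by (rule frozen_coarse[OF m])
    ultimately show "integrable M (\<lambda>\<omega>. (norm (E n n \<omega> - E (n * m) (n * m) \<omega>))\<^sup>2)"
      "expectation (\<lambda>\<omega>. (norm (E n n \<omega> - E (n * m) (n * m) \<omega>))\<^sup>2) \<le> \<epsilon>"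
      using cmp(1)[of N] by (simp_all add: N_def)
  qed
qed

text \<open>Schemes with \<open>n\<close> and \<open>n'\<close> steps are both close to the scheme with \<open>n * n'\<close> steps.\<close>

lemma euler_cauchy_L2:
  assumes "0 < \<epsilon>"
  shows "\<exists>n0>0. \<forall>n\<ge>n0. \<forall>n'\<ge>n0. integrable M (\<lambda>\<omega>. (norm (E n n \<omega> - E n' n' \<omega>))\<^sup>2) \<and>
     expectation (\<lambda>\<omega>. (norm (E n n \<omega> - E n' n' \<omega>))\<^sup>2) \<le> \<epsilon>"
proof -
  obtain n0 where n0: "0 < n0"
    "\<And>n m. n0 \<le> n \<Longrightarrow> 0 < m \<Longrightarrow> integrable M (\<lambda>\<omega>. (norm (E n n \<omega> - E (n * m) (n * m) \<omega>))\<^sup>2)"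
    "\<And>n m. n0 \<le> n \<Longrightarrow> 0 < m \<Longrightarrow> expectation (\<lambda>\<omega>. (norm (E n n \<omega> - E (n * m) (n * m) \<omega>))\<^sup>2) \<le> \<epsilon> / 4"
    using euler_refinement_L2[of "\<epsilon> / 4"] assms by auto
  show ?thesis
  proof (intro exI[of _ n0] conjI allI impI n0(1))
    fix n n' assume n: "n0 \<le> n" "n0 \<le> n'"
    then have pos: "0 < n" "0 < n'" using n0(1) by auto
    note [measurable] = euler_measurable[OF order_refl, of n] euler_measurable[OF order_refl, of n']
    let ?R = "\<lambda>\<omega>. 2 * (norm (E n n \<omega> - E (n * n') (n * n') \<omega>))\<^sup>2 + 2 * (norm (E n' n' \<omega> - E (n * n') (n * n') \<omega>))\<^sup>2"
    have i1: "integrable M (\<lambda>\<omega>. (norm (E n n \<omega> - E (n * n') (n * n') \<omega>))\<^sup>2)"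
      and e1: "expectation (\<lambda>\<omega>. (norm (E n n \<omega> - E (n * n') (n * n') \<omega>))\<^sup>2) \<le> \<epsilon> / 4"
      using n0(2,3)[OF n(1) pos(2)] by auto
    have i2: "integrable M (\<lambda>\<omega>. (norm (E n' n' \<omega> - E (n * n') (n * n') \<omega>))\<^sup>2)"
      and e2: "expectation (\<lambda>\<omega>. (norm (E n' n' \<omega> - E (n * n') (n * n') \<omega>))\<^sup>2) \<le> \<epsilon> / 4"
      using n0(2,3)[OF n(2) pos(1)] unfolding mult.commute[of n' n] by auto
    have Ri: "integrable M ?R" using i1 i2 by simp
    have le: "(norm (E n n \<omega> - E n' n' \<omega>))\<^sup>2 \<le> ?R \<omega>" for \<omega>
      using norm_diff_sq_le[of "E n n \<omega> - E (n * n') (n * n') \<omega>" "E n' n' \<omega> - E (n * n') (n * n') \<omega>"] by simp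
    show I: "integrable M (\<lambda>\<omega>. (norm (E n n \<omega> - E n' n' \<omega>))\<^sup>2)"
      using le by (intro Bochner_Integration.integrable_bound[OF Ri]) auto
    have "expectation (\<lambda>\<omega>. (norm (E n n \<omega> - E n' n' \<omega>))\<^sup>2) \<le> expectation ?R"
      by (intro integral_mono I Ri le)
    also have "\<dots> \<le> \<epsilon>" using i1 i2 e1 e2 by simp
    finally show "expectation (\<lambda>\<omega>. (norm (E n n \<omega> - E n' n' \<omega>))\<^sup>2) \<le> \<epsilon>" .
  qed
qed

lemma test_function_L2:
  assumes f: "continuous_on UNIV f" "linear_growth f" and "0 < n"
  shows "(\<lambda>\<omega>. f (E n n \<omega>)) \<in> borel_measurable M" "integrable M (\<lambda>\<omega>. (f (E n n \<omega>))\<^sup>2)"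
proof -
  note [measurable] = euler_measurable[OF order_refl, of n] borel_measurable_continuous_onI[OF f(1)]
  show "(\<lambda>\<omega>. f (E n n \<omega>)) \<in> borel_measurable M" by measurable
  obtain C where C: "\<And>y. \<bar>f y\<bar> \<le> C * (1 + norm y)" using f(2) by (auto simp: linear_growth_def)
  have "(f y)\<^sup>2 \<le> (2 * C\<^sup>2) * (1 + (norm y)\<^sup>2)\<^sup>2" for y
  proof -
    have "(f y)\<^sup>2 \<le> (C * (1 + norm y))\<^sup>2" using power_mono[OF C[of y], of 2] by simp
    also have "\<dots> \<le> (2 * C\<^sup>2) * (1 + (norm y)\<^sup>2)" using linear_growth_sq[of C "norm y"] by simp
    also have "\<dots> \<le> (2 * C\<^sup>2) * (1 + (norm y)\<^sup>2)\<^sup>2" by (intro mult_left_mono le_own_square) auto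
    finally show ?thesis .
  qed
  then show "integrable M (\<lambda>\<omega>. (f (E n n \<omega>))\<^sup>2)"
    by (intro integrable_fourth_dominated(1)[OF \<open>0 < n\<close> order_refl, where B = "2 * C\<^sup>2"]) auto
qed

lemma test_function_cauchy_L2:
  assumes f: "continuous_on UNIV f" "linear_growth f" and "0 < \<epsilon>"
  shows "\<exists>n0>0. \<forall>n\<ge>n0. \<forall>n'\<ge>n0. integrable M (\<lambda>\<omega>. (f (E n n \<omega>) - f (E n' n' \<omega>))\<^sup>2) \<and>
     expectation (\<lambda>\<omega>. (f (E n n \<omega>) - f (E n' n' \<omega>))\<^sup>2) \<le> \<epsilon>"
proof -
  obtain C where C: "0 < C" "\<And>m k. 0 < m \<Longrightarrow> k \<le> m \<Longrightarrow> integrable M (\<lambda>\<omega>. (1 + (norm (E m k \<omega>))\<^sup>2)\<^sup>2)"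
    "\<And>m k. 0 < m \<Longrightarrow> k \<le> m \<Longrightarrow> expectation (\<lambda>\<omega>. (1 + (norm (E m k \<omega>))\<^sup>2)\<^sup>2) \<le> C"
    using euler_fourth_moment by blast
  define \<eta> where "\<eta> = \<epsilon> / (4 * C)"
  have \<eta>: "0 < \<eta>" using assms C by (simp add: \<eta>_def)
  obtain L where L: "0 \<le> L"
    "\<And>y z. (f y - f z)\<^sup>2 \<le> \<eta> * ((1 + (norm y)\<^sup>2)\<^sup>2 + (1 + (norm z)\<^sup>2)\<^sup>2) + L * (norm (y - z))\<^sup>2"
    using continuous_quadratic_domination[OF f \<eta>] by blast
  obtain n0 where n0: "0 < n0" "\<And>n n'. n0 \<le> n \<Longrightarrow> n0 \<le> n' \<Longrightarrow> integrable M (\<lambda>\<omega>. (norm (E n n \<omega> - E n' n' \<omega>))\<^sup>2)"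
    "\<And>n n'. n0 \<le> n \<Longrightarrow> n0 \<le> n' \<Longrightarrow> expectation (\<lambda>\<omega>. (norm (E n n \<omega> - E n' n' \<omega>))\<^sup>2) \<le> \<epsilon> / (2 * (L + 1))"
    using euler_cauchy_L2[of "\<epsilon> / (2 * (L + 1))"] assms L(1) by auto
  show ?thesis
  proof (intro exI[of _ n0] conjI allI impI n0(1))
    fix n n' assume n: "n0 \<le> n" "n0 \<le> n'"
    then have pos: "0 < n" "0 < n'" using n0(1) by auto
    let ?a = "\<lambda>n \<omega>. (1 + (norm (E n n \<omega>))\<^sup>2)\<^sup>2"
    let ?R = "\<lambda>\<omega>. \<eta> * (?a n \<omega> + ?a n' \<omega>) + L * (norm (E n n \<omega> - E n' n' \<omega>))\<^sup>2"
    have Ri: "integrable M ?R" using C(2)[OF pos(1)] C(2)[OF pos(2)] n0(2)[OF n] by simp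
    show I: "integrable M (\<lambda>\<omega>. (f (E n n \<omega>) - f (E n' n' \<omega>))\<^sup>2)"
    proof (rule Bochner_Integration.integrable_bound[OF Ri])
      show "(\<lambda>\<omega>. (f (E n n \<omega>) - f (E n' n' \<omega>))\<^sup>2) \<in> borel_measurable M"
        using test_function_L2(1)[OF f pos(1)] test_function_L2(1)[OF f pos(2)] by measurable
      show "AE \<omega> in M. norm ((f (E n n \<omega>) - f (E n' n' \<omega>))\<^sup>2) \<le> norm (?R \<omega>)"
        using L by (auto intro!: AE_I2 intro: order_trans[OF _ abs_ge_self])
    qed
    have "expectation (\<lambda>\<omega>. (f (E n n \<omega>) - f (E n' n' \<omega>))\<^sup>2) \<le> expectation ?R"
      by (intro integral_mono I Ri L)
    also have "\<dots> = \<eta> * (expectation (?a n) + expectation (?a n')) + L * expectation (\<lambda>\<omega>. (norm (E n n \<omega> - E n' n' \<omega>))\<^sup>2)"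
      using C(2)[OF pos(1)] C(2)[OF pos(2)] n0(2)[OF n] by simp
    also have "\<dots> \<le> \<eta> * (C + C) + L * (\<epsilon> / (2 * (L + 1)))"
      using C(3)[OF pos(1)] C(3)[OF pos(2)] n0(3)[OF n] \<eta> L(1) by (intro add_mono mult_left_mono) auto
    also have "\<eta> * (C + C) = \<epsilon> / 2" using C(1) by (simp add: \<eta>_def)
    also have "L * (\<epsilon> / (2 * (L + 1))) \<le> \<epsilon> / 2"
      using assms L(1) by (simp add: field_simps)
    finally show "expectation (\<lambda>\<omega>. (f (E n n \<omega>) - f (E n' n' \<omega>))\<^sup>2) \<le> \<epsilon>" by simp
  qed
qed

end

section \<open>The law of the Euler scheme\<close>

lemma (in brownian_filtration) joint_law_increment:
  fixes Y :: "'w \<Rightarrow> 'c::topological_space"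
  assumes st: "0 \<le> s" "s < t" and Y: "Y \<in> borel_measurable (F s)"
  shows "distr M (borel \<Otimes>\<^sub>M borel) (\<lambda>\<omega>. (Y \<omega>, W t \<omega> - W s \<omega>)) =
    distr M borel Y \<Otimes>\<^sub>M density lborel (\<lambda>y. ennreal (gaussian_vec_density (t - s) y))"
proof -
  have "0 \<le> t" using st by simp
  note [measurable] = measurable_filtration_M[OF st(1) Y] measurable_W[OF st(1)] measurable_W[OF \<open>0 \<le> t\<close>]
  let ?w = "\<lambda>\<omega>. W t \<omega> - W s \<omega>"
  have D: "density lborel (\<lambda>y. ennreal (gaussian_vec_density (t - s) y)) = distr M lborel ?w"
    using distributed_distr_eq_density[OF gaussian_increment[OF st]] by simp
  interpret Y: prob_space "distr M borel Y" by (rule prob_space_distr) simp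
  interpret w: prob_space "distr M lborel ?w" by (rule prob_space_distr) simp
  show ?thesis
    unfolding D
  proof (rule pair_measure_eqI[symmetric])
    show "sigma_finite_measure (distr M borel Y)" "sigma_finite_measure (distr M lborel ?w)" by unfold_locales
    show "sets (distr M borel Y \<Otimes>\<^sub>M distr M lborel ?w) = sets (distr M (borel \<Otimes>\<^sub>M borel) (\<lambda>\<omega>. (Y \<omega>, ?w \<omega>)))"
      by (simp cong: sets_pair_measure_cong)
    fix A B assume "A \<in> sets (distr M borel Y)" "B \<in> sets (distr M lborel ?w)"
    then have [measurable]: "A \<in> sets borel" "B \<in> sets borel" by auto
    have "Y -` A \<inter> space M \<in> sets (F s)" using measurable_sets[OF Y, of A] space_filtration[OF st(1)] by simp
    moreover have "?w -` B \<inter> space M \<in> {?w -` A \<inter> space M |A. A \<in> sets borel}" by auto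
    ultimately have "prob ((Y -` A \<inter> space M) \<inter> (?w -` B \<inter> space M)) = prob (Y -` A \<inter> space M) * prob (?w -` B \<inter> space M)"
      by (rule indep_setD[OF indep_increment[OF st]])
    moreover have "(\<lambda>\<omega>. (Y \<omega>, ?w \<omega>)) -` (A \<times> B) \<inter> space M = (Y -` A \<inter> space M) \<inter> (?w -` B \<inter> space M)" by auto
    ultimately show "emeasure (distr M borel Y) A * emeasure (distr M lborel ?w) B
        = emeasure (distr M (borel \<Otimes>\<^sub>M borel) (\<lambda>\<omega>. (Y \<omega>, ?w \<omega>))) (A \<times> B)"
      by (simp add: emeasure_distr emeasure_eq_measure ennreal_mult)
  qed
qed

lemma (in brownian_sde) euler_law_Suc:
  assumes "k < m"
  shows "distr M borel (E m (Suc k)) =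
    distr (distr M borel (E m k) \<Otimes>\<^sub>M density lborel (\<lambda>y. ennreal (gaussian_vec_density (T / real m) y))) borel
      (\<lambda>(y, w). (y + (T / real m) *\<^sub>R b (grid m k) y) + \<sigma> (grid m k) y *v w)"
proof -
  let ?\<Phi> = "\<lambda>(y, w). (y + (T / real m) *\<^sub>R b (grid m k) y) + \<sigma> (grid m k) y *v w"
  let ?w = "\<lambda>\<omega>. W (grid m (Suc k)) \<omega> - W (grid m k) \<omega>"
  have "0 < T / real m" using assms T_pos by simp
  then have lt: "grid m k < grid m (Suc k)" by (simp only: grid_Suc less_add_same_cancel1)
  have km: "k \<le> m" using assms by simp
  have d: "grid m (Suc k) - grid m k = T / real m" by (simp only: grid_Suc add_diff_cancel_left')
  note [measurable] = b_measurable[OF grid_time_mem[OF km]] \<sigma>_measurable[OF grid_time_mem[OF km]] euler_measurable[OF km]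
    measurable_W[OF grid_nonneg]
  have pm: "(\<lambda>\<omega>. (E m k \<omega>, ?w \<omega>)) \<in> M \<rightarrow>\<^sub>M borel \<Otimes>\<^sub>M borel" by measurable
  have [measurable]: "?\<Phi> \<in> borel_measurable (borel \<Otimes>\<^sub>M borel)" by measurable
  have "distr (distr M borel (E m k) \<Otimes>\<^sub>M density lborel (\<lambda>y. ennreal (gaussian_vec_density (T / real m) y))) borel ?\<Phi>
    = distr (distr M (borel \<Otimes>\<^sub>M borel) (\<lambda>\<omega>. (E m k \<omega>, ?w \<omega>))) borel ?\<Phi>"
    unfolding joint_law_increment[OF grid_nonneg lt euler_adapted[OF km]] d ..
  also have "\<dots> = distr M borel (\<lambda>\<omega>. ?\<Phi> (E m k \<omega>, ?w \<omega>))"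
    by (subst distr_distr[OF _ pm]) (simp_all add: comp_def)
  also have "(\<lambda>\<omega>. ?\<Phi> (E m k \<omega>, ?w \<omega>)) = E m (Suc k)"
    by (rule ext) (simp only: euler_Suc prod.case)
  finally show ?thesis by simp
qed

text \<open>The law after a step is a function of the law before it, as the increment is independent of the past and has
  a known distribution. Hence it depends neither on the Brownian motion nor on the probability space.\<close>

lemma euler_law_eq:
  fixes W :: "real \<Rightarrow> 'w \<Rightarrow> real ^ 'q" and B :: "real \<Rightarrow> 'v \<Rightarrow> real ^ 'q"
  assumes "brownian_sde T b \<sigma> K M F W" "brownian_sde T b \<sigma> K N G B" and "k \<le> m"
  shows "distr M borel (euler T b \<sigma> x W m k) = distr N borel (euler T b \<sigma> x B m k)"
  using \<open>k \<le> m\<close>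
proof (induction k)
  case 0
  interpret M: brownian_sde T b \<sigma> x K M F W by fact
  interpret N: brownian_sde T b \<sigma> x K N G B by fact
  have "distr M borel (\<lambda>_. x) = return borel x" "distr N borel (\<lambda>_. x) = return borel x"
    using M.distr_const N.distr_const by auto
  moreover have "euler T b \<sigma> x W m 0 = (\<lambda>_. x)" "euler T b \<sigma> x B m 0 = (\<lambda>_. x)" by (auto simp: fun_eq_iff)
  ultimately show ?case by simp
next
  case (Suc k)
  then show ?case
    using brownian_sde.euler_law_Suc[OF assms(1), of k m x] brownian_sde.euler_law_Suc[OF assms(2), of k m x]
    by (simp del: euler.simps(2))
qed

lemma euler_terminal_expectation_eq:
  fixes W :: "real \<Rightarrow> 'w \<Rightarrow> real ^ 'q" and B :: "real \<Rightarrow> 'v \<Rightarrow> real ^ 'q" and g :: "real ^ 'd \<Rightarrow> real"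
  assumes M: "brownian_sde T b \<sigma> K M F W" and N: "brownian_sde T b \<sigma> K N G B" and g: "g \<in> borel_measurable borel"
  shows "(\<integral>\<omega>. g (euler T b \<sigma> x W m m \<omega>) \<partial>M) = (\<integral>\<omega>. g (euler T b \<sigma> x B m m \<omega>) \<partial>N)"
proof -
  have "(\<integral>\<omega>. g (euler T b \<sigma> x W m m \<omega>) \<partial>M) = (\<integral>y. g y \<partial>distr M borel (euler T b \<sigma> x W m m))"
    using brownian_sde.euler_measurable[OF M order_refl] g by (intro integral_distr[symmetric])
  also have "\<dots> = (\<integral>y. g y \<partial>distr N borel (euler T b \<sigma> x B m m))"
    using euler_law_eq[OF M N order_refl] by simp
  also have "\<dots> = (\<integral>\<omega>. g (euler T b \<sigma> x B m m \<omega>) \<partial>N)"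
    using brownian_sde.euler_measurable[OF N order_refl] g by (intro integral_distr)
  finally show ?thesis .
qed

section \<open>Riemann sums of the Ito integral\<close>

lemma finite_set_grid:
  fixes S :: "real set"
  assumes "finite S" "S \<noteq> {}"
  obtains N :: nat and r where "S = r ` {..N}" "\<And>i j. i < j \<Longrightarrow> j \<le> N \<Longrightarrow> r i < (r j :: real)"
proof -
  let ?L = "sorted_list_of_set S"
  define N where "N = length ?L - 1"
  have len: "length ?L = Suc N" using assms by (simp add: N_def card_gt_0_iff)
  have "S = set ?L" using assms by simp
  also have "\<dots> = (!) ?L ` {..N}" unfolding set_conv_nth len by (auto simp: less_Suc_eq_le)
  finally have "S = (!) ?L ` {..N}" .
  moreover have "?L ! i < ?L ! j" if "i < j" "j \<le> N" for i j
    by (rule sorted_wrt_nth_less[OF strict_sorted_list_of_set]) (use that len in auto)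
  ultimately show ?thesis using that by blast
qed

lemma telescope_on_grid:
  fixes f :: "nat \<Rightarrow> 'a::ab_group_add"
  assumes "p \<le> q" "q \<le> N"
  shows "(\<Sum>i<N. if p \<le> i \<and> i < q then f (Suc i) - f i else 0) = f q - f p"
proof -
  have "(\<Sum>i<N. if p \<le> i \<and> i < q then f (Suc i) - f i else 0) = (\<Sum>i=p..<q. f (Suc i) - f i)"
    using assms by (intro sum.mono_neutral_cong_right) auto
  then show ?thesis using sum_Suc_diff'[OF assms(1), of f] by simp
qed

text \<open>The terms that remain are those before the partial sums exceed \<open>\<delta>\<close> for the first time, and a term that
  would take the partial sum over \<open>\<delta>\<close> is already left out.\<close>

lemma stopped_sum_le:
  fixes a :: "nat \<Rightarrow> real"
  assumes "\<And>i. 0 \<le> a i" "0 \<le> \<delta>"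
  shows "(\<Sum>i<N. if (\<Sum>l\<le>i. a l) \<le> \<delta> then a i else 0) \<le> \<delta>"
proof (induction N)
  case (Suc N)
  show ?case
  proof (cases "(\<Sum>l\<le>N. a l) \<le> \<delta>")
    case True
    have "(\<Sum>i<Suc N. if (\<Sum>l\<le>i. a l) \<le> \<delta> then a i else 0) \<le> (\<Sum>i<Suc N. a i)"
      using assms(1) by (intro sum_mono) auto
    also have "(\<Sum>i<Suc N. a i) = (\<Sum>i\<le>N. a i)" by (simp only: lessThan_Suc_atMost)
    finally show ?thesis using True by linarith
  next
    case False then show ?thesis using Suc by simp
  qed
qed (use assms in simp)

context brownian_filtration begin

lemma discrete_ito_bound:
  fixes \<psi> :: "nat \<Rightarrow> 'w \<Rightarrow> real ^ 'q ^ 'd" and r :: "nat \<Rightarrow> real"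
  assumes r: "0 \<le> r 0" "\<And>i. i < N \<Longrightarrow> r i \<le> r (Suc i)"
    and \<psi>: "\<And>i. i < N \<Longrightarrow> \<psi> i \<in> borel_measurable (F (r i))" "\<And>i. i < N \<Longrightarrow> integrable M (\<lambda>\<omega>. (norm (\<psi> i \<omega>))\<^sup>2)"
  defines "J \<equiv> \<lambda>\<omega>. \<Sum>i<N. \<psi> i \<omega> *v (W (r (Suc i)) \<omega> - W (r i) \<omega>)"
  shows "J \<in> borel_measurable M" "integrable M (\<lambda>\<omega>. (norm (J \<omega>))\<^sup>2)"
    "expectation (\<lambda>\<omega>. (norm (J \<omega>))\<^sup>2) \<le> CARD('q) * (\<Sum>i<N. (r (Suc i) - r i) * expectation (\<lambda>\<omega>. (norm (\<psi> i \<omega>))\<^sup>2))"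
proof -
  have r0: "0 \<le> r i" if "i \<le> N" for i
    using that by (induction i) (use r in \<open>auto intro: order_trans\<close>)
  let ?J = "\<lambda>n \<omega>. \<Sum>i<n. \<psi> i \<omega> *v (W (r (Suc i)) \<omega> - W (r i) \<omega>)"
  have "?J n \<in> borel_measurable (F (r n)) \<and> integrable M (\<lambda>\<omega>. (norm (?J n \<omega>))\<^sup>2) \<and>
    expectation (\<lambda>\<omega>. (norm (?J n \<omega>))\<^sup>2) \<le> CARD('q) * (\<Sum>i<n. (r (Suc i) - r i) * expectation (\<lambda>\<omega>. (norm (\<psi> i \<omega>))\<^sup>2))"
    if "n \<le> N" for n
    using that
  proof (induction n)
    case (Suc n)
    then have n: "n < N" "n \<le> N" "Suc n \<le> N" by auto
    note le = r(2)[OF n(1)]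
    have IH: "?J n \<in> borel_measurable (F (r n))" "integrable M (\<lambda>\<omega>. (norm (?J n \<omega>))\<^sup>2)"
      "expectation (\<lambda>\<omega>. (norm (?J n \<omega>))\<^sup>2) \<le> CARD('q) * (\<Sum>i<n. (r (Suc i) - r i) * expectation (\<lambda>\<omega>. (norm (\<psi> i \<omega>))\<^sup>2))"
      using Suc.IH n by auto
    note st = increment_step_L2[OF r0[OF n(2)] le IH(1) \<psi>(1)[OF n(1)] IH(2) \<psi>(2)[OF n(1)]]
    note [measurable] = measurable_filtration_mono[OF r0[OF n(2)] le IH(1)]
      measurable_filtration_mono[OF r0[OF n(2)] le \<psi>(1)[OF n(1)]] adapted[OF r0[OF n(3)]] adapted_le[OF r0[OF n(2)] le]
    have "(\<lambda>\<omega>. ?J n \<omega> + \<psi> n \<omega> *v (W (r (Suc n)) \<omega> - W (r n) \<omega>)) \<in> borel_measurable (F (r (Suc n)))" by measurable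
    then show ?case using st IH(3) by (simp add: distrib_left mult.assoc)
  qed simp
  from this[OF order_refl] show "J \<in> borel_measurable M" "integrable M (\<lambda>\<omega>. (norm (J \<omega>))\<^sup>2)"
    "expectation (\<lambda>\<omega>. (norm (J \<omega>))\<^sup>2) \<le> CARD('q) * (\<Sum>i<N. (r (Suc i) - r i) * expectation (\<lambda>\<omega>. (norm (\<psi> i \<omega>))\<^sup>2))"
    using measurable_filtration_M[OF r0[OF order_refl]] unfolding J_def by blast+
qed

text \<open>Stop \<open>\<psi>\<close> when its accumulated square exceeds \<open>\<delta>\<close>. This is decided at the left end point of each cell, so
  the stopped process is still adapted and its sum has second moment at most \<open>CARD('q) * \<delta>\<close>. Both sums
  agree unless the stopping occurs.\<close>

lemma discrete_lenglart:
  fixes \<psi> :: "nat \<Rightarrow> 'w \<Rightarrow> real ^ 'q ^ 'd" and r :: "nat \<Rightarrow> real" and \<epsilon> \<delta> :: real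
  assumes r: "0 \<le> r 0" "\<And>i. i < N \<Longrightarrow> r i \<le> r (Suc i)"
    and \<psi>: "\<And>i. i < N \<Longrightarrow> \<psi> i \<in> borel_measurable (F (r i))" "\<And>i. i < N \<Longrightarrow> bounded (\<psi> i ` space M)"
    and A: "A \<in> sets M" and \<epsilon>: "0 < \<epsilon>" and \<delta>: "0 \<le> \<delta>"
  shows "prob {\<omega>\<in>A. \<epsilon> < norm (\<Sum>i<N. \<psi> i \<omega> *v (W (r (Suc i)) \<omega> - W (r i) \<omega>))}
    \<le> prob {\<omega>\<in>A. \<delta> < (\<Sum>i<N. (norm (\<psi> i \<omega>))\<^sup>2 * (r (Suc i) - r i))} + CARD('q) * \<delta> / \<epsilon>\<^sup>2"
proof -
  have r0: "0 \<le> r i" if "i \<le> N" for i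
    using that by (induction i) (use r in \<open>auto intro: order_trans\<close>)
  have rm: "r l \<le> r i" if "l \<le> i" "i \<le> N" for l i
    using that by (induction i) (use r in \<open>auto simp: le_Suc_eq intro: order_trans\<close>)
  define a where "a i \<omega> = (if i < N then (norm (\<psi> i \<omega>))\<^sup>2 * (r (Suc i) - r i) else 0)" for i \<omega>
  have a0: "0 \<le> a i \<omega>" for i \<omega> using r by (simp add: a_def)
  define \<psi>' where "\<psi>' i \<omega> = (if (\<Sum>l\<le>i. a l \<omega>) \<le> \<delta> then \<psi> i \<omega> else 0)" for i \<omega>
  have am: "a l \<in> borel_measurable (F (r i))" if "l \<le> i" "i < N" for l i
  proof -
    have lN: "l < N" "l \<le> N" "i \<le> N" using that by auto
    note [measurable] = measurable_filtration_mono[OF r0[OF lN(2)] rm[OF that(1) lN(3)] \<psi>(1)[OF lN(1)]]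
    show ?thesis unfolding a_def[abs_def] using lN by simp
  qed
  have \<psi>'m: "\<psi>' i \<in> borel_measurable (F (r i))" if "i < N" for i
  proof -
    have [measurable]: "(\<lambda>\<omega>. \<Sum>l\<le>i. a l \<omega>) \<in> borel_measurable (F (r i))"
      using am that by (intro borel_measurable_sum) auto
    note [measurable] = \<psi>(1)[OF that]
    show ?thesis unfolding \<psi>'_def[abs_def] by measurable
  qed
  have \<psi>M [measurable]: "\<psi> i \<in> borel_measurable M" if "i < N" for i
    using measurable_filtration_M[OF r0 \<psi>(1)[OF that]] that by simp
  have \<psi>'M [measurable]: "\<psi>' i \<in> borel_measurable M" if "i < N" for i
    using measurable_filtration_M[OF r0 \<psi>'m[OF that]] that by simp
  have \<psi>'i: "integrable M (\<lambda>\<omega>. (norm (\<psi>' i \<omega>))\<^sup>2)" if "i < N" for i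
  proof -
    have "bounded (\<psi> i ` space M)" by (rule \<psi>(2)[OF that])
    then obtain B where B: "\<And>\<omega>. \<omega> \<in> space M \<Longrightarrow> norm (\<psi> i \<omega>) \<le> B" unfolding bounded_iff by auto
    have "norm (\<psi>' i \<omega>) \<le> \<bar>B\<bar>" if "\<omega> \<in> space M" for \<omega> using B[OF that] unfolding \<psi>'_def by auto
    then have "(norm (\<psi>' i \<omega>))\<^sup>2 \<le> \<bar>B\<bar>\<^sup>2" if "\<omega> \<in> space M" for \<omega>
      using that by (intro power_mono) auto
    then have "AE \<omega> in M. norm ((norm (\<psi>' i \<omega>))\<^sup>2) \<le> \<bar>B\<bar>\<^sup>2" by (intro AE_I2) simp
    then show ?thesis using \<psi>'M[OF that] by (intro integrable_const_bound[where B = "\<bar>B\<bar>\<^sup>2"]) auto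
  qed
  let ?J = "\<lambda>\<psi> \<omega>. \<Sum>i<N. \<psi> i \<omega> *v (W (r (Suc i)) \<omega> - W (r i) \<omega>)"
  note J' = discrete_ito_bound[OF r \<psi>'m \<psi>'i]
  have Wm [measurable]: "W (r i) \<in> borel_measurable M" if "i \<le> N" for i using measurable_W[OF r0[OF that]] .
  have Jm [measurable]: "?J \<psi> \<in> borel_measurable M"
  proof (intro borel_measurable_sum)
    fix i assume "i \<in> {..<N}"
    then have [measurable]: "W (r i) \<in> borel_measurable M" "W (r (Suc i)) \<in> borel_measurable M" "\<psi> i \<in> borel_measurable M"
      using Wm[of i] Wm[of "Suc i"] \<psi>M[of i] by (simp_all only: lessThan_iff less_imp_le Suc_leI)
    show "(\<lambda>\<omega>. \<psi> i \<omega> *v (W (r (Suc i)) \<omega> - W (r i) \<omega>)) \<in> borel_measurable M" by measurable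
  qed
  note [measurable] = J'(1) A
  define Q where "Q \<omega> = (\<Sum>i<N. (norm (\<psi> i \<omega>))\<^sup>2 * (r (Suc i) - r i))" for \<omega>
  have Qm [measurable]: "Q \<in> borel_measurable M"
    unfolding Q_def[abs_def] using \<psi>M by (intro borel_measurable_sum) auto
  have Qa: "Q \<omega> = (\<Sum>i<N. a i \<omega>)" for \<omega> unfolding Q_def a_def by simp
  have E: "expectation (\<lambda>\<omega>. (norm (?J \<psi>' \<omega>))\<^sup>2) \<le> CARD('q) * \<delta>"
  proof -
    have "expectation (\<lambda>\<omega>. (norm (?J \<psi>' \<omega>))\<^sup>2) \<le> CARD('q) * (\<Sum>i<N. (r (Suc i) - r i) * expectation (\<lambda>\<omega>. (norm (\<psi>' i \<omega>))\<^sup>2))"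
      by (rule J'(3))
    also have "(\<Sum>i<N. (r (Suc i) - r i) * expectation (\<lambda>\<omega>. (norm (\<psi>' i \<omega>))\<^sup>2))
      = expectation (\<lambda>\<omega>. \<Sum>i<N. (r (Suc i) - r i) * (norm (\<psi>' i \<omega>))\<^sup>2)"
      using \<psi>'i by (subst Bochner_Integration.integral_sum) auto
    also have "\<dots> \<le> expectation (\<lambda>\<omega>. \<delta>)"
    proof (rule integral_mono)
      show "integrable M (\<lambda>\<omega>. \<Sum>i<N. (r (Suc i) - r i) * (norm (\<psi>' i \<omega>))\<^sup>2)" using \<psi>'i by auto
      fix \<omega>
      have "(\<Sum>i<N. (r (Suc i) - r i) * (norm (\<psi>' i \<omega>))\<^sup>2) = (\<Sum>i<N. if (\<Sum>l\<le>i. a l \<omega>) \<le> \<delta> then a i \<omega> else 0)"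
        by (intro sum.cong) (auto simp: \<psi>'_def a_def)
      also have "\<dots> \<le> \<delta>" using a0 \<delta> by (rule stopped_sum_le)
      finally show "(\<Sum>i<N. (r (Suc i) - r i) * (norm (\<psi>' i \<omega>))\<^sup>2) \<le> \<delta>" .
    qed simp
    finally show ?thesis by (simp add: prob_space)
  qed
  have sub: "{\<omega>\<in>A. \<epsilon> < norm (?J \<psi> \<omega>)} \<subseteq> {\<omega>\<in>A. \<delta> < Q \<omega>} \<union> {\<omega>\<in>space M. \<epsilon> \<le> norm (?J \<psi>' \<omega>)}"
  proof
    fix \<omega> assume \<omega>: "\<omega> \<in> {\<omega>\<in>A. \<epsilon> < norm (?J \<psi> \<omega>)}"
    then have sp: "\<omega> \<in> space M" using A sets.sets_into_space by blast
    show "\<omega> \<in> {\<omega>\<in>A. \<delta> < Q \<omega>} \<union> {\<omega>\<in>space M. \<epsilon> \<le> norm (?J \<psi>' \<omega>)}"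
    proof (cases "\<delta> < Q \<omega>")
      case False
      have "(\<Sum>l\<le>i. a l \<omega>) \<le> \<delta>" if "i < N" for i
      proof -
        have "(\<Sum>l\<le>i. a l \<omega>) \<le> (\<Sum>l<N. a l \<omega>)" using that a0 by (intro sum_mono2) auto
        then show ?thesis using False unfolding Qa by simp
      qed
      then have "?J \<psi>' \<omega> = ?J \<psi> \<omega>" by (intro sum.cong) (auto simp: \<psi>'_def)
      then show ?thesis using \<omega> sp by simp
    qed (use \<omega> in simp)
  qed
  have [measurable]: "{\<omega>\<in>A. \<delta> < Q \<omega>} \<in> sets M"
  proof -
    have "{\<omega>\<in>A. \<delta> < Q \<omega>} = A \<inter> {\<omega>\<in>space M. \<delta> < Q \<omega>}" using A sets.sets_into_space by blast
    then show ?thesis by simp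
  qed
  have "prob {\<omega>\<in>A. \<epsilon> < norm (?J \<psi> \<omega>)} \<le> prob ({\<omega>\<in>A. \<delta> < Q \<omega>} \<union> {\<omega>\<in>space M. \<epsilon> \<le> norm (?J \<psi>' \<omega>)})"
    by (intro finite_measure_mono sub) measurable
  also have "\<dots> \<le> prob {\<omega>\<in>A. \<delta> < Q \<omega>} + prob {\<omega>\<in>space M. \<epsilon> \<le> norm (?J \<psi>' \<omega>)}"
    by (intro measure_Un_le) measurable
  also have "prob {\<omega>\<in>space M. \<epsilon> \<le> norm (?J \<psi>' \<omega>)} \<le> expectation (\<lambda>\<omega>. (norm (?J \<psi>' \<omega>))\<^sup>2) / \<epsilon>\<^sup>2"
  proof -
    have "{\<omega>\<in>space M. \<epsilon> \<le> norm (?J \<psi>' \<omega>)} = {\<omega>\<in>space M. \<epsilon>\<^sup>2 \<le> (norm (?J \<psi>' \<omega>))\<^sup>2}"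
      using \<epsilon> by (auto simp: power2_le_iff_abs_le abs_le_square_iff[symmetric])
    then show ?thesis
      using integral_Markov_inequality_measure[OF J'(2) sets.empty_sets, where c = "\<epsilon>\<^sup>2"] \<epsilon> by simp
  qed
  also have "\<dots> \<le> CARD('q) * \<delta> / \<epsilon>\<^sup>2" using E \<epsilon> by (intro divide_right_mono) auto
  finally show ?thesis unfolding Q_def by simp
qed

text \<open>The intervals may overlap, so the difference of two simple processes on different partitions
  is a family of this kind. All end points together form a common grid, on whose cells the
  value of the family is constant in time.\<close>

lemma interval_family_lenglart:
  fixes \<xi> :: "'k \<Rightarrow> 'w \<Rightarrow> real ^ 'q ^ 'd" and a c :: "'k \<Rightarrow> real" and \<epsilon> \<delta> t :: real
  assumes fin: "finite I" and ac: "\<And>k. k \<in> I \<Longrightarrow> 0 \<le> a k \<and> a k \<le> c k \<and> c k \<le> t"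
    and \<xi>: "\<And>k. k \<in> I \<Longrightarrow> a k < c k \<Longrightarrow> \<xi> k \<in> borel_measurable (F (a k))"
      "\<And>k. k \<in> I \<Longrightarrow> a k < c k \<Longrightarrow> bounded (\<xi> k ` space M)"
    and A: "A \<in> sets M" and \<epsilon>: "0 < \<epsilon>" and \<delta>: "0 \<le> \<delta>"
    and B: "B \<in> sets M" "\<And>\<omega>. \<omega> \<in> A \<Longrightarrow> ennreal \<delta> < (\<integral>\<^sup>+ s\<in>{0..t}. ennreal ((norm (\<Sum>k\<in>I. indicat_real {a k<..c k} s *\<^sub>R \<xi> k \<omega>))\<^sup>2) \<partial>lborel) \<Longrightarrow> \<omega> \<in> B"
  shows "prob {\<omega>\<in>A. \<epsilon> < norm (\<Sum>k\<in>I. \<xi> k \<omega> *v (W (c k) \<omega> - W (a k) \<omega>))} \<le> prob B + CARD('q) * \<delta> / \<epsilon>\<^sup>2"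
proof (cases "I = {}")
  case True then show ?thesis using \<epsilon> \<delta> by simp
next
  case False
  define S where "S = a ` I \<union> c ` I"
  have S: "finite S" "S \<noteq> {}" using fin False by (auto simp: S_def)
  obtain N :: nat and r where r: "S = r ` {..N}" "\<And>i j. i < j \<Longrightarrow> j \<le> N \<Longrightarrow> r i < r j"
    using finite_set_grid[OF S] by metis
  have rle: "r i \<le> r j \<longleftrightarrow> i \<le> j" if "i \<le> N" "j \<le> N" for i j
    using r(2)[of i j] r(2)[of j i] that by (cases i j rule: linorder_cases) auto
  have rlt: "r i < r j \<longleftrightarrow> i < j" if "i \<le> N" "j \<le> N" for i j
    using rle[OF that(2,1)] by auto
  have "\<exists>p. p \<le> N \<and> a k = r p" "\<exists>q. q \<le> N \<and> c k = r q" if "k \<in> I" for k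
  proof -
    have "a k \<in> r ` {..N}" "c k \<in> r ` {..N}" unfolding r(1)[symmetric] S_def using that by simp_all
    then show "\<exists>p. p \<le> N \<and> a k = r p" "\<exists>q. q \<le> N \<and> c k = r q" by (elim imageE; auto)+
  qed
  then obtain p q where pq0: "\<And>k. k \<in> I \<Longrightarrow> p k \<le> N \<and> a k = r (p k)" "\<And>k. k \<in> I \<Longrightarrow> q k \<le> N \<and> c k = r (q k)"
    by metis
  have pq: "p k \<le> N" "q k \<le> N" "a k = r (p k)" "c k = r (q k)" if "k \<in> I" for k
    using pq0[OF that] by auto
  have pq_le: "p k \<le> q k" if "k \<in> I" for k using ac[OF that] rle[OF pq(1,2)[OF that]] pq(3,4)[OF that] by simp
  have r_nn: "0 \<le> r i" "r i \<le> t" if "i \<le> N" for i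
  proof -
    have "r i \<in> S" using r(1) that by auto
    moreover have "0 \<le> a k" "a k \<le> t" "0 \<le> c k" "c k \<le> t" if "k \<in> I" for k using ac[OF that] by auto
    ultimately show "0 \<le> r i" "r i \<le> t" unfolding S_def by auto
  qed
  have r_mono: "r i \<le> r (Suc i)" if "i < N" for i using r(2)[of i "Suc i"] that by simp
  define v where "v s \<omega> = (\<Sum>k\<in>I. indicat_real {a k<..c k} s *\<^sub>R \<xi> k \<omega>)" for s \<omega>
  \<comment> \<open>on a cell \<open>(r i, r (i + 1)]\<close> the step function \<open>v\<close> is constant in time, with the value at the right end point\<close>
  have mem: "s \<in> {a k<..c k} \<longleftrightarrow> p k \<le> i \<and> i < q k" if "k \<in> I" "i < N" "r i < s" "s \<le> r (Suc i)" for k i s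
  proof -
    have "a k < s \<longleftrightarrow> p k \<le> i"
    proof
      assume "p k \<le> i"
      then have "a k \<le> r i" using rle[of "p k" i] pq[OF that(1)] that by simp
      then show "a k < s" using that by simp
    next
      assume "a k < s"
      then have "r (p k) < r (Suc i)" using pq[OF that(1)] that by simp
      then show "p k \<le> i" using rlt[of "p k" "Suc i"] pq[OF that(1)] that by simp
    qed
    moreover have "s \<le> c k \<longleftrightarrow> i < q k"
    proof
      assume "i < q k"
      then have "r (Suc i) \<le> c k" using rle[of "Suc i" "q k"] pq[OF that(1)] that by simp
      then show "s \<le> c k" using that by simp
    next
      assume "s \<le> c k"
      then have "r i < r (q k)" using pq[OF that(1)] that by simp
      then show "i < q k" using rlt[of i "q k"] pq[OF that(1)] that by simp
    qed
    ultimately show ?thesis by simp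
  qed
  define \<psi> where "\<psi> i \<omega> = v (r (Suc i)) \<omega>" for i \<omega>
  have v_cell: "v s \<omega> = \<psi> i \<omega>" if "i < N" "r i < s" "s \<le> r (Suc i)" for i s \<omega>
    unfolding v_def \<psi>_def using mem[of _ i s] mem[of _ i "r (Suc i)"] that
    by (intro sum.cong refl arg_cong2[where f = scaleR]) (auto simp: indicator_def)
  have \<psi>_sum: "\<psi> i \<omega> = (\<Sum>k\<in>I. (if p k \<le> i \<and> i < q k then \<xi> k \<omega> else 0))" if "i < N" for i \<omega>
    unfolding \<psi>_def v_def using mem[of _ i "r (Suc i)"] r(2)[of i "Suc i"] that
    by (intro sum.cong) (auto simp: indicator_def)
  have act: "a k < c k" "a k \<le> r i" if "k \<in> I" "p k \<le> i \<and> i < q k" "i < N" for k i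
    using that pq[OF that(1)] rlt[of "p k" "q k"] rle[of "p k" i] by auto
  have \<psi>m: "\<psi> i \<in> borel_measurable (F (r i))" if i: "i < N" for i
  proof -
    have "(\<lambda>\<omega>. if p k \<le> i \<and> i < q k then \<xi> k \<omega> else 0) \<in> borel_measurable (F (r i))" if k: "k \<in> I" for k
    proof (cases "p k \<le> i \<and> i < q k")
      case True
      then have "\<xi> k \<in> borel_measurable (F (r i))"
        using measurable_filtration_mono[of "a k" "r i"] \<xi>(1)[OF k] act[OF k True i] ac[OF k] by blast
      then show ?thesis using True by simp
    next
      case False then show ?thesis by (simp only: if_False) simp
    qed
    then have "(\<lambda>\<omega>. \<Sum>k\<in>I. (if p k \<le> i \<and> i < q k then \<xi> k \<omega> else 0)) \<in> borel_measurable (F (r i))"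
      by (rule borel_measurable_sum)
    then show ?thesis using \<psi>_sum[OF i] by (simp cong: measurable_cong)
  qed
  have \<psi>b: "bounded (\<psi> i ` space M)" if i: "i < N" for i
  proof -
    have "\<exists>D. \<forall>\<omega>\<in>space M. norm (if p k \<le> i \<and> i < q k then \<xi> k \<omega> else 0) \<le> D" if k: "k \<in> I" for k
    proof (cases "p k \<le> i \<and> i < q k")
      case True
      then show ?thesis using \<xi>(2)[OF k act(1)[OF k True i]] unfolding bounded_iff by auto
    next
      case False then show ?thesis by (intro exI[of _ 0]) auto
    qed
    then obtain D where D: "\<And>k \<omega>. k \<in> I \<Longrightarrow> \<omega> \<in> space M \<Longrightarrow> norm (if p k \<le> i \<and> i < q k then \<xi> k \<omega> else 0) \<le> D k" by metis
    have "norm (\<psi> i \<omega>) \<le> (\<Sum>k\<in>I. D k)" if "\<omega> \<in> space M" for \<omega>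
      unfolding \<psi>_sum[OF i] using D that by (intro sum_norm_le) auto
    then show ?thesis unfolding bounded_iff by auto
  qed
  have int_eq: "(\<Sum>k\<in>I. \<xi> k \<omega> *v (W (c k) \<omega> - W (a k) \<omega>)) = (\<Sum>i<N. \<psi> i \<omega> *v (W (r (Suc i)) \<omega> - W (r i) \<omega>))" for \<omega>
  proof -
    let ?f = "\<lambda>i. W (r i) \<omega>"
    have "\<xi> k \<omega> *v (W (c k) \<omega> - W (a k) \<omega>) = (\<Sum>i<N. (if p k \<le> i \<and> i < q k then \<xi> k \<omega> else 0) *v (?f (Suc i) - ?f i))"
      if k: "k \<in> I" for k
    proof -
      let ?g = "\<lambda>i. \<xi> k \<omega> *v ?f i"
      have "\<xi> k \<omega> *v (W (c k) \<omega> - W (a k) \<omega>) = ?g (q k) - ?g (p k)"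
        using pq[OF k] by (simp add: matrix_vector_mult_diff_distrib)
      also have "\<dots> = (\<Sum>i<N. if p k \<le> i \<and> i < q k then ?g (Suc i) - ?g i else 0)"
        using telescope_on_grid[OF pq_le[OF k] pq(2)[OF k], of ?g] by simp
      also have "\<dots> = (\<Sum>i<N. (if p k \<le> i \<and> i < q k then \<xi> k \<omega> else 0) *v (?f (Suc i) - ?f i))"
        by (intro sum.cong) (auto simp: matrix_vector_mult_diff_distrib)
      finally show ?thesis .
    qed
    then have "(\<Sum>k\<in>I. \<xi> k \<omega> *v (W (c k) \<omega> - W (a k) \<omega>))
      = (\<Sum>i<N. \<Sum>k\<in>I. (if p k \<le> i \<and> i < q k then \<xi> k \<omega> else 0) *v (?f (Suc i) - ?f i))"
      by (subst sum.swap) simp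
    also have "\<dots> = (\<Sum>i<N. \<psi> i \<omega> *v (?f (Suc i) - ?f i))"
    proof (intro sum.cong refl)
      fix i assume "i \<in> {..<N}"
      moreover have "(\<Sum>k\<in>I. g k *v y) = (\<Sum>k\<in>I. g k) *v y" for g :: "'k \<Rightarrow> real ^ 'q ^ 'd" and y
        using fin by induction (simp_all add: matrix_vector_mult_add_rdistrib)
      ultimately show "(\<Sum>k\<in>I. (if p k \<le> i \<and> i < q k then \<xi> k \<omega> else 0) *v (?f (Suc i) - ?f i)) = \<psi> i \<omega> *v (?f (Suc i) - ?f i)"
        by (simp add: \<psi>_sum)
    qed
    finally show ?thesis .
  qed
  have qv: "ennreal (\<Sum>i<N. (norm (\<psi> i \<omega>))\<^sup>2 * (r (Suc i) - r i)) \<le> (\<integral>\<^sup>+ s\<in>{0..t}. ennreal ((norm (v s \<omega>))\<^sup>2) \<partial>lborel)" for \<omega>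
  proof -
    have "ennreal (\<Sum>i<N. (norm (\<psi> i \<omega>))\<^sup>2 * (r (Suc i) - r i)) = (\<Sum>i<N. ennreal ((norm (\<psi> i \<omega>))\<^sup>2) * emeasure lborel {r i<..r (Suc i)})"
      using r_mono by (subst sum_ennreal[symmetric]) (auto simp: ennreal_mult)
    also have "\<dots> = (\<Sum>i<N. \<integral>\<^sup>+ s. ennreal ((norm (\<psi> i \<omega>))\<^sup>2) * indicator {r i<..r (Suc i)} s \<partial>lborel)"
      by (intro sum.cong refl) (simp add: nn_integral_cmult_indicator)
    also have "\<dots> = (\<integral>\<^sup>+ s. (\<Sum>i<N. ennreal ((norm (\<psi> i \<omega>))\<^sup>2) * indicator {r i<..r (Suc i)} s) \<partial>lborel)"
      by (subst nn_integral_sum) auto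
    also have "\<dots> \<le> (\<integral>\<^sup>+ s\<in>{0..t}. ennreal ((norm (v s \<omega>))\<^sup>2) \<partial>lborel)"
    proof (rule nn_integral_mono)
      fix s
      show "(\<Sum>i<N. ennreal ((norm (\<psi> i \<omega>))\<^sup>2) * indicator {r i<..r (Suc i)} s) \<le> ennreal ((norm (v s \<omega>))\<^sup>2) * indicator {0..t} s"
      proof (cases "\<exists>i<N. s \<in> {r i<..r (Suc i)}")
        case True
        then obtain i where i: "i < N" "r i < s" "s \<le> r (Suc i)" by auto
        have uniq: "l = i" if "l < N" "r l < s" "s \<le> r (Suc l)" for l
        proof -
          have "r l < r (Suc i)" "r i < r (Suc l)" using that i by auto
          then show ?thesis using rlt[of l "Suc i"] rlt[of i "Suc l"] that i by simp
        qed
        have "(\<Sum>l<N. ennreal ((norm (\<psi> l \<omega>))\<^sup>2) * indicator {r l<..r (Suc l)} s)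
          = (\<Sum>l\<in>{i}. ennreal ((norm (\<psi> l \<omega>))\<^sup>2) * indicator {r l<..r (Suc l)} s)"
        proof (intro sum.mono_neutral_right ballI)
          fix l assume "l \<in> {..<N} - {i}"
          then have "s \<notin> {r l<..r (Suc l)}" using uniq[of l] by auto
          then show "ennreal ((norm (\<psi> l \<omega>))\<^sup>2) * indicator {r l<..r (Suc l)} s = 0" by simp
        qed (use i in auto)
        also have "\<dots> = ennreal ((norm (v s \<omega>))\<^sup>2)" using v_cell[OF i] i by simp
        also have "\<dots> = ennreal ((norm (v s \<omega>))\<^sup>2) * indicator {0..t} s"
          using r_nn(1)[of i] r_nn(2)[of "Suc i"] i by (simp add: indicator_def)
        finally show ?thesis by simp
      next
        case False
        then show ?thesis by (subst sum.neutral) (auto simp: indicator_def)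
      qed
    qed
    finally show ?thesis .
  qed
  have "prob {\<omega>\<in>A. \<epsilon> < norm (\<Sum>k\<in>I. \<xi> k \<omega> *v (W (c k) \<omega> - W (a k) \<omega>))}
     \<le> prob {\<omega>\<in>A. \<delta> < (\<Sum>i<N. (norm (\<psi> i \<omega>))\<^sup>2 * (r (Suc i) - r i))} + CARD('q) * \<delta> / \<epsilon>\<^sup>2"
    unfolding int_eq by (intro discrete_lenglart r_nn r_mono \<psi>m \<psi>b A \<epsilon> \<delta>) auto
  also have "prob {\<omega>\<in>A. \<delta> < (\<Sum>i<N. (norm (\<psi> i \<omega>))\<^sup>2 * (r (Suc i) - r i))} \<le> prob B"
  proof (intro finite_measure_mono B(1) subsetI)
    fix \<omega> assume \<omega>: "\<omega> \<in> {\<omega>\<in>A. \<delta> < (\<Sum>i<N. (norm (\<psi> i \<omega>))\<^sup>2 * (r (Suc i) - r i))}"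
    then have "ennreal \<delta> < ennreal (\<Sum>i<N. (norm (\<psi> i \<omega>))\<^sup>2 * (r (Suc i) - r i))" using \<delta> by (auto intro: ennreal_lessI)
    also note qv
    finally show "\<omega> \<in> B" using \<omega> by (intro B(2)) (simp_all add: v_def)
  qed
  finally show ?thesis by simp
qed

end

lemma step_function_value:
  fixes s :: "nat \<Rightarrow> real" and g :: "nat \<Rightarrow> 'a::real_vector"
  assumes mono: "\<And>i. i < j \<Longrightarrow> s i \<le> s (Suc i)" and u: "s 0 < u" "u \<le> s j"
  shows "\<exists>k<j. s k < u \<and> u \<le> s (Suc k) \<and> (\<Sum>i<j. indicat_real {s i<..s (Suc i)} u *\<^sub>R g i) = g k"
  using assms
proof (induction j)
  case (Suc j)
  show ?case
  proof (cases "u \<le> s j")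
    case True
    then obtain k where "k < j" "s k < u" "u \<le> s (Suc k)" "(\<Sum>i<j. indicat_real {s i<..s (Suc i)} u *\<^sub>R g i) = g k"
      using Suc by auto
    then show ?thesis using True by (intro exI[of _ k]) (simp add: indicator_def)
  next
    case False
    have below: "s (Suc i) \<le> s j" if "i < j" for i
    proof -
      have "s (Suc i) \<le> s l" if "Suc i \<le> l" "l \<le> j" for l
        using that by (induction l rule: dec_induct) (use Suc.prems(1) in \<open>auto intro: order_trans\<close>)
      then show ?thesis using that by simp
    qed
    have "(\<Sum>i<j. indicat_real {s i<..s (Suc i)} u *\<^sub>R g i) = 0"
      using below False by (intro sum.neutral) (fastforce simp: indicator_def)
    then show ?thesis using False Suc.prems by (intro exI[of _ j]) (simp add: indicator_def)
  qed
qed simp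

lemma riemann_sum_error:
  fixes f :: "real \<Rightarrow> 'a::{banach, second_countable_topology}" and g :: "nat \<Rightarrow> 'a"
  assumes s: "s 0 = 0" "s j = t" "\<And>i. i < j \<Longrightarrow> s i \<le> s (Suc i)" and t: "0 \<le> t"
    and f: "continuous_on {0..t} f"
    and close: "\<And>u. 0 < u \<Longrightarrow> u \<le> t \<Longrightarrow> norm (f u - (\<Sum>i<j. indicat_real {s i<..s (Suc i)} u *\<^sub>R g i)) \<le> \<eta>"
  shows "norm ((\<Sum>i<j. (s (Suc i) - s i) *\<^sub>R g i) - (LBINT u:{0..t}. f u)) \<le> \<eta> * t"
proof -
  define \<phi> where "\<phi> u = (\<Sum>i<j. indicat_real {s i<..s (Suc i)} u *\<^sub>R g i)" for u
  have s_nn: "0 \<le> s i" "s i \<le> t" if "i \<le> j" for i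
  proof -
    show "0 \<le> s i" using that by (induction i) (use s in \<open>auto intro: order_trans\<close>)
    have "s i \<le> s l" if "i \<le> l" "l \<le> j" for l
      using that by (induction l rule: dec_induct) (use s in \<open>auto intro: order_trans\<close>)
    then show "s i \<le> t" using that s(2) by blast
  qed
  have one: "has_bochner_integral lborel (\<lambda>u. indicat_real {s i<..s (Suc i)} u *\<^sub>R g i) ((s (Suc i) - s i) *\<^sub>R g i)" if "i < j" for i
    using has_bochner_integral_indicator[of "{s i<..s (Suc i)}" lborel "g i"] s(3)[OF that] by simp
  have \<phi>: "has_bochner_integral lborel \<phi> (\<Sum>i<j. (s (Suc i) - s i) *\<^sub>R g i)"
    unfolding \<phi>_def[abs_def] using one by (intro has_bochner_integral_sum) auto
  have fi: "integrable lborel (\<lambda>u. indicat_real {0..t} u *\<^sub>R f u)"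
    using borel_integrable_atLeastAtMost'[OF f] by (simp add: set_integrable_def)
  have "(\<Sum>i<j. (s (Suc i) - s i) *\<^sub>R g i) - (LBINT u:{0..t}. f u) = (\<integral>u. \<phi> u - indicat_real {0..t} u *\<^sub>R f u \<partial>lborel)"
    using \<phi> fi by (simp add: set_lebesgue_integral_def has_bochner_integral_iff)
  also have "norm \<dots> \<le> (\<integral>u. norm (\<phi> u - indicat_real {0..t} u *\<^sub>R f u) \<partial>lborel)"
    by (rule integral_norm_bound)
  also have "\<dots> \<le> (\<integral>u. \<eta> * indicat_real {0..t} u \<partial>lborel)"
  proof (rule integral_mono_AE)
    show "integrable lborel (\<lambda>u. norm (\<phi> u - indicat_real {0..t} u *\<^sub>R f u))"
      using \<phi> fi by (auto simp: has_bochner_integral_iff)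
    show "integrable lborel (\<lambda>u. \<eta> * indicat_real {0..t} u)" using t by simp
    show "AE u in lborel. norm (\<phi> u - indicat_real {0..t} u *\<^sub>R f u) \<le> \<eta> * indicat_real {0..t} u"
      using AE_lborel_singleton[of 0]
    proof eventually_elim
      case (elim u)
      show ?case
      proof (cases "u \<in> {0..t}")
        case True then show ?thesis using close[of u] elim unfolding \<phi>_def by (simp add: norm_minus_commute)
      next
        case False
        have "\<phi> u = 0" unfolding \<phi>_def
        proof (intro sum.neutral ballI)
          fix i assume "i \<in> {..<j}"
          then show "indicat_real {s i<..s (Suc i)} u *\<^sub>R g i = 0"
            using s_nn(1)[of i] s_nn(2)[of "Suc i"] False by (auto simp: indicator_def)
        qed
        then show ?thesis using False by simp
      qed
    qed
  qed
  also have "\<dots> = \<eta> * t" using t by simp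
  finally show ?thesis .
qed

lemma rational_bound_extends:
  fixes h :: "real \<Rightarrow> 'a::real_normed_vector"
  assumes "0 < T" and h: "continuous_on {a..c} h" and u: "a < u" "u \<le> c"
    and bd: "\<And>r. r \<in> \<rat> \<Longrightarrow> a \<le> r * T \<Longrightarrow> r * T \<le> u \<Longrightarrow> norm (h (r * T) - z) \<le> \<eta>"
  shows "norm (h u - z) \<le> \<eta>"
proof (rule ccontr)
  assume "\<not> norm (h u - z) \<le> \<eta>"
  then have "0 < norm (h u - z) - \<eta>" by simp
  then obtain \<delta> where \<delta>: "0 < \<delta>" "\<And>s. s \<in> {a..c} \<Longrightarrow> dist s u < \<delta> \<Longrightarrow> dist (h s) (h u) < norm (h u - z) - \<eta>"
    using h u unfolding continuous_on_iff by (metis atLeastAtMost_iff less_imp_le)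
  have "max a (u - \<delta>) / T < u / T" using u \<delta> \<open>0 < T\<close> by (intro divide_strict_right_mono) auto
  then obtain r where r: "r \<in> \<rat>" "max a (u - \<delta>) / T < r" "r < u / T" using Rats_dense_in_real by blast
  then have rT: "max a (u - \<delta>) < r * T" "r * T < u" using \<open>0 < T\<close> by (simp_all add: field_simps)
  then have "norm (h (r * T) - z) \<le> \<eta>" "dist (h (r * T)) (h u) < norm (h u - z) - \<eta>"
    using bd[OF r(1)] \<delta>(2)[of "r * T"] u by (auto simp: dist_norm)
  then show False using norm_triangle_ineq[of "h u - h (r * T)" "h (r * T) - z"] by (simp add: dist_norm norm_minus_commute)
qed

text \<open>A Fatou lemma for convergence in probability. Where \<open>Z m\<close> is close to \<open>X\<close> the bound for \<open>U - Z m\<close> applies.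
  The remaining event has small probability, and the integrable quantity on it is truncated at a level \<open>L\<close>.\<close>

lemma (in prob_space) limit_in_probability_L2_bound:
  fixes U X :: "'a \<Rightarrow> 'b::{real_normed_vector, second_countable_topology}" and Z :: "nat \<Rightarrow> 'a \<Rightarrow> 'b"
  assumes A [measurable]: "A \<in> events"
    and mU [measurable]: "U \<in> borel_measurable M" and mX [measurable]: "X \<in> borel_measurable M"
    and mZ [measurable]: "\<And>m. Z m \<in> borel_measurable M"
    and U2: "integrable M (\<lambda>\<omega>. (norm (U \<omega>))\<^sup>2)" and XR: "\<And>\<omega>. \<omega> \<in> A \<Longrightarrow> norm (X \<omega>) \<le> R"
    and UZ: "\<And>m. integrable M (\<lambda>\<omega>. (norm (U \<omega> - Z m \<omega>))\<^sup>2)"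
      "\<And>m. expectation (\<lambda>\<omega>. indicat_real A \<omega> * (norm (U \<omega> - Z m \<omega>))\<^sup>2) \<le> \<kappa>"
    and conv: "\<And>\<epsilon> \<theta>. 0 < \<epsilon> \<Longrightarrow> 0 < \<theta> \<Longrightarrow> \<exists>m. prob {\<omega>\<in>A. \<epsilon> < norm (Z m \<omega> - X \<omega>)} \<le> \<theta>"
  shows "expectation (\<lambda>\<omega>. indicat_real A \<omega> * (norm (U \<omega> - X \<omega>))\<^sup>2) \<le> 2 * \<kappa>"
proof -
  let ?\<phi> = "\<lambda>\<omega>. indicat_real A \<omega> * (norm (U \<omega> - X \<omega>))\<^sup>2"
  have \<phi>: "integrable M ?\<phi>"
  proof (rule Bochner_Integration.integrable_bound)
    show "integrable M (\<lambda>\<omega>. 2 * (norm (U \<omega>))\<^sup>2 + 2 * R\<^sup>2)" using U2 by simp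
    show "AE \<omega> in M. norm (?\<phi> \<omega>) \<le> norm (2 * (norm (U \<omega>))\<^sup>2 + 2 * R\<^sup>2)"
    proof (rule AE_I2)
      fix \<omega>
      have "(norm (U \<omega> - X \<omega>))\<^sup>2 \<le> 2 * (norm (U \<omega>))\<^sup>2 + 2 * R\<^sup>2" if "\<omega> \<in> A"
        using norm_diff_sq_le[of "U \<omega>" "X \<omega>"] power_mono[OF XR[OF that], of 2] by simp
      then show "norm (?\<phi> \<omega>) \<le> norm (2 * (norm (U \<omega>))\<^sup>2 + 2 * R\<^sup>2)"
        by (auto simp: indicator_def)
    qed
  qed measurable
  have \<phi>0: "0 \<le> ?\<phi> \<omega>" for \<omega> by simp
  have tail: "(\<lambda>L. expectation (\<lambda>\<omega>. ?\<phi> \<omega> - min (?\<phi> \<omega>) (real L))) \<longlonglongrightarrow> expectation (\<lambda>\<omega>. 0)"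
  proof (rule integral_dominated_convergence)
    show "integrable M ?\<phi>" by (rule \<phi>)
    show "AE \<omega> in M. (\<lambda>L. ?\<phi> \<omega> - min (?\<phi> \<omega>) (real L)) \<longlonglongrightarrow> 0"
    proof (rule AE_I2)
      fix \<omega>
      obtain L0 :: nat where "?\<phi> \<omega> \<le> real L0" using real_arch_simple by blast
      then show "(\<lambda>L. ?\<phi> \<omega> - min (?\<phi> \<omega>) (real L)) \<longlonglongrightarrow> 0"
        by (intro tendsto_eventually eventually_sequentiallyI[of L0]) (auto intro: order_trans)
    qed
    show "AE \<omega> in M. norm (?\<phi> \<omega> - min (?\<phi> \<omega>) (real L)) \<le> ?\<phi> \<omega>" for L
      using \<phi>0 by (intro AE_I2) (simp add: min_def del: zero_le_mult_iff)
  qed measurable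
  show "expectation ?\<phi> \<le> 2 * \<kappa>"
  proof (rule field_le_epsilon)
    fix \<zeta> :: real assume \<zeta>: "0 < \<zeta>"
    have "\<forall>\<^sub>F L in sequentially. expectation (\<lambda>\<omega>. ?\<phi> \<omega> - min (?\<phi> \<omega>) (real L)) < \<zeta> / 3"
      using order_tendstoD(2)[OF tail, of "\<zeta> / 3"] \<zeta> by simp
    then obtain L0 where L0: "\<forall>L\<ge>L0. expectation (\<lambda>\<omega>. ?\<phi> \<omega> - min (?\<phi> \<omega>) (real L)) < \<zeta> / 3"
      unfolding eventually_sequentially ..
    define L where "L = Suc L0"
    have L: "0 < L" "expectation (\<lambda>\<omega>. ?\<phi> \<omega> - min (?\<phi> \<omega>) (real L)) < \<zeta> / 3"
      using L0[rule_format, of L] by (simp_all add: L_def)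
    obtain m where m: "prob {\<omega>\<in>A. sqrt (\<zeta> / 6) < norm (Z m \<omega> - X \<omega>)} \<le> \<zeta> / (3 * real L)"
      using conv[of "sqrt (\<zeta> / 6)" "\<zeta> / (3 * real L)"] \<zeta> L(1) by auto
    define B where "B = {\<omega>\<in>A. sqrt (\<zeta> / 6) < norm (Z m \<omega> - X \<omega>)}"
    have "B = A \<inter> {\<omega>\<in>space M. sqrt (\<zeta> / 6) < norm (Z m \<omega> - X \<omega>)}"
      using sets.sets_into_space[OF A] by (auto simp: B_def)
    then have [measurable]: "B \<in> events" by simp
    let ?R = "\<lambda>\<omega>. 2 * (indicat_real A \<omega> * (norm (U \<omega> - Z m \<omega>))\<^sup>2) + \<zeta> / 3 + real L * indicat_real B \<omega>
      + (?\<phi> \<omega> - min (?\<phi> \<omega>) (real L))"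
    have iA: "integrable M (\<lambda>\<omega>. indicat_real A \<omega> * (norm (U \<omega> - Z m \<omega>))\<^sup>2)"
      using integrable_mult_indicator[OF A UZ(1)[of m]] by simp
    have iB: "integrable M (indicat_real B)" by (simp add: emeasure_eq_measure)
    have it: "integrable M (\<lambda>\<omega>. ?\<phi> \<omega> - min (?\<phi> \<omega>) (real L))"
    proof (rule Bochner_Integration.integrable_bound[OF \<phi>])
      show "AE \<omega> in M. norm (?\<phi> \<omega> - min (?\<phi> \<omega>) (real L)) \<le> norm (?\<phi> \<omega>)"
        using \<phi>0 by (intro AE_I2) (simp add: min_def del: zero_le_mult_iff)
    qed measurable
    have "expectation ?\<phi> \<le> expectation ?R"
    proof (rule integral_mono[OF \<phi>])
      show "integrable M ?R" using iA iB it by simp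
      fix \<omega>
      have 1: "?\<phi> \<omega> \<le> real L + (?\<phi> \<omega> - min (?\<phi> \<omega>) (real L))" by simp
      have 2: "0 \<le> ?\<phi> \<omega> - min (?\<phi> \<omega>) (real L)" by simp
      show "?\<phi> \<omega> \<le> ?R \<omega>"
      proof (cases "\<omega> \<in> A \<and> \<omega> \<notin> B")
        case True
        then have "(norm (Z m \<omega> - X \<omega>))\<^sup>2 \<le> (sqrt (\<zeta> / 6))\<^sup>2" by (intro power_mono) (auto simp: B_def)
        then have "(norm (U \<omega> - X \<omega>))\<^sup>2 \<le> 2 * (norm (U \<omega> - Z m \<omega>))\<^sup>2 + \<zeta> / 3"
          using norm_add_sq_le[of "U \<omega> - Z m \<omega>" "Z m \<omega> - X \<omega>"] \<zeta> by simp
        moreover have "0 \<le> real L * indicat_real B \<omega>" by simp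
        ultimately show ?thesis using True 2 by (simp add: indicator_def)
      next
        case False
        then consider "\<omega> \<notin> A" | "\<omega> \<in> A" "\<omega> \<in> B" by blast
        then show ?thesis
        proof cases
          case 2
          have "0 \<le> indicat_real A \<omega> * (norm (U \<omega> - Z m \<omega>))\<^sup>2" by simp
          then show ?thesis using 1 2 \<zeta> by (simp only: indicator_simps)
        qed (use \<zeta> in simp)
      qed
    qed
    also have "\<dots> = 2 * expectation (\<lambda>\<omega>. indicat_real A \<omega> * (norm (U \<omega> - Z m \<omega>))\<^sup>2) + \<zeta> / 3 + real L * prob B
       + expectation (\<lambda>\<omega>. ?\<phi> \<omega> - min (?\<phi> \<omega>) (real L))"
      using iA iB it by (simp add: prob_space)
    also have "\<dots> \<le> 2 * \<kappa> + \<zeta> / 3 + real L * (\<zeta> / (3 * real L)) + \<zeta> / 3"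
      using UZ(2)[of m] m L unfolding B_def by (intro add_mono mult_left_mono) auto
    also have "\<dots> = 2 * \<kappa> + \<zeta>" using L(1) by simp
    finally show "expectation ?\<phi> \<le> 2 * \<kappa> + \<zeta>" .
  qed
qed

context brownian_filtration begin

lemma simple_process_measurable:
  assumes "simple_process F n \<tau> \<xi>" "k < n"
  shows "0 \<le> \<tau> k" "\<tau> k \<le> \<tau> (Suc k)" "\<xi> k \<in> borel_measurable (F (\<tau> k))" "bounded (\<xi> k ` space M)"
    "\<xi> k \<in> borel_measurable M"
proof -
  have mono: "mono_on {..n} \<tau>" and 0: "0 \<le> \<tau> 0" using assms by (auto simp: simple_process_def)
  have "\<tau> 0 \<le> \<tau> k" using assms(2) by (intro mono_onD[OF mono]) auto
  then show nn: "0 \<le> \<tau> k" using 0 by simp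
  show "\<tau> k \<le> \<tau> (Suc k)" using assms(2) by (intro mono_onD[OF mono]) auto
  show m: "\<xi> k \<in> borel_measurable (F (\<tau> k))" and "bounded (\<xi> k ` space M)"
    using assms space_filtration[OF nn] by (auto simp: simple_process_def)
  show "\<xi> k \<in> borel_measurable M" by (rule measurable_filtration_M[OF nn m])
qed

text \<open>Subtract the step function with values \<open>g\<close> from the simple processes \<open>\<phi>\<^sub>j\<close> that define the integral. On
  \<open>A\<close> the squared \<open>L\<^sup>2\<close> distance in time is at most \<open>2 * D j + 2 * \<kappa>\<^sup>2 * t\<close>, where \<open>D j\<close> is the error of \<open>\<phi>\<^sub>j\<close>, and
  \<open>D j\<close> tends to zero in probability. The inequality of Lenglart type bounds the difference of the integrals,
  and \<open>j\<close> tends to infinity.\<close>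

lemma ito_riemann_bound:
  fixes H :: "real \<Rightarrow> 'w \<Rightarrow> real ^ 'q ^ 'd" and g :: "nat \<Rightarrow> 'w \<Rightarrow> real ^ 'q ^ 'd" and s :: "nat \<Rightarrow> real"
    and \<epsilon> \<delta> \<kappa> t :: real
  assumes ito: "has_ito_integral M F W t H I" and t: "0 \<le> t"
    and s: "\<And>k. k < J \<Longrightarrow> 0 \<le> s k \<and> s k \<le> s (Suc k) \<and> s (Suc k) \<le> t"
    and g: "\<And>k. k < J \<Longrightarrow> g k \<in> borel_measurable (F (s k))" "\<And>k. k < J \<Longrightarrow> bounded (g k ` space M)"
    and A: "A \<in> sets M"
    and close: "\<And>\<omega> u. \<omega> \<in> A \<Longrightarrow> 0 < u \<Longrightarrow> u \<le> t \<Longrightarrow>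
      norm (H u \<omega> - (\<Sum>k<J. indicat_real {s k<..s (Suc k)} u *\<^sub>R g k \<omega>)) \<le> \<kappa>"
    and \<epsilon>: "0 < \<epsilon>" and \<delta>: "0 < \<delta>" and \<kappa>: "4 * t * \<kappa>\<^sup>2 \<le> \<delta>"
  shows "prob {\<omega>\<in>A. 2 * \<epsilon> < norm (I \<omega> - (\<Sum>k<J. g k \<omega> *v (W (s (Suc k)) \<omega> - W (s k) \<omega>)))} \<le> CARD('q) * \<delta> / \<epsilon>\<^sup>2"
proof -
  from ito obtain n \<tau> \<xi> where prog: "progressive F t H" and Im [measurable]: "I \<in> borel_measurable M"
    and sp: "\<And>j::nat. simple_process F (n j) (\<tau> j) (\<xi> j)"
    and conv1: "to_zero_in_probability M (\<lambda>j \<omega>. \<integral>\<^sup>+ s\<in>{0..t}. ennreal ((norm (simple_value (n j) (\<tau> j) (\<xi> j) s \<omega> - H s \<omega>))\<^sup>2) \<partial>lborel)"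
    and conv2: "to_zero_in_probability M (\<lambda>j \<omega>. ennreal (norm (simple_integral W t (n j) (\<tau> j) (\<xi> j) \<omega> - I \<omega>)))"
    unfolding has_ito_integral_def by blast
  note spm = simple_process_measurable[OF sp]
  define V where "V j u \<omega> = simple_value (n j) (\<tau> j) (\<xi> j) u \<omega>" for j u \<omega>
  define SI where "SI j \<omega> = simple_integral W t (n j) (\<tau> j) (\<xi> j) \<omega>" for j \<omega>
  define D where "D j \<omega> = (\<integral>\<^sup>+ s\<in>{0..t}. ennreal ((norm (V j s \<omega> - H s \<omega>))\<^sup>2) \<partial>lborel)" for j \<omega>
  define S where "S \<omega> = (\<Sum>k<J. g k \<omega> *v (W (s (Suc k)) \<omega> - W (s k) \<omega>))" for \<omega>
  define G where "G u \<omega> = (\<Sum>k<J. indicat_real {s k<..s (Suc k)} u *\<^sub>R g k \<omega>)" for u \<omega>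
  \<comment> \<open>joint measurability, which makes the error \<open>D\<close> a random variable\<close>
  define R where "R = restrict_space lborel {0..t}"
  have sR: "sets R = sets (restrict_space borel {0..t})"
    unfolding R_def by (rule sets_restrict_space_cong) simp
  have "finite_measure R" unfolding R_def using t
    by (intro finite_measureI) (simp add: space_restrict_space emeasure_restrict_space)
  then interpret R: finite_measure R .
  have Hm: "(\<lambda>(u, \<omega>). H u \<omega>) \<in> borel_measurable (R \<Otimes>\<^sub>M M)"
  proof -
    have h: "(\<lambda>(u, \<omega>). H u \<omega>) \<in> borel_measurable (restrict_space borel {0..t} \<Otimes>\<^sub>M F t)"
      using prog t by (auto simp: progressive_def)
    have "(\<lambda>\<omega>. \<omega>) \<in> measurable M (F t)" by (rule measurable_filtration_M[OF t measurable_ident_sets[OF refl]])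
    then have "(\<lambda>p. (fst p, snd p)) \<in> measurable (R \<Otimes>\<^sub>M M) (restrict_space borel {0..t} \<Otimes>\<^sub>M F t)"
      by (intro measurable_Pair measurable_compose[OF measurable_fst] measurable_compose[OF measurable_snd])
        (simp_all add: measurable_ident_sets sR)
    from measurable_compose[OF this h] show ?thesis by (simp add: split_beta')
  qed
  have Vm: "(\<lambda>(u, \<omega>). V j u \<omega>) \<in> borel_measurable (R \<Otimes>\<^sub>M M)" for j
  proof -
    have "(\<lambda>p. indicat_real {\<tau> j k<..\<tau> j (Suc k)} (fst p) *\<^sub>R \<xi> j k (snd p)) \<in> borel_measurable (R \<Otimes>\<^sub>M M)"
      if "k < n j" for k
    proof -
      have "(\<lambda>u. indicat_real {\<tau> j k<..\<tau> j (Suc k)} u) \<in> borel_measurable R"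
        unfolding R_def by (intro measurable_restrict_space1) simp
      note [measurable] = measurable_compose[OF measurable_fst this] measurable_compose[OF measurable_snd spm(5)[OF that]]
      show ?thesis by measurable
    qed
    then show ?thesis unfolding V_def simple_value_def split_beta' by (intro borel_measurable_sum) auto
  qed
  have Pm: "(\<lambda>(u, \<omega>). ennreal ((norm (V j u \<omega> - H u \<omega>))\<^sup>2)) \<in> borel_measurable (R \<Otimes>\<^sub>M M)" for j
    using Vm[of j] Hm unfolding split_beta' by measurable
  have DR: "D j \<omega> = (\<integral>\<^sup>+ u. ennreal ((norm (V j u \<omega> - H u \<omega>))\<^sup>2) \<partial>R)" for j \<omega>
    unfolding D_def R_def by (subst nn_integral_restrict_space) auto
  have Dm [measurable]: "D j \<in> borel_measurable M" for j
    unfolding DR[abs_def] using measurable_pair_swap[OF Pm[of j]]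
    by (intro R.borel_measurable_nn_integral) (simp add: split_beta')
  have SIm [measurable]: "SI j \<in> borel_measurable M" for j
    unfolding SI_def[abs_def] simple_integral_def
  proof (intro borel_measurable_sum)
    fix k assume "k \<in> {..<n j}"
    then have k: "k < n j" by simp
    have nn: "0 \<le> min t (\<tau> j k)" "0 \<le> min t (\<tau> j (Suc k))" using spm(1,2)[OF k] t by auto
    show "(\<lambda>\<omega>. \<xi> j k \<omega> *v (W (min t (\<tau> j (Suc k))) \<omega> - W (min t (\<tau> j k)) \<omega>)) \<in> borel_measurable M"
      by (intro measurable_matrix_vector_mult borel_measurable_diff measurable_W nn spm(5)[OF k])
  qed
  have Sm [measurable]: "S \<in> borel_measurable M"
    unfolding S_def[abs_def]
  proof (intro borel_measurable_sum)
    fix k assume "k \<in> {..<J}"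
    then have k: "k < J" by simp
    then have "0 \<le> s k" "0 \<le> s (Suc k)" using s[of k] by auto
    note [measurable] = measurable_W[OF this(1)] measurable_W[OF this(2)] measurable_filtration_M[OF this(1) g(1)[OF k]]
    show "(\<lambda>\<omega>. g k \<omega> *v (W (s (Suc k)) \<omega> - W (s k) \<omega>)) \<in> borel_measurable M" by measurable
  qed
  note [measurable] = A
  have Aset: "{\<omega>\<in>A. P \<omega>} = A \<inter> {\<omega>\<in>space M. P \<omega>}" for P using sets.sets_into_space[OF A] by auto
  have step: "prob {\<omega>\<in>A. \<epsilon> < norm (SI j \<omega> - S \<omega>)} \<le> prob {\<omega>\<in>space M. ennreal (\<delta> / 4) < D j \<omega>} + CARD('q) * \<delta> / \<epsilon>\<^sup>2" for j
  proof -
    define K where "K = {..<n j} <+> {..<J}"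
    define a where "a = case_sum (\<lambda>k. min t (\<tau> j k)) s"
    define c where "c = case_sum (\<lambda>k. min t (\<tau> j (Suc k))) (\<lambda>k. s (Suc k))"
    define \<zeta> where "\<zeta> = case_sum (\<xi> j) (\<lambda>k \<omega>. - g k \<omega>)"
    have mneg: "- B *v w = - (B *v w)" for B :: "real ^ 'q ^ 'd" and w
      using matrix_vector_mult_diff_rdistrib[of 0 B w] by simp
    have sumS: "(\<Sum>k\<in>K. \<zeta> k \<omega> *v (W (c k) \<omega> - W (a k) \<omega>)) = SI j \<omega> - S \<omega>" for \<omega>
      unfolding K_def a_def c_def \<zeta>_def SI_def S_def simple_integral_def
      by (subst sum.Plus) (simp_all add: mneg sum_negf)
    have sumV: "(\<Sum>k\<in>K. indicat_real {a k<..c k} u *\<^sub>R \<zeta> k \<omega>) = V j u \<omega> - G u \<omega>" if u: "u \<le> t" for u \<omega>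
    proof -
      have "indicat_real {min t (\<tau> j k)<..min t (\<tau> j (Suc k))} u = indicat_real {\<tau> j k<..\<tau> j (Suc k)} u" for k
        using u by (auto simp: indicator_def min_def)
      then show ?thesis
        unfolding K_def a_def c_def \<zeta>_def V_def G_def simple_value_def
        by (subst sum.Plus) (simp_all add: sum_negf)
    qed
    show ?thesis
      unfolding sumS[symmetric]
    proof (rule interval_family_lenglart[where t = t])
      show "finite K" by (simp add: K_def)
      fix k assume k: "k \<in> K"
      show "0 \<le> a k \<and> a k \<le> c k \<and> c k \<le> t"
        using k spm(1,2)[of _ j] s t unfolding K_def a_def c_def by (auto simp: min_le_iff_disj)
      assume ac: "a k < c k"
      show "\<zeta> k \<in> borel_measurable (F (a k))"
      proof (cases k)
        case (Inl i)
        then have i: "i < n j" using k by (auto simp: K_def)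
        have "a k = \<tau> j i" using ac Inl spm(2)[OF i] unfolding a_def c_def by (auto simp: min_def split: if_splits)
        then show ?thesis using spm(3)[OF i] Inl by (simp add: \<zeta>_def)
      next
        case (Inr i)
        then have i: "i < J" using k by (auto simp: K_def)
        then show ?thesis using g(1)[OF i] Inr by (simp add: \<zeta>_def a_def)
      qed
      show "bounded (\<zeta> k ` space M)"
      proof (cases k)
        case (Inl i)
        then have i: "i < n j" using k by (auto simp: K_def)
        then show ?thesis using spm(4)[OF i] Inl by (simp add: \<zeta>_def)
      next
        case (Inr i)
        then have i: "i < J" using k by (auto simp: K_def)
        then show ?thesis using g(2)[OF i] Inr by (simp add: \<zeta>_def bounded_iff)
      qed
    next
      fix \<omega> assume \<omega>: "\<omega> \<in> A"
        and big: "ennreal \<delta> < (\<integral>\<^sup>+ u\<in>{0..t}. ennreal ((norm (\<Sum>k\<in>K. indicat_real {a k<..c k} u *\<^sub>R \<zeta> k \<omega>))\<^sup>2) \<partial>lborel)"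
      have wM: "\<omega> \<in> space M" using \<omega> sets.sets_into_space[OF A] by auto
      have sec: "(\<lambda>u. ennreal ((norm (V j u \<omega> - H u \<omega>))\<^sup>2)) \<in> borel_measurable R"
        using measurable_compose[OF measurable_Pair2'[OF wM, of R] Pm[of j]] by simp
      have "(\<integral>\<^sup>+ u\<in>{0..t}. ennreal ((norm (\<Sum>k\<in>K. indicat_real {a k<..c k} u *\<^sub>R \<zeta> k \<omega>))\<^sup>2) \<partial>lborel)
        \<le> (\<integral>\<^sup>+ u\<in>{0..t}. (2 * ennreal ((norm (V j u \<omega> - H u \<omega>))\<^sup>2) + ennreal (2 * \<kappa>\<^sup>2)) \<partial>lborel)"
      proof (rule nn_integral_mono_AE)
        show "AE u in lborel. ennreal ((norm (\<Sum>k\<in>K. indicat_real {a k<..c k} u *\<^sub>R \<zeta> k \<omega>))\<^sup>2) * indicator {0..t} u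
          \<le> (2 * ennreal ((norm (V j u \<omega> - H u \<omega>))\<^sup>2) + ennreal (2 * \<kappa>\<^sup>2)) * indicator {0..t} u"
          using AE_lborel_singleton[of 0]
        proof eventually_elim
          case (elim u)
          show ?case
          proof (cases "u \<in> {0..t}")
            case True
            then have u: "0 < u" "u \<le> t" using elim by auto
            have "(norm (V j u \<omega> - G u \<omega>))\<^sup>2 \<le> 2 * (norm (V j u \<omega> - H u \<omega>))\<^sup>2 + 2 * (norm (H u \<omega> - G u \<omega>))\<^sup>2"
              using norm_add_sq_le[of "V j u \<omega> - H u \<omega>" "H u \<omega> - G u \<omega>"] by simp
            also have "(norm (H u \<omega> - G u \<omega>))\<^sup>2 \<le> \<kappa>\<^sup>2" using close[OF \<omega> u] unfolding G_def by (intro power_mono) auto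
            finally have "ennreal ((norm (V j u \<omega> - G u \<omega>))\<^sup>2) \<le> ennreal (2 * (norm (V j u \<omega> - H u \<omega>))\<^sup>2 + 2 * \<kappa>\<^sup>2)"
              by (intro ennreal_leI) simp
            also have "\<dots> = 2 * ennreal ((norm (V j u \<omega> - H u \<omega>))\<^sup>2) + ennreal (2 * \<kappa>\<^sup>2)"
              by (subst ennreal_plus) (simp_all add: ennreal_mult)
            finally show ?thesis using True sumV[OF u(2)] by simp
          qed simp
        qed
      qed
      also have "\<dots> = (\<integral>\<^sup>+ u. (2 * ennreal ((norm (V j u \<omega> - H u \<omega>))\<^sup>2) + ennreal (2 * \<kappa>\<^sup>2)) \<partial>R)"
        unfolding R_def by (subst nn_integral_restrict_space) auto
      also have "\<dots> = 2 * D j \<omega> + ennreal (2 * \<kappa>\<^sup>2) * emeasure R (space R)"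
        using sec by (subst nn_integral_add) (auto simp: nn_integral_cmult DR)
      also have "emeasure R (space R) = ennreal t"
        unfolding R_def using t by (simp add: space_restrict_space emeasure_restrict_space)
      also have "ennreal (2 * \<kappa>\<^sup>2) * ennreal t = ennreal (2 * \<kappa>\<^sup>2 * t)" using t by (intro ennreal_mult[symmetric]) auto
      also have "2 * D j \<omega> + ennreal (2 * \<kappa>\<^sup>2 * t) \<le> 2 * D j \<omega> + ennreal (\<delta> / 2)"
        using \<kappa> by (intro add_left_mono ennreal_leI) (simp add: mult_ac)
      finally have fin: "(\<integral>\<^sup>+ u\<in>{0..t}. ennreal ((norm (\<Sum>k\<in>K. indicat_real {a k<..c k} u *\<^sub>R \<zeta> k \<omega>))\<^sup>2) \<partial>lborel) \<le> 2 * D j \<omega> + ennreal (\<delta> / 2)" .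
      have "ennreal (\<delta> / 4) < D j \<omega>"
      proof (rule ccontr)
        assume "\<not> ennreal (\<delta> / 4) < D j \<omega>"
        then have "2 * D j \<omega> + ennreal (\<delta> / 2) \<le> 2 * ennreal (\<delta> / 4) + ennreal (\<delta> / 2)"
          by (intro add_right_mono mult_left_mono) auto
        also have "2 * ennreal (\<delta> / 4) = ennreal (\<delta> / 2)" using ennreal_mult[of 2 "\<delta> / 4"] \<delta> by simp
        also have "ennreal (\<delta> / 2) + ennreal (\<delta> / 2) = ennreal \<delta>"
          using ennreal_plus[of "\<delta> / 2" "\<delta> / 2"] \<delta> by simp
        finally show False using fin big by simp
      qed
      then show "\<omega> \<in> {\<omega>\<in>space M. ennreal (\<delta> / 4) < D j \<omega>}" using wM by simp
    qed (use A \<epsilon> \<delta> in auto)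
  qed
  have bound: "prob {\<omega>\<in>A. 2 * \<epsilon> < norm (I \<omega> - S \<omega>)} \<le> prob {\<omega>\<in>space M. ennreal \<epsilon> < ennreal (norm (SI j \<omega> - I \<omega>))}
     + (prob {\<omega>\<in>space M. ennreal (\<delta> / 4) < D j \<omega>} + CARD('q) * \<delta> / \<epsilon>\<^sup>2)" for j
  proof -
    have sub: "{\<omega>\<in>A. 2 * \<epsilon> < norm (I \<omega> - S \<omega>)} \<subseteq> {\<omega>\<in>space M. ennreal \<epsilon> < ennreal (norm (SI j \<omega> - I \<omega>))} \<union> {\<omega>\<in>A. \<epsilon> < norm (SI j \<omega> - S \<omega>)}"
    proof
      fix \<omega> assume \<omega>: "\<omega> \<in> {\<omega>\<in>A. 2 * \<epsilon> < norm (I \<omega> - S \<omega>)}"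
      have "norm (I \<omega> - S \<omega>) \<le> norm (SI j \<omega> - I \<omega>) + norm (SI j \<omega> - S \<omega>)"
        using norm_triangle_ineq[of "I \<omega> - SI j \<omega>" "SI j \<omega> - S \<omega>"] by (simp add: norm_minus_commute)
      then have "\<epsilon> < norm (SI j \<omega> - I \<omega>) \<or> \<epsilon> < norm (SI j \<omega> - S \<omega>)" using \<omega> by auto
      then show "\<omega> \<in> {\<omega>\<in>space M. ennreal \<epsilon> < ennreal (norm (SI j \<omega> - I \<omega>))} \<union> {\<omega>\<in>A. \<epsilon> < norm (SI j \<omega> - S \<omega>)}"
        using \<omega> sets.sets_into_space[OF A] \<epsilon> by (auto simp: ennreal_less_iff)
    qed
    have m1: "{\<omega>\<in>space M. ennreal \<epsilon> < ennreal (norm (SI j \<omega> - I \<omega>))} \<in> sets M" by measurable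
    have m2: "{\<omega>\<in>A. \<epsilon> < norm (SI j \<omega> - S \<omega>)} \<in> sets M" unfolding Aset by measurable
    have "prob {\<omega>\<in>A. 2 * \<epsilon> < norm (I \<omega> - S \<omega>)} \<le> prob ({\<omega>\<in>space M. ennreal \<epsilon> < ennreal (norm (SI j \<omega> - I \<omega>))} \<union> {\<omega>\<in>A. \<epsilon> < norm (SI j \<omega> - S \<omega>)})"
      using m1 m2 by (intro finite_measure_mono sub) auto
    also have "\<dots> \<le> prob {\<omega>\<in>space M. ennreal \<epsilon> < ennreal (norm (SI j \<omega> - I \<omega>))} + prob {\<omega>\<in>A. \<epsilon> < norm (SI j \<omega> - S \<omega>)}"
      using m1 m2 by (intro measure_Un_le)
    finally show ?thesis using step[of j] by simp
  qed
  have "(\<lambda>j. prob {\<omega>\<in>space M. ennreal \<epsilon> < ennreal (norm (SI j \<omega> - I \<omega>))}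
     + (prob {\<omega>\<in>space M. ennreal (\<delta> / 4) < D j \<omega>} + CARD('q) * \<delta> / \<epsilon>\<^sup>2)) \<longlonglongrightarrow> 0 + (0 + CARD('q) * \<delta> / \<epsilon>\<^sup>2)"
  proof (intro tendsto_add tendsto_const)
    show "(\<lambda>j. prob {\<omega>\<in>space M. ennreal \<epsilon> < ennreal (norm (SI j \<omega> - I \<omega>))}) \<longlonglongrightarrow> 0"
      using conv2 \<epsilon> unfolding to_zero_in_probability_def SI_def by blast
    have "0 < \<delta> / 4" using \<delta> by simp
    then show "(\<lambda>j. prob {\<omega>\<in>space M. ennreal (\<delta> / 4) < D j \<omega>}) \<longlonglongrightarrow> 0"
      using conv1 unfolding to_zero_in_probability_def D_def V_def by blast
  qed
  then have "prob {\<omega>\<in>A. 2 * \<epsilon> < norm (I \<omega> - S \<omega>)} \<le> 0 + (0 + CARD('q) * \<delta> / \<epsilon>\<^sup>2)"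
    by (rule LIMSEQ_le_const) (use bound in blast)
  then show ?thesis unfolding S_def by simp
qed

end

section \<open>Convergence to the strong solution\<close>

lemma countable_Rats_Int: "countable (\<rat> \<inter> A)"
  using countable_rat by (rule countable_subset[rotated]) auto

locale euler_solution = brownian_sde T b \<sigma> x K M F W
  for T b and \<sigma> :: "real \<Rightarrow> real ^ 'd \<Rightarrow> real ^ 'q ^ 'd" and x K and M :: "'w measure" and F and W :: "real \<Rightarrow> 'w \<Rightarrow> real ^ 'q" +
  fixes X :: "real \<Rightarrow> 'w \<Rightarrow> real ^ 'd"
  assumes X_adapted: "t \<in> {0..T} \<Longrightarrow> X t \<in> borel_measurable (F t)"
    and X_continuous: "\<omega> \<in> space M \<Longrightarrow> continuous_on {0..T} (\<lambda>t. X t \<omega>)"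
    and X_ito: "t \<in> {0..T} \<Longrightarrow> has_ito_integral M F W t (\<lambda>s \<omega>. \<sigma> s (X s \<omega>))
      (\<lambda>\<omega>. X t \<omega> - x - (LBINT s:{0..t}. b s (X s \<omega>)))"
begin

lemma X_measurable: "t \<in> {0..T} \<Longrightarrow> X t \<in> borel_measurable M"
  using X_adapted[of t] measurable_filtration_M[of t] by simp

lemma coeff_path_continuous:
  assumes "\<omega> \<in> space M"
  shows "continuous_on {0..T} (\<lambda>t. b t (X t \<omega>))" "continuous_on {0..T} (\<lambda>t. \<sigma> t (X t \<omega>))"
proof -
  have "continuous_on {0..T} (\<lambda>t. (t, X t \<omega>))" by (intro continuous_intros X_continuous assms)
  from continuous_on_compose2[OF b_cont this] continuous_on_compose2[OF \<sigma>_cont this]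
  show "continuous_on {0..T} (\<lambda>t. b t (X t \<omega>))" "continuous_on {0..T} (\<lambda>t. \<sigma> t (X t \<omega>))" by auto
qed

lemma coeff_path_adapted:
  assumes "t \<in> {0..T}"
  shows "(\<lambda>\<omega>. b t (X t \<omega>)) \<in> borel_measurable (F t)" "(\<lambda>\<omega>. \<sigma> t (X t \<omega>)) \<in> borel_measurable (F t)"
  using measurable_compose[OF X_adapted[OF assms] b_measurable[OF assms]]
    measurable_compose[OF X_adapted[OF assms] \<sigma>_measurable[OF assms]] by auto

text \<open>Times are restricted to rational multiples of \<open>T\<close>, which makes the event measurable and still covers all grid
  points \<open>k * T / m\<close>. The same holds for the event \<open>regular n \<eta>\<close> below, which controls the modulus of
  continuity of the coefficients along the path.\<close>

definition confined :: "real \<Rightarrow> real \<Rightarrow> 'w set" where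
  "confined R t = {\<omega>\<in>space M. \<forall>r\<in>{r\<in>\<rat>. 0 \<le> r \<and> r * T \<le> t}. norm (X (r * T) \<omega>) \<le> R}"

definition regular :: "nat \<Rightarrow> real \<Rightarrow> 'w set" where
  "regular n \<eta> = {\<omega>\<in>space M. \<forall>p\<in>\<rat> \<inter> {0..1}. \<forall>r\<in>\<rat> \<inter> {0..1}. \<bar>p - r\<bar> \<le> 1 / real n \<longrightarrow>
     norm (b (p * T) (X (p * T) \<omega>) - b (r * T) (X (r * T) \<omega>)) \<le> \<eta> \<and>
     norm (\<sigma> (p * T) (X (p * T) \<omega>) - \<sigma> (r * T) (X (r * T) \<omega>)) \<le> \<eta>}"

lemma confined_sets:
  assumes t: "t \<in> {0..T}"
  shows "confined R t \<in> sets (F t)"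
proof -
  have sp: "space M = space (F t)" using t space_filtration[of t] by simp
  have c: "countable {r\<in>\<rat>. 0 \<le> r \<and> r * T \<le> t}" using countable_rat by (rule countable_subset[rotated]) auto
  show ?thesis
    unfolding confined_def sp
  proof (rule sets.sets_Collect_countable_All'[OF _ c])
    fix r assume "r \<in> {r\<in>\<rat>. 0 \<le> r \<and> r * T \<le> t}"
    then have r: "0 \<le> r * T" "r * T \<le> t" using T_pos by auto
    then have rT: "r * T \<in> {0..T}" using t by (meson atLeastAtMost_iff order_trans)
    note [measurable] = measurable_filtration_mono[OF r X_adapted[OF rT]]
    show "{\<omega>\<in>space (F t). norm (X (r * T) \<omega>) \<le> R} \<in> sets (F t)" by measurable
  qed
qed

lemma confined_antimono: "s \<le> t \<Longrightarrow> confined R t \<subseteq> confined R s"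
  unfolding confined_def by auto

lemma confined_mono: "R \<le> R' \<Longrightarrow> confined R t \<subseteq> confined R' t"
  unfolding confined_def by (auto intro: order_trans)

lemma confined_space: "confined R t \<subseteq> space M"
  unfolding confined_def by auto

lemma grid_rational:
  assumes "k \<le> m"
  shows "real k / real m \<in> \<rat> \<inter> {0..1}" "grid m k = real k / real m * T"
  using assms by (auto simp: divide_le_eq)

lemma confined_grid:
  assumes "\<omega> \<in> confined R (grid m k)" "k \<le> m"
  shows "norm (X (grid m k) \<omega>) \<le> R"
proof -
  have "real k / real m \<in> {r\<in>\<rat>. 0 \<le> r \<and> r * T \<le> grid m k}" using grid_rational[OF assms(2)] by auto
  then have "norm (X (real k / real m * T) \<omega>) \<le> R" using assms(1) unfolding confined_def by blast
  then show ?thesis unfolding grid_rational(2)[OF assms(2)] .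
qed

lemma confined_UN: "(\<Union>R::nat. confined (real R) T) = space M"
proof
  show "space M \<subseteq> (\<Union>R::nat. confined (real R) T)"
  proof
    fix \<omega> assume \<omega>: "\<omega> \<in> space M"
    have "bounded ((\<lambda>t. X t \<omega>) ` {0..T})" by (intro compact_imp_bounded compact_continuous_image X_continuous \<omega>) simp
    then obtain B where "\<forall>y\<in>(\<lambda>t. X t \<omega>) ` {0..T}. norm y \<le> B" unfolding bounded_iff ..
    then have B: "norm (X t \<omega>) \<le> B" if "t \<in> {0..T}" for t using that by blast
    obtain R :: nat where R: "B \<le> real R" using real_arch_simple by blast
    have "\<omega> \<in> confined (real R) T" unfolding confined_def using \<omega> T_pos by (auto intro!: order_trans[OF B R])
    then show "\<omega> \<in> (\<Union>R::nat. confined (real R) T)" by blast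
  qed
qed (use confined_space in blast)

lemma regular_sets: "regular n \<eta> \<in> sets M"
proof -
  have X: "(\<lambda>\<omega>. b (r * T) (X (r * T) \<omega>)) \<in> borel_measurable M" "(\<lambda>\<omega>. \<sigma> (r * T) (X (r * T) \<omega>)) \<in> borel_measurable M"
    if "r \<in> \<rat> \<inter> {0..1}" for r
  proof -
    have r: "0 \<le> r * T" "r * T \<in> {0..T}" using that T_pos by (auto simp: mult_le_cancel_right1)
    show "(\<lambda>\<omega>. b (r * T) (X (r * T) \<omega>)) \<in> borel_measurable M" "(\<lambda>\<omega>. \<sigma> (r * T) (X (r * T) \<omega>)) \<in> borel_measurable M"
      using measurable_filtration_M[OF r(1) coeff_path_adapted(1)[OF r(2)]]
        measurable_filtration_M[OF r(1) coeff_path_adapted(2)[OF r(2)]] by auto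
  qed
  show ?thesis
    unfolding regular_def
  proof (intro sets.sets_Collect_countable_All' countable_Rats_Int)
    fix p r :: real assume "p \<in> \<rat> \<inter> {0..1}" "r \<in> \<rat> \<inter> {0..1}"
    note [measurable] = X[OF this(1)] X[OF this(2)]
    show "{\<omega>\<in>space M. \<bar>p - r\<bar> \<le> 1 / real n \<longrightarrow>
     norm (b (p * T) (X (p * T) \<omega>) - b (r * T) (X (r * T) \<omega>)) \<le> \<eta> \<and>
     norm (\<sigma> (p * T) (X (p * T) \<omega>) - \<sigma> (r * T) (X (r * T) \<omega>)) \<le> \<eta>} \<in> sets M"
      by (cases "\<bar>p - r\<bar> \<le> 1 / real n") simp_all
  qed
qed

lemma regularD:
  assumes "\<omega> \<in> regular n \<eta>" "p \<in> \<rat> \<inter> {0..1}" "r \<in> \<rat> \<inter> {0..1}" "\<bar>p - r\<bar> \<le> 1 / real n"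
  shows "norm (b (p * T) (X (p * T) \<omega>) - b (r * T) (X (r * T) \<omega>)) \<le> \<eta>"
    "norm (\<sigma> (p * T) (X (p * T) \<omega>) - \<sigma> (r * T) (X (r * T) \<omega>)) \<le> \<eta>"
  using assms unfolding regular_def by blast+

lemma regular_prob:
  assumes "0 < \<eta>"
  shows "(\<lambda>n. prob (space M - regular n \<eta>)) \<longlonglongrightarrow> 0"
proof -
  have "(\<lambda>i. prob (space M - regular (Suc i) \<eta>)) \<longlonglongrightarrow> prob (\<Inter>i. space M - regular (Suc i) \<eta>)"
  proof (rule finite_Lim_measure_decseq)
    show "range (\<lambda>i. space M - regular (Suc i) \<eta>) \<subseteq> sets M" using regular_sets by auto
    have "regular (Suc i) \<eta> \<subseteq> regular (Suc j) \<eta>" if "i \<le> j" for i j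
    proof -
      have "1 / real (Suc j) \<le> 1 / real (Suc i)" using that by (intro divide_left_mono) auto
      then show ?thesis unfolding regular_def by (auto dest: order_trans)
    qed
    then show "decseq (\<lambda>i. space M - regular (Suc i) \<eta>)" unfolding decseq_def by blast
  qed
  also have "(\<Inter>i. space M - regular (Suc i) \<eta>) = {}"
  proof -
    have "\<exists>i. \<omega> \<in> regular (Suc i) \<eta>" if \<omega>: "\<omega> \<in> space M" for \<omega>
    proof -
      have "uniformly_continuous_on {0..T} (\<lambda>t. b t (X t \<omega>))" "uniformly_continuous_on {0..T} (\<lambda>t. \<sigma> t (X t \<omega>))"
        using coeff_path_continuous[OF \<omega>] by (auto intro: compact_uniformly_continuous)
      then obtain d1 d2 where d: "0 < d1" "0 < d2"
        "\<And>s t. s \<in> {0..T} \<Longrightarrow> t \<in> {0..T} \<Longrightarrow> dist s t < d1 \<Longrightarrow> dist (b s (X s \<omega>)) (b t (X t \<omega>)) < \<eta>"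
        "\<And>s t. s \<in> {0..T} \<Longrightarrow> t \<in> {0..T} \<Longrightarrow> dist s t < d2 \<Longrightarrow> dist (\<sigma> s (X s \<omega>)) (\<sigma> t (X t \<omega>)) < \<eta>"
        unfolding uniformly_continuous_on_def using assms by metis
      have "0 < min d1 d2 / T" using d T_pos by simp
      then obtain i :: nat where i: "inverse (real (Suc i)) < min d1 d2 / T" using reals_Archimedean by blast
      have "\<omega> \<in> regular (Suc i) \<eta>"
        unfolding regular_def
      proof (intro CollectI conjI \<omega> ballI impI)
        fix p r :: real assume pr: "p \<in> \<rat> \<inter> {0..1}" "r \<in> \<rat> \<inter> {0..1}" "\<bar>p - r\<bar> \<le> 1 / real (Suc i)"
        have t: "p * T \<in> {0..T}" "r * T \<in> {0..T}" using pr T_pos by (auto simp: mult_le_cancel_right1)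
        have "\<bar>p - r\<bar> < min d1 d2 / T" using pr(3) i by (simp add: inverse_eq_divide)
        then have "\<bar>p - r\<bar> * T < min d1 d2" using T_pos pos_less_divide_eq by blast
        moreover have "dist (p * T) (r * T) = \<bar>p - r\<bar> * T"
          using T_pos by (simp add: dist_real_def left_diff_distrib[symmetric] abs_mult)
        ultimately have "dist (p * T) (r * T) < d1" "dist (p * T) (r * T) < d2" by auto
        then show "norm (b (p * T) (X (p * T) \<omega>) - b (r * T) (X (r * T) \<omega>)) \<le> \<eta>"
          "norm (\<sigma> (p * T) (X (p * T) \<omega>) - \<sigma> (r * T) (X (r * T) \<omega>)) \<le> \<eta>"
          using d(3)[OF t] d(4)[OF t] by (auto simp: dist_norm less_imp_le)
      qed
      then show ?thesis by blast
    qed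
    then show ?thesis by blast
  qed
  finally show ?thesis by (simp add: LIMSEQ_imp_Suc)
qed

lemma regular_grid:
  assumes \<omega>: "\<omega> \<in> regular n \<eta>" and "i \<le> n" "0 < m" "j \<le> n * m" "i = j div m"
  shows "norm (b (grid n i) (X (grid n i) \<omega>) - b (grid (n * m) j) (X (grid (n * m) j) \<omega>)) \<le> \<eta>"
    "norm (\<sigma> (grid n i) (X (grid n i) \<omega>) - \<sigma> (grid (n * m) j) (X (grid (n * m) j) \<omega>)) \<le> \<eta>"
proof -
  have bb: "\<bar>grid n i - grid (n * m) j\<bar> \<le> T / real n"
    using block_bounds[OF \<open>0 < m\<close>, where n = n and j = j] assms(5) by auto
  have "\<bar>real i / real n - real j / real (n * m)\<bar> * T = \<bar>grid n i - grid (n * m) j\<bar>"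
    using T_pos by (simp add: abs_mult_pos left_diff_distrib)
  then have "\<bar>real i / real n - real j / real (n * m)\<bar> * T \<le> 1 / real n * T" using bb by simp
  then have "\<bar>real i / real n - real j / real (n * m)\<bar> \<le> 1 / real n" using T_pos by (rule mult_right_le_imp_le)
  then show "norm (b (grid n i) (X (grid n i) \<omega>) - b (grid (n * m) j) (X (grid (n * m) j) \<omega>)) \<le> \<eta>"
    "norm (\<sigma> (grid n i) (X (grid n i) \<omega>) - \<sigma> (grid (n * m) j) (X (grid (n * m) j) \<omega>)) \<le> \<eta>"
    unfolding grid_rational(2)[OF assms(2)] grid_rational(2)[OF assms(4)]
    by (rule regularD[OF \<omega> grid_rational(1)[OF assms(2)] grid_rational(1)[OF assms(4)]])+
qed

lemma regular_cell:
  assumes \<omega>: "\<omega> \<in> regular N \<eta>" and "0 < N" "0 \<le> \<eta>" "k < N" and u: "grid N k < u" "u \<le> grid N (Suc k)"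
  shows "norm (b u (X u \<omega>) - b (grid N k) (X (grid N k) \<omega>)) \<le> \<eta>"
    "norm (\<sigma> u (X u \<omega>) - \<sigma> (grid N k) (X (grid N k) \<omega>)) \<le> \<eta>"
proof -
  have wM: "\<omega> \<in> space M" using \<omega> by (simp add: regular_def)
  let ?a = "grid N k"
  have uT: "u \<le> T" using u(2) grid_time_mem[of "Suc k" N] assms(4) by simp
  have sub: "{?a..T} \<subseteq> {0..T}" using grid_nonneg[of k N] by auto
  have cont: "continuous_on {?a..T} (\<lambda>t. b t (X t \<omega>))" "continuous_on {?a..T} (\<lambda>t. \<sigma> t (X t \<omega>))"
    using coeff_path_continuous[OF wM] sub continuous_on_subset by blast+
  have rat: "norm (b (r * T) (X (r * T) \<omega>) - b ?a (X ?a \<omega>)) \<le> \<eta> \<and> norm (\<sigma> (r * T) (X (r * T) \<omega>) - \<sigma> ?a (X ?a \<omega>)) \<le> \<eta>"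
    if r: "r \<in> \<rat>" "?a \<le> r * T" "r * T \<le> u" for r
  proof -
    have "0 \<le> r * T" using r(2) grid_nonneg[of k N] by linarith
    then have r0: "0 \<le> r" using T_pos by (simp add: zero_le_mult_iff)
    have "r * T \<le> 1 * T" using r(3) uT by simp
    then have r1: "r \<le> 1" using T_pos by (rule mult_right_le_imp_le)
    have "r * T - ?a \<le> T / real N" using r(3) u(2) unfolding grid_Suc by linarith
    then have "(r - real k / real N) * T \<le> 1 / real N * T" by (simp add: left_diff_distrib)
    then have 1: "r - real k / real N \<le> 1 / real N" using T_pos by (rule mult_right_le_imp_le)
    have "real k / real N * T \<le> r * T" using r(2) by simp
    then have 2: "real k / real N \<le> r" using T_pos by (rule mult_right_le_imp_le)
    have "\<bar>r - real k / real N\<bar> \<le> 1 / real N" using 1 2 by simp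
    moreover have "k \<le> N" "r \<in> \<rat> \<inter> {0..1}" using assms(4) r(1) r0 r1 by auto
    ultimately show ?thesis
      unfolding grid_rational(2)[OF \<open>k \<le> N\<close>]
      using regularD[OF \<omega> _ grid_rational(1)[OF \<open>k \<le> N\<close>], of r] by blast
  qed
  show "norm (b u (X u \<omega>) - b ?a (X ?a \<omega>)) \<le> \<eta>"
    by (rule rational_bound_extends[OF T_pos cont(1) u(1) uT]) (use rat in auto)
  show "norm (\<sigma> u (X u \<omega>) - \<sigma> ?a (X ?a \<omega>)) \<le> \<eta>"
    by (rule rational_bound_extends[OF T_pos cont(2) u(1) uT]) (use rat in auto)
qed

text \<open>The coefficients along the solution, set to zero once \<open>X\<close> has left the ball of radius \<open>R\<close>. They are bounded
  and adapted, whatever the moments of \<open>X\<close> are.\<close>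

definition loc_b :: "real \<Rightarrow> nat \<Rightarrow> nat \<Rightarrow> 'w \<Rightarrow> real ^ 'd" where
  "loc_b R N j \<omega> = indicat_real (confined R (grid N j)) \<omega> *\<^sub>R b (grid N j) (X (grid N j) \<omega>)"

definition loc_\<sigma> :: "real \<Rightarrow> nat \<Rightarrow> nat \<Rightarrow> 'w \<Rightarrow> real ^ 'q ^ 'd" where
  "loc_\<sigma> R N j \<omega> = indicat_real (confined R (grid N j)) \<omega> *\<^sub>R \<sigma> (grid N j) (X (grid N j) \<omega>)"

definition riemann :: "real \<Rightarrow> nat \<Rightarrow> nat \<Rightarrow> 'w \<Rightarrow> real ^ 'd" where
  "riemann R N j \<omega> = x + (\<Sum>i<j. (T / real N) *\<^sub>R loc_b R N i \<omega>
     + loc_\<sigma> R N i \<omega> *v (W (grid N (Suc i)) \<omega> - W (grid N i) \<omega>))"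

lemma loc_adapted:
  assumes "j \<le> N"
  shows "loc_b R N j \<in> borel_measurable (F (grid N j))" "loc_\<sigma> R N j \<in> borel_measurable (F (grid N j))"
proof -
  note t = grid_time_mem[OF assms]
  note [measurable] = coeff_path_adapted[OF t] confined_sets[OF t]
  show "loc_b R N j \<in> borel_measurable (F (grid N j))" "loc_\<sigma> R N j \<in> borel_measurable (F (grid N j))"
    unfolding loc_b_def[abs_def] loc_\<sigma>_def[abs_def] by measurable
qed

lemma loc_bound:
  assumes "j \<le> N" "0 \<le> R"
  shows "norm (loc_b R N j \<omega>) \<le> K * (1 + R)" "norm (loc_\<sigma> R N j \<omega>) \<le> K * (1 + R)"
proof -
  note t = grid_time_mem[OF assms(1)]
  have 0: "0 \<le> K * (1 + R)" using K_pos assms by simp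
  have "norm (b (grid N j) (X (grid N j) \<omega>)) \<le> K * (1 + R)" "norm (\<sigma> (grid N j) (X (grid N j) \<omega>)) \<le> K * (1 + R)"
    if "\<omega> \<in> confined R (grid N j)"
  proof -
    have "K * (1 + norm (X (grid N j) \<omega>)) \<le> K * (1 + R)"
      using confined_grid[OF that assms(1)] K_pos by (intro mult_left_mono) auto
    then show "norm (b (grid N j) (X (grid N j) \<omega>)) \<le> K * (1 + R)" "norm (\<sigma> (grid N j) (X (grid N j) \<omega>)) \<le> K * (1 + R)"
      using b_growth[OF t] \<sigma>_growth[OF t] order_trans by blast+
  qed
  then show "norm (loc_b R N j \<omega>) \<le> K * (1 + R)" "norm (loc_\<sigma> R N j \<omega>) \<le> K * (1 + R)"
    using 0 by (auto simp: loc_b_def loc_\<sigma>_def indicator_def)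
qed

lemma loc_L2:
  assumes "j \<le> N" "0 \<le> R"
  shows "integrable M (\<lambda>\<omega>. (norm (loc_b R N j \<omega>))\<^sup>2)" "integrable M (\<lambda>\<omega>. (norm (loc_\<sigma> R N j \<omega>))\<^sup>2)"
proof -
  note m = measurable_filtration_M[OF grid_nonneg loc_adapted(1)[OF assms(1)]] measurable_filtration_M[OF grid_nonneg loc_adapted(2)[OF assms(1)]]
  show "integrable M (\<lambda>\<omega>. (norm (loc_b R N j \<omega>))\<^sup>2)"
    using m(1)[of R] by (intro integrable_const_bound[where B = "(K * (1 + R))\<^sup>2"])
      (auto intro!: AE_I2 power_mono loc_bound[OF assms])
  show "integrable M (\<lambda>\<omega>. (norm (loc_\<sigma> R N j \<omega>))\<^sup>2)"
    using m(2)[of R] by (intro integrable_const_bound[where B = "(K * (1 + R))\<^sup>2"])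
      (auto intro!: AE_I2 power_mono loc_bound[OF assms])
qed

lemma riemann_measurable:
  assumes "j \<le> N"
  shows "riemann R N j \<in> borel_measurable M"
  unfolding riemann_def[abs_def]
proof (intro borel_measurable_add borel_measurable_const borel_measurable_sum)
  fix i assume "i \<in> {..<j}"
  then have i: "i \<le> N" using assms by simp
  note m = measurable_filtration_M[OF grid_nonneg loc_adapted(1)[OF i]] measurable_filtration_M[OF grid_nonneg loc_adapted(2)[OF i]]
  show "(\<lambda>\<omega>. (T / real N) *\<^sub>R loc_b R N i \<omega>) \<in> borel_measurable M" using m(1)[of R] by measurable
  show "(\<lambda>\<omega>. loc_\<sigma> R N i \<omega> *v (W (grid N (Suc i)) \<omega> - W (grid N i) \<omega>)) \<in> borel_measurable M"
    by (intro measurable_matrix_vector_mult borel_measurable_diff measurable_W grid_nonneg m(2))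
qed

text \<open>On \<open>confined R t\<close> the localized coefficients are the true ones up to time \<open>t\<close>. If moreover \<open>regular N \<eta>\<close>
  occurs, they are within \<open>\<eta>\<close> of the coefficients at all times of a cell, so the drift sums are close to the
  integral and \<open>ito_riemann_bound\<close> applies to the rest.\<close>

lemma riemann_converges:
  assumes "0 \<le> R" "0 < \<epsilon>" "0 < \<theta>"
  shows "\<exists>N0>0. \<forall>N\<ge>N0. \<forall>j\<le>N. prob {\<omega>\<in>confined R (grid N j). \<epsilon> < norm (riemann R N j \<omega> - X (grid N j) \<omega>)} \<le> \<theta>"
proof -
  define \<delta> where "\<delta> = \<theta> * \<epsilon>\<^sup>2 / (32 * CARD('q))"
  have \<delta>: "0 < \<delta>" using assms by (simp add: \<delta>_def)
  have \<delta>\<theta>: "CARD('q) * \<delta> / (\<epsilon> / 4)\<^sup>2 = \<theta> / 2" using assms by (simp add: \<delta>_def power_divide)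
  define \<eta> where "\<eta> = min (\<epsilon> / (2 * T)) (sqrt (\<delta> / (4 * T)))"
  have \<eta>: "0 < \<eta>" using assms T_pos \<delta> by (simp add: \<eta>_def)
  have \<eta>1: "\<eta> * T \<le> \<epsilon> / 2"
  proof -
    have "\<eta> * T \<le> \<epsilon> / (2 * T) * T" using T_pos by (intro mult_right_mono) (auto simp: \<eta>_def)
    then show ?thesis using T_pos by simp
  qed
  have \<eta>2: "4 * T * \<eta>\<^sup>2 \<le> \<delta>"
  proof -
    have "\<eta>\<^sup>2 \<le> (sqrt (\<delta> / (4 * T)))\<^sup>2" using \<eta> by (intro power_mono) (auto simp: \<eta>_def)
    also have "\<dots> = \<delta> / (4 * T)" using \<delta> T_pos by simp
    finally show ?thesis using T_pos by (simp add: field_simps)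
  qed
  have "\<forall>\<^sub>F n in sequentially. prob (space M - regular n \<eta>) < \<theta> / 2"
    using order_tendstoD(2)[OF regular_prob[OF \<eta>], of "\<theta> / 2"] assms by simp
  then obtain N1 where N1: "\<forall>n\<ge>N1. prob (space M - regular n \<eta>) < \<theta> / 2"
    unfolding eventually_sequentially ..
  show ?thesis
  proof (intro exI[of _ "Suc N1"] conjI allI impI)
    fix N j assume N: "Suc N1 \<le> N" and j: "j \<le> N"
    have N0: "0 < N" using N by simp
    let ?t = "grid N j"
    have t: "?t \<in> {0..T}" using j by (rule grid_time_mem)
    have t0: "0 \<le> ?t" by (rule grid_nonneg)
    have tT: "?t \<le> T" using t by simp
    define A where "A = confined R ?t \<inter> regular N \<eta>"
    have cM: "confined R ?t \<in> sets M" by (rule sets_filtration_M[OF t0 confined_sets[OF t]])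
    have A: "A \<in> sets M" unfolding A_def using cM regular_sets by auto
    define J where "J \<omega> = X ?t \<omega> - x - (LBINT s:{0..?t}. b s (X s \<omega>))" for \<omega>
    define S where "S \<omega> = (\<Sum>i<j. loc_\<sigma> R N i \<omega> *v (W (grid N (Suc i)) \<omega> - W (grid N i) \<omega>))" for \<omega>
    have mono: "grid N i \<le> grid N (Suc i)" for i by (intro grid_mono) simp
    have loc_eq: "loc_b R N i \<omega> = b (grid N i) (X (grid N i) \<omega>)" "loc_\<sigma> R N i \<omega> = \<sigma> (grid N i) (X (grid N i) \<omega>)"
      if "\<omega> \<in> A" "i \<le> j" for \<omega> i
      using that confined_antimono[OF grid_mono[OF that(2)], of R N] by (auto simp: A_def loc_b_def loc_\<sigma>_def)
    have close: "norm (b u (X u \<omega>) - (\<Sum>i<j. indicat_real {grid N i<..grid N (Suc i)} u *\<^sub>R loc_b R N i \<omega>)) \<le> \<eta>"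
      "norm (\<sigma> u (X u \<omega>) - (\<Sum>i<j. indicat_real {grid N i<..grid N (Suc i)} u *\<^sub>R loc_\<sigma> R N i \<omega>)) \<le> \<eta>"
      if \<omega>: "\<omega> \<in> A" and u: "0 < u" "u \<le> ?t" for \<omega> u
    proof -
      have u0: "grid N 0 < u" using u by simp
      obtain k where k: "k < j" "grid N k < u" "u \<le> grid N (Suc k)"
        "(\<Sum>i<j. indicat_real {grid N i<..grid N (Suc i)} u *\<^sub>R loc_b R N i \<omega>) = loc_b R N k \<omega>"
        using step_function_value[of j "grid N", OF mono u0 u(2), of "\<lambda>i. loc_b R N i \<omega>"] by blast
      obtain l where l: "l < j" "grid N l < u" "u \<le> grid N (Suc l)"
        "(\<Sum>i<j. indicat_real {grid N i<..grid N (Suc i)} u *\<^sub>R loc_\<sigma> R N i \<omega>) = loc_\<sigma> R N l \<omega>"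
        using step_function_value[of j "grid N", OF mono u0 u(2), of "\<lambda>i. loc_\<sigma> R N i \<omega>"] by blast
      have reg: "\<omega> \<in> regular N \<eta>" using \<omega> by (simp add: A_def)
      show "norm (b u (X u \<omega>) - (\<Sum>i<j. indicat_real {grid N i<..grid N (Suc i)} u *\<^sub>R loc_b R N i \<omega>)) \<le> \<eta>"
        unfolding k(4) loc_eq(1)[OF \<omega> less_imp_le[OF k(1)]]
        using k(1) j \<eta> by (intro regular_cell(1)[OF reg N0 _ _ k(2,3)]) auto
      show "norm (\<sigma> u (X u \<omega>) - (\<Sum>i<j. indicat_real {grid N i<..grid N (Suc i)} u *\<^sub>R loc_\<sigma> R N i \<omega>)) \<le> \<eta>"
        unfolding l(4) loc_eq(2)[OF \<omega> less_imp_le[OF l(1)]]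
        using l(1) j \<eta> by (intro regular_cell(2)[OF reg N0 _ _ l(2,3)]) auto
    qed
    have drift: "norm ((\<Sum>i<j. (T / real N) *\<^sub>R loc_b R N i \<omega>) - (LBINT s:{0..?t}. b s (X s \<omega>))) \<le> \<epsilon> / 2" if \<omega>: "\<omega> \<in> A" for \<omega>
    proof -
      have wM: "\<omega> \<in> space M" using \<omega> confined_space by (auto simp: A_def)
      have "continuous_on {0..?t} (\<lambda>s. b s (X s \<omega>))"
        by (rule continuous_on_subset[OF coeff_path_continuous(1)[OF wM]]) (use tT in auto)
      then have "norm ((\<Sum>i<j. (grid N (Suc i) - grid N i) *\<^sub>R loc_b R N i \<omega>) - (LBINT s:{0..?t}. b s (X s \<omega>))) \<le> \<eta> * ?t"
        by (intro riemann_sum_error mono t0 close(1)[OF \<omega>]) simp_all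
      also have "\<eta> * ?t \<le> \<eta> * T" using tT \<eta> by (intro mult_left_mono) auto
      also note \<eta>1
      finally show ?thesis by (simp only: grid_Suc add_diff_cancel_left')
    qed
    have "prob {\<omega>\<in>A. 2 * (\<epsilon> / 4) < norm (J \<omega> - S \<omega>)} \<le> CARD('q) * \<delta> / (\<epsilon> / 4)\<^sup>2"
      unfolding S_def
    proof (rule ito_riemann_bound[OF X_ito[OF t, folded J_def] t0 _ _ _ A close(2)])
      fix k assume k: "k < j"
      then have kN: "k \<le> N" using j by simp
      show "0 \<le> grid N k \<and> grid N k \<le> grid N (Suc k) \<and> grid N (Suc k) \<le> ?t"
        using grid_nonneg mono grid_mono[of "Suc k" j N] k by simp
      show "loc_\<sigma> R N k \<in> borel_measurable (F (grid N k))" by (rule loc_adapted(2)[OF kN])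
      show "bounded (loc_\<sigma> R N k ` space M)" using loc_bound(2)[OF kN assms(1)] unfolding bounded_iff by auto
    next
      have "4 * ?t * \<eta>\<^sup>2 \<le> 4 * T * \<eta>\<^sup>2" using tT by (intro mult_right_mono mult_left_mono) auto
      then show "4 * ?t * \<eta>\<^sup>2 \<le> \<delta>" using \<eta>2 by simp
    qed (use assms \<delta> in auto)
    then have p1: "prob {\<omega>\<in>A. 2 * (\<epsilon> / 4) < norm (J \<omega> - S \<omega>)} \<le> \<theta> / 2" unfolding \<delta>\<theta> .
    have p2: "prob (space M - regular N \<eta>) \<le> \<theta> / 2" using N1 N by (simp add: less_imp_le)
    have Jm: "J \<in> borel_measurable M" using X_ito[OF t] unfolding J_def[abs_def] has_ito_integral_def by blast
    have Sm: "S \<in> borel_measurable M"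
      unfolding S_def[abs_def]
    proof (intro borel_measurable_sum measurable_matrix_vector_mult borel_measurable_diff measurable_W grid_nonneg)
      fix i assume "i \<in> {..<j}"
      then show "loc_\<sigma> R N i \<in> borel_measurable M"
        using j by (intro measurable_filtration_M[OF grid_nonneg loc_adapted(2)]) simp
    qed
    have sub: "{\<omega>\<in>confined R ?t. \<epsilon> < norm (riemann R N j \<omega> - X ?t \<omega>)}
      \<subseteq> (space M - regular N \<eta>) \<union> {\<omega>\<in>A. 2 * (\<epsilon> / 4) < norm (J \<omega> - S \<omega>)}"
    proof
      fix \<omega> assume \<omega>: "\<omega> \<in> {\<omega>\<in>confined R ?t. \<epsilon> < norm (riemann R N j \<omega> - X ?t \<omega>)}"
      then have wM: "\<omega> \<in> space M" using confined_space by blast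
      show "\<omega> \<in> (space M - regular N \<eta>) \<union> {\<omega>\<in>A. 2 * (\<epsilon> / 4) < norm (J \<omega> - S \<omega>)}"
      proof (cases "\<omega> \<in> regular N \<eta>")
        case True
        then have wA: "\<omega> \<in> A" using \<omega> by (simp add: A_def)
        have "riemann R N j \<omega> - X ?t \<omega> = ((\<Sum>i<j. (T / real N) *\<^sub>R loc_b R N i \<omega>) - (LBINT s:{0..?t}. b s (X s \<omega>))) + (S \<omega> - J \<omega>)"
          by (simp add: riemann_def J_def S_def sum.distrib)
        then have "norm (riemann R N j \<omega> - X ?t \<omega>) \<le> \<epsilon> / 2 + norm (J \<omega> - S \<omega>)"
          using drift[OF wA]
            norm_triangle_ineq[of "(\<Sum>i<j. (T / real N) *\<^sub>R loc_b R N i \<omega>) - (LBINT s:{0..?t}. b s (X s \<omega>))" "S \<omega> - J \<omega>"]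
          by (simp add: norm_minus_commute[of "J \<omega>"])
        then have "2 * (\<epsilon> / 4) < norm (J \<omega> - S \<omega>)" using \<omega> by simp
        then show ?thesis using wA by simp
      qed (use wM in simp)
    qed
    have m2: "{\<omega>\<in>A. 2 * (\<epsilon> / 4) < norm (J \<omega> - S \<omega>)} \<in> sets M"
    proof -
      note [measurable] = Jm Sm A
      have "{\<omega>\<in>A. 2 * (\<epsilon> / 4) < norm (J \<omega> - S \<omega>)} = A \<inter> {\<omega>\<in>space M. 2 * (\<epsilon> / 4) < norm (J \<omega> - S \<omega>)}"
        using sets.sets_into_space[OF A] by auto
      then show ?thesis by simp
    qed
    have "prob {\<omega>\<in>confined R ?t. \<epsilon> < norm (riemann R N j \<omega> - X ?t \<omega>)} \<le> prob ((space M - regular N \<eta>) \<union> {\<omega>\<in>A. 2 * (\<epsilon> / 4) < norm (J \<omega> - S \<omega>)})"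
      using m2 regular_sets by (intro finite_measure_mono sub) auto
    also have "\<dots> \<le> prob (space M - regular N \<eta>) + prob {\<omega>\<in>A. 2 * (\<epsilon> / 4) < norm (J \<omega> - S \<omega>)}"
      using m2 regular_sets by (intro measure_Un_le) auto
    also have "\<dots> \<le> \<theta>" using p1 p2 by simp
    finally show "prob {\<omega>\<in>confined R ?t. \<epsilon> < norm (riemann R N j \<omega> - X ?t \<omega>)} \<le> \<theta>" .
  qed simp
qed

end

lemma sum_blocks:
  fixes f :: "nat \<Rightarrow> real"
  assumes "0 < m"
  shows "(\<Sum>j<c * m. f (j div m)) = real m * (\<Sum>i<c. f i)"
proof -
  have "(\<Sum>j<c * m. f (j div m)) = (\<Sum>i<c. \<Sum>j = i * m..<i * m + m. f (j div m))"
    by (rule sum.nat_group[symmetric])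
  also have "\<dots> = (\<Sum>i<c. \<Sum>j = i * m..<i * m + m. f i)"
  proof (intro sum.cong refl)
    fix i j assume "j \<in> {i * m..<i * m + m}"
    then have "j div m = i" by (intro div_nat_eqI) (auto simp: mult.commute)
    then show "f (j div m) = f i" by simp
  qed
  also have "\<dots> = real m * (\<Sum>i<c. f i)" by (simp add: sum_distrib_left)
  finally show ?thesis .
qed

context euler_solution begin

lemma confined_sets_grid: "j \<le> N \<Longrightarrow> confined R (grid N j) \<in> sets M"
  by (rule sets_filtration_M[OF grid_nonneg confined_sets[OF grid_time_mem]])

lemma confined_error_integrable:
  assumes "0 < n" "i \<le> n"
  shows "integrable M (\<lambda>\<omega>. indicat_real (confined R (grid n i)) \<omega> * (norm (E n i \<omega> - X (grid n i) \<omega>))\<^sup>2)"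
proof (rule Bochner_Integration.integrable_bound)
  note [measurable] = euler_measurable[OF assms(2)] X_measurable[OF grid_time_mem[OF assms(2)]] confined_sets_grid[OF assms(2)]
  show "integrable M (\<lambda>\<omega>. 2 * (norm (E n i \<omega>))\<^sup>2 + 2 * R\<^sup>2)" using euler_L2[OF assms] by simp
  show "AE \<omega> in M. norm (indicat_real (confined R (grid n i)) \<omega> * (norm (E n i \<omega> - X (grid n i) \<omega>))\<^sup>2) \<le> norm (2 * (norm (E n i \<omega>))\<^sup>2 + 2 * R\<^sup>2)"
  proof (rule AE_I2)
    fix \<omega>
    have "(norm (E n i \<omega> - X (grid n i) \<omega>))\<^sup>2 \<le> 2 * (norm (E n i \<omega>))\<^sup>2 + 2 * R\<^sup>2" if "\<omega> \<in> confined R (grid n i)"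
      using norm_diff_sq_le[of "E n i \<omega>" "X (grid n i) \<omega>"] power_mono[OF confined_grid[OF that assms(2)], of 2] by simp
    then show "norm (indicat_real (confined R (grid n i)) \<omega> * (norm (E n i \<omega> - X (grid n i) \<omega>))\<^sup>2) \<le> norm (2 * (norm (E n i \<omega>))\<^sup>2 + 2 * R\<^sup>2)"
      by (auto simp: indicator_def)
  qed
  show "(\<lambda>\<omega>. indicat_real (confined R (grid n i)) \<omega> * (norm (E n i \<omega> - X (grid n i) \<omega>))\<^sup>2) \<in> borel_measurable M"
    by measurable
qed

lemma local_error_pointwise:
  fixes g :: "real \<Rightarrow> real ^ 'd \<Rightarrow> 'e::real_normed_vector"
  assumes lip: "\<And>t y z. t \<in> {0..T} \<Longrightarrow> norm (g t y - g t z) \<le> K * norm (y - z)"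
    and growth: "\<And>t y. t \<in> {0..T} \<Longrightarrow> norm (g t y) \<le> K * (1 + norm y)"
    and reg: "\<omega> \<in> regular n \<eta> \<Longrightarrow> norm (g (grid n i) (X (grid n i) \<omega>) - g (grid N j) (X (grid N j) \<omega>)) \<le> \<eta>"
    and i: "i \<le> n" and j: "j \<le> N" and le: "grid n i \<le> grid N j" and \<omega>: "\<omega> \<in> confined R (grid N j)" and R: "0 \<le> R"
  shows "(norm (g (grid n i) (E n i \<omega>) - g (grid N j) (X (grid N j) \<omega>)))\<^sup>2 \<le>
     2 * K\<^sup>2 * (norm (E n i \<omega> - X (grid n i) \<omega>))\<^sup>2 + 2 * (\<eta>\<^sup>2 + 4 * (K * (1 + R))\<^sup>2 * indicat_real (space M - regular n \<eta>) \<omega>)"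
proof -
  let ?t = "grid n i" and ?s = "grid N j"
  have t: "?t \<in> {0..T}" "?s \<in> {0..T}" using i j by (auto intro: grid_time_mem simp del: atLeastAtMost_iff)
  have \<omega>': "\<omega> \<in> confined R ?t" using \<omega> confined_antimono[OF le] by blast
  have wM: "\<omega> \<in> space M" using \<omega> confined_space by blast
  have 1: "(norm (g ?t (E n i \<omega>) - g ?t (X ?t \<omega>)))\<^sup>2 \<le> K\<^sup>2 * (norm (E n i \<omega> - X ?t \<omega>))\<^sup>2"
    using power_mono[OF lip[OF t(1), of "E n i \<omega>" "X ?t \<omega>"], of 2] by (simp add: power_mult_distrib)
  have 2: "(norm (g ?t (X ?t \<omega>) - g ?s (X ?s \<omega>)))\<^sup>2 \<le> \<eta>\<^sup>2 + 4 * (K * (1 + R))\<^sup>2 * indicat_real (space M - regular n \<eta>) \<omega>"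
  proof (cases "\<omega> \<in> regular n \<eta>")
    case True
    then show ?thesis using power_mono[OF reg[OF True], of 2] by simp
  next
    case False
    have "K * (1 + norm (X ?t \<omega>)) \<le> K * (1 + R)" "K * (1 + norm (X ?s \<omega>)) \<le> K * (1 + R)"
      using confined_grid[OF \<omega>' i] confined_grid[OF \<omega> j] K_pos by (auto intro!: mult_left_mono)
    then have "norm (g ?t (X ?t \<omega>)) \<le> K * (1 + R)" "norm (g ?s (X ?s \<omega>)) \<le> K * (1 + R)"
      using growth[OF t(1), of "X ?t \<omega>"] growth[OF t(2), of "X ?s \<omega>"] by linarith+
    then have "(norm (g ?t (X ?t \<omega>)))\<^sup>2 \<le> (K * (1 + R))\<^sup>2" "(norm (g ?s (X ?s \<omega>)))\<^sup>2 \<le> (K * (1 + R))\<^sup>2"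
      by (auto intro!: power_mono)
    then have "(norm (g ?t (X ?t \<omega>) - g ?s (X ?s \<omega>)))\<^sup>2 \<le> 4 * (K * (1 + R))\<^sup>2"
      using norm_diff_sq_le[of "g ?t (X ?t \<omega>)" "g ?s (X ?s \<omega>)"] by linarith
    moreover have "0 \<le> \<eta>\<^sup>2" by simp
    ultimately show ?thesis using False wM by (simp add: add_increasing)
  qed
  show ?thesis
    using norm_add_sq_le[of "g ?t (E n i \<omega>) - g ?t (X ?t \<omega>)" "g ?t (X ?t \<omega>) - g ?s (X ?s \<omega>)"] 1 2 by simp
qed

text \<open>The right hand side does not involve the refinement \<open>m\<close>. The scheme is compared with the Riemann sums on
  the grid with \<open>n * m\<close> points, and for \<open>m\<close> to infinity these are replaced by the solution.\<close>

lemma confined_error_step: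
  assumes R: "0 \<le> R" and n: "0 < n" and c: "c \<le> n" and \<eta>: "0 \<le> \<eta>"
  defines "e \<equiv> \<lambda>i. expectation (\<lambda>\<omega>. indicat_real (confined R (grid n i)) \<omega> * (norm (E n i \<omega> - X (grid n i) \<omega>))\<^sup>2)"
    and "G \<equiv> exp T * (1 + T + CARD('q))"
    and "\<mu> \<equiv> \<eta>\<^sup>2 + 4 * (K * (1 + R))\<^sup>2 * prob (space M - regular n \<eta>)"
  shows "e c \<le> 8 * G * \<mu> * T + (8 * G * K\<^sup>2 * (T / real n)) * (\<Sum>i<c. e i)"
proof -
  have G: "0 < G" using T_pos by (simp add: G_def)
  have \<mu>: "0 \<le> \<mu>" by (simp add: \<mu>_def)
  define \<kappa> where "\<kappa> = 4 * G * \<mu> * T + 4 * G * K\<^sup>2 * (T / real n) * (\<Sum>i<c. e i)"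
  note [measurable] = euler_measurable[OF c] X_measurable[OF grid_time_mem[OF c]] confined_sets_grid[OF c]
  define N where "N m = n * Suc m" for m
  have cN: "c * Suc m \<le> N m" for m unfolding N_def using c by (intro mult_right_mono) auto
  have gN: "grid (N m) (c * Suc m) = grid n c" for m unfolding N_def by (rule grid_refine) simp
  define Z where "Z m = riemann R (N m) (c * Suc m)" for m
  have cmp: "integrable M (\<lambda>\<omega>. (norm (E n c \<omega> - Z m \<omega>))\<^sup>2) \<and>
    expectation (\<lambda>\<omega>. indicat_real (confined R (grid n c)) \<omega> * (norm (E n c \<omega> - Z m \<omega>))\<^sup>2) \<le> \<kappa>" for m
  proof -
    let ?m = "Suc m"
    let ?k = "c * ?m"
    have m: "0 < ?m" by simp
    have kN: "?k \<le> n * ?m" using cN[of m] by (simp only: N_def)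
    have st: "riemann R (N m) (Suc j) \<omega> = riemann R (N m) j \<omega> + (T / real (N m)) *\<^sub>R loc_b R (N m) j \<omega>
       + loc_\<sigma> R (N m) j \<omega> *v (W (grid (N m) (Suc j)) \<omega> - W (grid (N m) j) \<omega>)" for j \<omega>
      unfolding riemann_def sum.lessThan_Suc by (simp only: add.assoc)
    have jN: "j \<le> N m" if "j < ?k" for j using that cN[of m] by linarith
    note fc = frozen_compare[OF n m kN, where Q = "riemann R (N m)" and \<beta> = "loc_b R (N m)" and \<tau> = "loc_\<sigma> R (N m)"
        and A = "\<lambda>j. confined R (grid (N m) j)", folded N_def G_def]
    have prem: "riemann R (N m) 0 \<omega> = x" "confined R (grid (N m) (Suc j)) \<subseteq> confined R (grid (N m) j)" for \<omega> j
      by (simp add: riemann_def) (intro confined_antimono grid_mono; simp)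
    note fc' = fc[OF prem(1) st loc_adapted(1)[OF jN] loc_L2(1)[OF jN R] loc_adapted(2)[OF jN] loc_L2(2)[OF jN R]
       confined_sets[OF grid_time_mem[OF jN]] prem(2) confined_sets_grid[OF cN]]
    have fz: "frozen n ?m ?k \<omega> = E n c \<omega>" for \<omega> by (rule frozen_coarse[OF m])
    let ?db = "\<lambda>j \<omega>. b (grid n (j div ?m)) (E n (j div ?m) \<omega>) - loc_b R (N m) j \<omega>"
    let ?ds = "\<lambda>j \<omega>. \<sigma> (grid n (j div ?m)) (E n (j div ?m) \<omega>) - loc_\<sigma> R (N m) j \<omega>"
    have est: "expectation (\<lambda>\<omega>. indicat_real (confined R (grid (N m) j)) \<omega> * ((norm (?db j \<omega>))\<^sup>2 + (norm (?ds j \<omega>))\<^sup>2))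
      \<le> 4 * K\<^sup>2 * e (j div ?m) + 4 * \<mu>" if j: "j < ?k" for j
    proof -
      define i where "i = j div ?m"
      have i: "i \<le> n"
      proof -
        have "i < c" unfolding i_def using j by (rule less_mult_imp_div_less)
        then show ?thesis using c by simp
      qed
      have le: "grid n i \<le> grid (N m) j" unfolding i_def N_def by (rule block_bounds(1)[OF m])
      have jn: "j \<le> n * ?m" using jN[OF j] by (simp only: N_def)
      let ?bad = "indicat_real (space M - regular n \<eta>)"
      let ?I = "indicat_real (confined R (grid (N m) j))"
      let ?\<phi> = "\<lambda>\<omega>. indicat_real (confined R (grid n i)) \<omega> * (norm (E n i \<omega> - X (grid n i) \<omega>))\<^sup>2"
      have pw: "?I \<omega> * ((norm (?db j \<omega>))\<^sup>2 + (norm (?ds j \<omega>))\<^sup>2)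
        \<le> 4 * K\<^sup>2 * ?\<phi> \<omega> + 4 * (\<eta>\<^sup>2 + 4 * (K * (1 + R))\<^sup>2 * ?bad \<omega>)" for \<omega>
      proof (cases "\<omega> \<in> confined R (grid (N m) j)")
        case True
        have \<omega>': "\<omega> \<in> confined R (grid n i)" using True confined_antimono[OF le] by blast
        note reg = regular_grid[OF _ i m jn i_def, folded N_def]
        have "(norm (?db j \<omega>))\<^sup>2 \<le> 2 * K\<^sup>2 * (norm (E n i \<omega> - X (grid n i) \<omega>))\<^sup>2 + 2 * (\<eta>\<^sup>2 + 4 * (K * (1 + R))\<^sup>2 * ?bad \<omega>)"
          using local_error_pointwise[OF b_lip b_growth reg(1) i jN[OF j] le True R, of \<eta>] True by (simp add: loc_b_def i_def)
        moreover have "(norm (?ds j \<omega>))\<^sup>2 \<le> 2 * K\<^sup>2 * (norm (E n i \<omega> - X (grid n i) \<omega>))\<^sup>2 + 2 * (\<eta>\<^sup>2 + 4 * (K * (1 + R))\<^sup>2 * ?bad \<omega>)"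
          using local_error_pointwise[OF \<sigma>_lip \<sigma>_growth reg(2) i jN[OF j] le True R, of \<eta>] True by (simp add: loc_\<sigma>_def i_def)
        ultimately show ?thesis using True \<omega>' by simp
      next
        case False
        have "0 \<le> 4 * K\<^sup>2 * ?\<phi> \<omega>" "0 \<le> 4 * (\<eta>\<^sup>2 + 4 * (K * (1 + R))\<^sup>2 * ?bad \<omega>)" by simp_all
        then show ?thesis using False by simp
      qed
      have i1: "integrable M ?\<phi>" by (rule confined_error_integrable[OF n i])
      have i2: "integrable M ?bad" using regular_sets by (simp add: emeasure_eq_measure)
      have cm: "confined R (grid (N m) j) \<in> sets M" by (rule confined_sets_grid[OF jN[OF j]])
      have d1: "integrable M (\<lambda>\<omega>. (norm (?db j \<omega>))\<^sup>2)" by (rule fc'(3)[OF _ _ _ _ _ j])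
      have d2: "integrable M (\<lambda>\<omega>. (norm (?ds j \<omega>))\<^sup>2)" by (rule fc'(4)[OF _ _ _ _ _ j])
      have i3: "integrable M (\<lambda>\<omega>. ?I \<omega> * ((norm (?db j \<omega>))\<^sup>2 + (norm (?ds j \<omega>))\<^sup>2))"
        using integrable_mult_indicator[OF cm Bochner_Integration.integrable_add[OF d1 d2]] by simp
      have "expectation (\<lambda>\<omega>. ?I \<omega> * ((norm (?db j \<omega>))\<^sup>2 + (norm (?ds j \<omega>))\<^sup>2))
        \<le> expectation (\<lambda>\<omega>. 4 * K\<^sup>2 * ?\<phi> \<omega> + 4 * (\<eta>\<^sup>2 + 4 * (K * (1 + R))\<^sup>2 * ?bad \<omega>))"
        using i1 i2 by (intro integral_mono i3 pw) simp
      also have "\<dots> = 4 * K\<^sup>2 * e i + 4 * \<mu>"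
        using i1 i2 regular_sets by (simp add: e_def \<mu>_def prob_space)
      finally show ?thesis unfolding i_def .
    qed
    have "expectation (\<lambda>\<omega>. indicat_real (confined R (grid n c)) \<omega> * (norm (E n c \<omega> - Z m \<omega>))\<^sup>2)
      \<le> G * (\<Sum>j<?k. (T / real (N m)) * expectation (\<lambda>\<omega>. indicat_real (confined R (grid (N m) j)) \<omega> * ((norm (?db j \<omega>))\<^sup>2 + (norm (?ds j \<omega>))\<^sup>2)))"
      using fc'(2) unfolding fz gN Z_def by simp
    also have "\<dots> \<le> G * (\<Sum>j<?k. (T / real (N m)) * (4 * K\<^sup>2 * e (j div ?m) + 4 * \<mu>))"
      using G T_pos by (intro mult_left_mono sum_mono est) auto
    also have "(\<Sum>j<?k. (T / real (N m)) * (4 * K\<^sup>2 * e (j div ?m) + 4 * \<mu>)) = (T / real n) * (\<Sum>i<c. 4 * K\<^sup>2 * e i + 4 * \<mu>)"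
    proof -
      have "(T / real (n * k)) * (real k * S) = (T / real n) * S" if "0 < k" for k and S :: real
        using that n by (simp add: field_simps)
      from this[OF m] show ?thesis
        unfolding sum_distrib_left[symmetric] sum_blocks[OF m, of "\<lambda>i. 4 * K\<^sup>2 * e i + 4 * \<mu>"] N_def .
    qed
    also have "\<dots> = 4 * K\<^sup>2 * (T / real n) * (\<Sum>i<c. e i) + 4 * \<mu> * (T / real n * real c)"
    proof -
      have "(\<Sum>i<c. 4 * K\<^sup>2 * e i + 4 * \<mu>) = 4 * K\<^sup>2 * (\<Sum>i<c. e i) + real c * (4 * \<mu>)"
        by (simp add: sum.distrib sum_distrib_left)
      then show ?thesis by (simp add: algebra_simps)
    qed
    also have "4 * \<mu> * (T / real n * real c) \<le> 4 * \<mu> * T"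
      using \<mu> T_pos n c by (intro mult_left_mono) (auto simp: field_simps)
    finally have "expectation (\<lambda>\<omega>. indicat_real (confined R (grid n c)) \<omega> * (norm (E n c \<omega> - Z m \<omega>))\<^sup>2) \<le> \<kappa>"
      using G unfolding \<kappa>_def by (simp add: distrib_left mult_ac)
    moreover have "integrable M (\<lambda>\<omega>. (norm (E n c \<omega> - Z m \<omega>))\<^sup>2)" using fc'(1) unfolding fz Z_def by simp
    ultimately show ?thesis by blast
  qed
  have "expectation (\<lambda>\<omega>. indicat_real (confined R (grid n c)) \<omega> * (norm (E n c \<omega> - X (grid n c) \<omega>))\<^sup>2) \<le> 2 * \<kappa>"
  proof (rule limit_in_probability_L2_bound[where Z = Z and R = R])
    show "integrable M (\<lambda>\<omega>. (norm (E n c \<omega>))\<^sup>2)" by (rule euler_L2[OF n c])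
    show "Z m \<in> borel_measurable M" for m unfolding Z_def by (rule riemann_measurable[OF cN])
    show "norm (X (grid n c) \<omega>) \<le> R" if "\<omega> \<in> confined R (grid n c)" for \<omega> by (rule confined_grid[OF that c])
    fix \<epsilon> \<theta> :: real assume "0 < \<epsilon>" "0 < \<theta>"
    then obtain N0 where N0: "\<forall>M0\<ge>N0. \<forall>j\<le>M0. prob {\<omega>\<in>confined R (grid M0 j). \<epsilon> < norm (riemann R M0 j \<omega> - X (grid M0 j) \<omega>)} \<le> \<theta>"
      using riemann_converges[OF R] by blast
    have "N0 \<le> N N0" unfolding N_def using n by (cases n) auto
    then have "prob {\<omega>\<in>confined R (grid (N N0) (c * Suc N0)). \<epsilon> < norm (riemann R (N N0) (c * Suc N0) \<omega> - X (grid (N N0) (c * Suc N0)) \<omega>)} \<le> \<theta>"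
      using N0 cN[of N0] by blast
    then show "\<exists>m. prob {\<omega>\<in>confined R (grid n c). \<epsilon> < norm (Z m \<omega> - X (grid n c) \<omega>)} \<le> \<theta>"
      unfolding gN Z_def by blast
  qed (use cmp in auto)
  then have "e c \<le> 2 * \<kappa>" by (simp only: e_def)
  then show ?thesis unfolding \<kappa>_def by (simp add: algebra_simps)
qed

lemma confined_convergence:
  assumes R: "0 \<le> R" and "0 < \<theta>"
  shows "\<exists>n0>0. \<forall>n\<ge>n0. integrable M (\<lambda>\<omega>. indicat_real (confined R T) \<omega> * (norm (E n n \<omega> - X T \<omega>))\<^sup>2) \<and>
    expectation (\<lambda>\<omega>. indicat_real (confined R T) \<omega> * (norm (E n n \<omega> - X T \<omega>))\<^sup>2) \<le> \<theta>"
proof -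
  define G where "G = exp T * (1 + T + CARD('q))"
  define D where "D = 8 * G * T * exp (8 * G * K\<^sup>2 * T)"
  define B where "B = K * (1 + R)"
  have G: "0 < G" and D: "0 < D" and B: "0 < B" using T_pos K_pos R by (auto simp: G_def D_def B_def)
  define \<eta> where "\<eta> = sqrt (\<theta> / (2 * D))"
  have \<eta>: "0 < \<eta>" "\<eta>\<^sup>2 * D = \<theta> / 2" using \<open>0 < \<theta>\<close> D by (simp_all add: \<eta>_def)
  have "0 < \<theta> / (8 * B\<^sup>2 * D)" using \<open>0 < \<theta>\<close> D B by simp
  then have "\<forall>\<^sub>F n in sequentially. prob (space M - regular n \<eta>) < \<theta> / (8 * B\<^sup>2 * D)"
    by (rule order_tendstoD(2)[OF regular_prob[OF \<eta>(1)]])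
  then obtain n1 where n1: "\<forall>n\<ge>n1. prob (space M - regular n \<eta>) < \<theta> / (8 * B\<^sup>2 * D)"
    unfolding eventually_sequentially ..
  show ?thesis
  proof (intro exI[of _ "Suc n1"] conjI allI impI)
    fix n assume "Suc n1 \<le> n"
    then have n: "0 < n" "n1 \<le> n" by auto
    let ?e = "\<lambda>i. expectation (\<lambda>\<omega>. indicat_real (confined R (grid n i)) \<omega> * (norm (E n i \<omega> - X (grid n i) \<omega>))\<^sup>2)"
    let ?\<mu> = "\<eta>\<^sup>2 + 4 * B\<^sup>2 * prob (space M - regular n \<eta>)"
    have gT: "grid n n = T" using n by simp
    have "?e n \<le> (8 * G * ?\<mu> * T) * exp ((8 * G * K\<^sup>2 * (T / real n)) * real n)"
    proof (rule discrete_gronwall_sum[where n = n and a = ?e])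
      show "?e k \<le> 8 * G * ?\<mu> * T + 8 * G * K\<^sup>2 * (T / real n) * (\<Sum>j<k. ?e j)" if "k \<le> n" for k
        using confined_error_step[OF R n(1) that less_imp_le[OF \<eta>(1)]] unfolding G_def B_def .
    qed (use G T_pos in auto)
    also have "\<dots> = \<eta>\<^sup>2 * D + 4 * B\<^sup>2 * D * prob (space M - regular n \<eta>)"
      using n(1) by (simp add: D_def algebra_simps)
    also have "\<dots> \<le> \<theta> / 2 + 4 * B\<^sup>2 * D * (\<theta> / (8 * B\<^sup>2 * D))"
      using \<eta>(2) n1 n(2) B D by (intro add_mono mult_left_mono) (auto intro: less_imp_le)
    also have "\<dots> = \<theta>" using B D by (simp add: field_simps)
    finally show "expectation (\<lambda>\<omega>. indicat_real (confined R T) \<omega> * (norm (E n n \<omega> - X T \<omega>))\<^sup>2) \<le> \<theta>"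
      unfolding gT .
    show "integrable M (\<lambda>\<omega>. indicat_real (confined R T) \<omega> * (norm (E n n \<omega> - X T \<omega>))\<^sup>2)"
      using confined_error_integrable[OF n(1) order_refl, of R] unfolding gT .
  qed simp
qed

lemma test_function_converges_confined:
  assumes f: "continuous_on UNIV f" "linear_growth f" and R: "0 \<le> R" and "0 < \<epsilon>"
  shows "\<exists>n0>0. \<forall>n\<ge>n0. integrable M (\<lambda>\<omega>. indicat_real (confined R T) \<omega> * (f (E n n \<omega>) - f (X T \<omega>))\<^sup>2) \<and>
    expectation (\<lambda>\<omega>. indicat_real (confined R T) \<omega> * (f (E n n \<omega>) - f (X T \<omega>))\<^sup>2) \<le> \<epsilon>"
proof -
  obtain C where C: "0 < C" "\<And>m k. 0 < m \<Longrightarrow> k \<le> m \<Longrightarrow> integrable M (\<lambda>\<omega>. (1 + (norm (E m k \<omega>))\<^sup>2)\<^sup>2)"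
    "\<And>m k. 0 < m \<Longrightarrow> k \<le> m \<Longrightarrow> expectation (\<lambda>\<omega>. (1 + (norm (E m k \<omega>))\<^sup>2)\<^sup>2) \<le> C"
    using euler_fourth_moment by blast
  define C' where "C' = C + (1 + R\<^sup>2)\<^sup>2"
  have C': "0 < C'" using C(1) by (simp add: C'_def add_pos_nonneg)
  define \<eta> where "\<eta> = \<epsilon> / (2 * C')"
  have \<eta>: "0 < \<eta>" using assms C' by (simp add: \<eta>_def)
  obtain L where L: "0 \<le> L"
    "\<And>y z. (f y - f z)\<^sup>2 \<le> \<eta> * ((1 + (norm y)\<^sup>2)\<^sup>2 + (1 + (norm z)\<^sup>2)\<^sup>2) + L * (norm (y - z))\<^sup>2"
    using continuous_quadratic_domination[OF f \<eta>] by blast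
  define \<theta> where "\<theta> = \<epsilon> / (2 * (L + 1))"
  have \<theta>: "0 < \<theta>" using assms L(1) by (simp add: \<theta>_def)
  obtain n0 where n0: "0 < n0"
    "\<And>n. n0 \<le> n \<Longrightarrow> integrable M (\<lambda>\<omega>. indicat_real (confined R T) \<omega> * (norm (E n n \<omega> - X T \<omega>))\<^sup>2)"
    "\<And>n. n0 \<le> n \<Longrightarrow> expectation (\<lambda>\<omega>. indicat_real (confined R T) \<omega> * (norm (E n n \<omega> - X T \<omega>))\<^sup>2) \<le> \<theta>"
    using confined_convergence[OF R \<theta>] by blast
  have TT: "T \<in> {0..T}" using T_pos by simp
  show ?thesis
  proof (intro exI[of _ n0] conjI allI impI n0(1))
    fix n assume nn: "n0 \<le> n"
    then have n: "0 < n" using n0(1) by simp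
    let ?I = "indicat_real (confined R T)"
    let ?a = "\<lambda>\<omega>. (1 + (norm (E n n \<omega>))\<^sup>2)\<^sup>2"
    have gT: "grid n n = T" using n by simp
    let ?R = "\<lambda>\<omega>. \<eta> * (?a \<omega> + (1 + R\<^sup>2)\<^sup>2) + L * (?I \<omega> * (norm (E n n \<omega> - X T \<omega>))\<^sup>2)"
    have Ri: "integrable M ?R" using C(2)[OF n order_refl] n0(2)[OF nn] by simp
    have pw: "?I \<omega> * (f (E n n \<omega>) - f (X T \<omega>))\<^sup>2 \<le> ?R \<omega>" for \<omega>
    proof (cases "\<omega> \<in> confined R T")
      case True
      then have "norm (X T \<omega>) \<le> R" using confined_grid[of \<omega> R n n] unfolding gT by simp
      then have "(1 + (norm (X T \<omega>))\<^sup>2)\<^sup>2 \<le> (1 + R\<^sup>2)\<^sup>2" by (intro power_mono add_left_mono) auto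
      then have "\<eta> * (?a \<omega> + (1 + (norm (X T \<omega>))\<^sup>2)\<^sup>2) \<le> \<eta> * (?a \<omega> + (1 + R\<^sup>2)\<^sup>2)" using \<eta> by (intro mult_left_mono) auto
      then show ?thesis using L(2)[of "E n n \<omega>" "X T \<omega>"] True by simp
    next
      case False then show ?thesis using \<eta> L(1) by simp
    qed
    note [measurable] = test_function_L2(1)[OF f n] borel_measurable_continuous_onI[OF f(1)] X_measurable[OF TT]
      sets_filtration_M[OF _ confined_sets[OF TT]]
    have T0: "0 \<le> T" using T_pos by simp
    show I: "integrable M (\<lambda>\<omega>. ?I \<omega> * (f (E n n \<omega>) - f (X T \<omega>))\<^sup>2)"
    proof (rule Bochner_Integration.integrable_bound[OF Ri])
      note [measurable] = sets_filtration_M[OF T0 confined_sets[OF TT]]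
      show "(\<lambda>\<omega>. ?I \<omega> * (f (E n n \<omega>) - f (X T \<omega>))\<^sup>2) \<in> borel_measurable M" by measurable
      show "AE \<omega> in M. norm (?I \<omega> * (f (E n n \<omega>) - f (X T \<omega>))\<^sup>2) \<le> norm (?R \<omega>)"
        using pw by (auto intro!: AE_I2 intro: order_trans[OF _ abs_ge_self])
    qed
    have "expectation (\<lambda>\<omega>. ?I \<omega> * (f (E n n \<omega>) - f (X T \<omega>))\<^sup>2) \<le> expectation ?R"
      by (intro integral_mono I Ri pw)
    also have "\<dots> = \<eta> * (expectation ?a + (1 + R\<^sup>2)\<^sup>2) + L * expectation (\<lambda>\<omega>. ?I \<omega> * (norm (E n n \<omega> - X T \<omega>))\<^sup>2)"
      using C(2)[OF n order_refl] n0(2)[OF nn] by (simp add: prob_space)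
    also have "\<dots> \<le> \<eta> * C' + L * \<theta>"
      using C(3)[OF n order_refl] n0(3)[OF nn] \<eta> L(1) by (intro add_mono mult_left_mono) (auto simp: C'_def)
    also have "\<eta> * C' = \<epsilon> / 2" using C' by (simp add: \<eta>_def)
    also have "L * \<theta> \<le> \<epsilon> / 2" using assms L(1) by (simp add: \<theta>_def field_simps)
    finally show "expectation (\<lambda>\<omega>. ?I \<omega> * (f (E n n \<omega>) - f (X T \<omega>))\<^sup>2) \<le> \<epsilon>" by simp
  qed
qed

text \<open>Compare \<open>E n n\<close> with \<open>E m m\<close> by the Cauchy property, and \<open>E m m\<close> with the solution on \<open>confined R T\<close> for
  a large \<open>m\<close> that may depend on \<open>R\<close>. The bound obtained for \<open>E n n\<close> does not depend on \<open>R\<close>, so monotone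
  convergence applies.\<close>

lemma test_function_converges_L2:
  assumes f: "continuous_on UNIV f" "linear_growth f" and "0 < \<epsilon>"
  shows "\<exists>n0>0. \<forall>n\<ge>n0. integrable M (\<lambda>\<omega>. (f (E n n \<omega>) - f (X T \<omega>))\<^sup>2) \<and>
    expectation (\<lambda>\<omega>. (f (E n n \<omega>) - f (X T \<omega>))\<^sup>2) \<le> \<epsilon>"
proof -
  obtain n0 where n0: "0 < n0" "\<And>n n'. n0 \<le> n \<Longrightarrow> n0 \<le> n' \<Longrightarrow> integrable M (\<lambda>\<omega>. (f (E n n \<omega>) - f (E n' n' \<omega>))\<^sup>2)"
    "\<And>n n'. n0 \<le> n \<Longrightarrow> n0 \<le> n' \<Longrightarrow> expectation (\<lambda>\<omega>. (f (E n n \<omega>) - f (E n' n' \<omega>))\<^sup>2) \<le> \<epsilon> / 4"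
    using test_function_cauchy_L2[OF f, of "\<epsilon> / 4"] assms by auto
  have TT: "T \<in> {0..T}" and T0: "0 \<le> T" using T_pos by simp_all
  show ?thesis
  proof (intro exI[of _ n0] allI impI conjI n0(1))
    fix n assume nn: "n0 \<le> n"
    then have n: "0 < n" using n0(1) by simp
    let ?g = "\<lambda>\<omega>. (f (E n n \<omega>) - f (X T \<omega>))\<^sup>2"
    let ?I = "\<lambda>R::nat. indicat_real (confined (real R) T)"
    have cm [measurable]: "confined (real R) T \<in> sets M" for R by (rule sets_filtration_M[OF T0 confined_sets[OF TT]])
    note [measurable] = test_function_L2(1)[OF f n] borel_measurable_continuous_onI[OF f(1)] X_measurable[OF TT]
    have gm [measurable]: "?g \<in> borel_measurable M" by measurable
    have bd: "(\<integral>\<^sup>+\<omega>. ennreal (?I R \<omega> * ?g \<omega>) \<partial>M) \<le> ennreal \<epsilon>" for R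
    proof -
      obtain n1 where n1: "0 < n1"
        "\<And>m. n1 \<le> m \<Longrightarrow> integrable M (\<lambda>\<omega>. ?I R \<omega> * (f (E m m \<omega>) - f (X T \<omega>))\<^sup>2)"
        "\<And>m. n1 \<le> m \<Longrightarrow> expectation (\<lambda>\<omega>. ?I R \<omega> * (f (E m m \<omega>) - f (X T \<omega>))\<^sup>2) \<le> \<epsilon> / 4"
        using test_function_converges_confined[OF f, of "real R" "\<epsilon> / 4"] assms by auto
      define m where "m = max n0 n1"
      have m: "n0 \<le> m" "n1 \<le> m" by (auto simp: m_def)
      let ?R = "\<lambda>\<omega>. 2 * (f (E n n \<omega>) - f (E m m \<omega>))\<^sup>2 + 2 * (?I R \<omega> * (f (E m m \<omega>) - f (X T \<omega>))\<^sup>2)"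
      have Ri: "integrable M ?R" using n0(2)[OF nn m(1)] n1(2)[OF m(2)] by simp
      have "?I R \<omega> * ?g \<omega> \<le> ?R \<omega>" for \<omega>
        using norm_add_sq_le[of "f (E n n \<omega>) - f (E m m \<omega>)" "f (E m m \<omega>) - f (X T \<omega>)"] by (auto simp: indicator_def)
      then have "(\<integral>\<^sup>+\<omega>. ennreal (?I R \<omega> * ?g \<omega>) \<partial>M) \<le> (\<integral>\<^sup>+\<omega>. ennreal (?R \<omega>) \<partial>M)"
        by (intro nn_integral_mono ennreal_leI)
      also have "\<dots> = ennreal (expectation ?R)" by (intro nn_integral_eq_integral Ri) simp
      also have "expectation ?R \<le> \<epsilon>" using n0(2,3)[OF nn m(1)] n1(2,3)[OF m(2)] by simp
      finally show ?thesis by (simp add: ennreal_leI)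
    qed
    have "(\<integral>\<^sup>+\<omega>. ennreal (?g \<omega>) \<partial>M) = (\<integral>\<^sup>+\<omega>. (SUP R. ennreal (?I R \<omega> * ?g \<omega>)) \<partial>M)"
    proof (rule nn_integral_cong)
      fix \<omega> assume "\<omega> \<in> space M"
      then obtain R0 :: nat where R0: "\<omega> \<in> confined (real R0) T" using confined_UN by blast
      show "ennreal (?g \<omega>) = (SUP R. ennreal (?I R \<omega> * ?g \<omega>))"
      proof (rule antisym)
        have "ennreal (?g \<omega>) = ennreal (?I R0 \<omega> * ?g \<omega>)" using R0 by simp
        also have "\<dots> \<le> (SUP R. ennreal (?I R \<omega> * ?g \<omega>))" by (rule SUP_upper) simp
        finally show "ennreal (?g \<omega>) \<le> (SUP R. ennreal (?I R \<omega> * ?g \<omega>))" .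
        show "(SUP R. ennreal (?I R \<omega> * ?g \<omega>)) \<le> ennreal (?g \<omega>)"
          by (intro SUP_least ennreal_leI) (simp add: indicator_def)
      qed
    qed
    also have "\<dots> = (SUP R. \<integral>\<^sup>+\<omega>. ennreal (?I R \<omega> * ?g \<omega>) \<partial>M)"
    proof (rule nn_integral_monotone_convergence_SUP)
      show "incseq (\<lambda>R \<omega>. ennreal (?I R \<omega> * ?g \<omega>))"
      proof (intro incseq_SucI le_funI ennreal_leI)
        fix R \<omega>
        have "confined (real R) T \<subseteq> confined (real (Suc R)) T" by (rule confined_mono) simp
        then show "?I R \<omega> * ?g \<omega> \<le> ?I (Suc R) \<omega> * ?g \<omega>" by (auto simp: indicator_def)
      qed
    qed measurable
    also have "\<dots> \<le> ennreal \<epsilon>" using bd by (rule SUP_least)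
    finally have fin: "(\<integral>\<^sup>+\<omega>. ennreal (?g \<omega>) \<partial>M) \<le> ennreal \<epsilon>" .
    show I: "integrable M ?g"
      using fin by (intro integrableI_bounded gm) (auto simp: le_less_trans[OF _ ennreal_less_top])
    show "expectation ?g \<le> \<epsilon>"
      using fin assms nn_integral_eq_integral[OF I] by (simp add: ennreal_le_iff)
  qed
qed

end

section \<open>The asymptotic variance\<close>

context prob_space begin

text \<open>The Cauchy-Schwarz inequality for upper bounds \<open>r\<close> and \<open>B\<close> of the two norms, obtained by integrating
  \<open>2 * r * B * \<bar>u * v\<bar> \<le> B\<^sup>2 * u\<^sup>2 + r\<^sup>2 * v\<^sup>2\<close>.\<close>

lemma expectation_mult_le:
  fixes u v :: "'a \<Rightarrow> real"
  assumes [measurable]: "u \<in> borel_measurable M" "v \<in> borel_measurable M"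
    and iu: "integrable M (\<lambda>\<omega>. (u \<omega>)\<^sup>2)" and iv: "integrable M (\<lambda>\<omega>. (v \<omega>)\<^sup>2)"
    and r: "0 < r" "expectation (\<lambda>\<omega>. (u \<omega>)\<^sup>2) \<le> r\<^sup>2" and B: "0 < B" "expectation (\<lambda>\<omega>. (v \<omega>)\<^sup>2) \<le> B\<^sup>2"
  shows "integrable M (\<lambda>\<omega>. u \<omega> * v \<omega>)" "\<bar>expectation (\<lambda>\<omega>. u \<omega> * v \<omega>)\<bar> \<le> r * B"
proof -
  let ?R = "\<lambda>\<omega>. B / (2 * r) * (u \<omega>)\<^sup>2 + r / (2 * B) * (v \<omega>)\<^sup>2"
  have Ri: "integrable M ?R" using iu iv by simp
  have le: "\<bar>u \<omega> * v \<omega>\<bar> \<le> ?R \<omega>" for \<omega>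
  proof -
    have "0 \<le> (B * \<bar>u \<omega>\<bar> - r * \<bar>v \<omega>\<bar>)\<^sup>2 / (2 * r * B)" using r(1) B(1) by simp
    also have "\<dots> = ?R \<omega> - \<bar>u \<omega>\<bar> * \<bar>v \<omega>\<bar>" using r(1) B(1) by (simp add: power2_diff power_mult_distrib field_simps power2_eq_square)
    finally show ?thesis by (simp add: abs_mult)
  qed
  show I: "integrable M (\<lambda>\<omega>. u \<omega> * v \<omega>)"
    using le by (intro Bochner_Integration.integrable_bound[OF Ri]) (auto intro!: AE_I2 intro: order_trans[OF _ abs_ge_self])
  have "\<bar>expectation (\<lambda>\<omega>. u \<omega> * v \<omega>)\<bar> \<le> expectation (\<lambda>\<omega>. \<bar>u \<omega> * v \<omega>\<bar>)" by (rule integral_abs_bound)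
  also have "\<dots> \<le> expectation ?R" using I by (intro integral_mono Ri le) auto
  also have "\<dots> = B / (2 * r) * expectation (\<lambda>\<omega>. (u \<omega>)\<^sup>2) + r / (2 * B) * expectation (\<lambda>\<omega>. (v \<omega>)\<^sup>2)" using iu iv by simp
  also have "\<dots> \<le> B / (2 * r) * r\<^sup>2 + r / (2 * B) * B\<^sup>2" using r B by (intro add_mono mult_left_mono) auto
  also have "\<dots> = r * B" using r(1) B(1) by (simp add: field_simps power2_eq_square)
  finally show "\<bar>expectation (\<lambda>\<omega>. u \<omega> * v \<omega>)\<bar> \<le> r * B" .
qed

lemma expectation_abs_le:
  fixes v :: "'a \<Rightarrow> real"
  assumes "v \<in> borel_measurable M" "integrable M (\<lambda>\<omega>. (v \<omega>)\<^sup>2)" "0 < B" "expectation (\<lambda>\<omega>. (v \<omega>)\<^sup>2) \<le> B\<^sup>2"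
  shows "\<bar>expectation v\<bar> \<le> B"
  using expectation_mult_le(2)[of v "\<lambda>_. 1" B 1] assms by (simp add: prob_space)

lemma variance_diff_le:
  fixes u v :: "'a \<Rightarrow> real"
  assumes m [measurable]: "u \<in> borel_measurable M" "v \<in> borel_measurable M"
    and iu: "integrable M (\<lambda>\<omega>. (u \<omega>)\<^sup>2)" and iv: "integrable M (\<lambda>\<omega>. (v \<omega>)\<^sup>2)"
    and r: "0 < r" "expectation (\<lambda>\<omega>. (u \<omega> - v \<omega>)\<^sup>2) \<le> r\<^sup>2" and B: "0 < B" "expectation (\<lambda>\<omega>. (v \<omega>)\<^sup>2) \<le> B\<^sup>2"
  shows "\<bar>variance u - variance v\<bar> \<le> 2 * r * (r + 2 * B)"
proof -
  let ?w = "\<lambda>\<omega>. u \<omega> - v \<omega>"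
  have wm: "?w \<in> borel_measurable M" by measurable
  note iu1 = square_integrable_imp_integrable[OF m(1) iu]
  note iv1 = square_integrable_imp_integrable[OF m(2) iv]
  have iw: "integrable M (\<lambda>\<omega>. (?w \<omega>)\<^sup>2)"
    using square_integrable_diff[OF _ _ wm] iu iv by simp
  note wv = expectation_mult_le[OF wm m(2) iw iv r B]
  have "expectation (\<lambda>\<omega>. (u \<omega>)\<^sup>2) = expectation (\<lambda>\<omega>. (?w \<omega>)\<^sup>2 + 2 * (?w \<omega> * v \<omega>) + (v \<omega>)\<^sup>2)"
    by (intro Bochner_Integration.integral_cong) (auto simp: power2_eq_square algebra_simps)
  also have "\<dots> = expectation (\<lambda>\<omega>. (?w \<omega>)\<^sup>2) + 2 * expectation (\<lambda>\<omega>. ?w \<omega> * v \<omega>) + expectation (\<lambda>\<omega>. (v \<omega>)\<^sup>2)"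
    using iw wv(1) iv by simp
  finally have "expectation (\<lambda>\<omega>. (u \<omega>)\<^sup>2) - expectation (\<lambda>\<omega>. (v \<omega>)\<^sup>2) = expectation (\<lambda>\<omega>. (?w \<omega>)\<^sup>2) + 2 * expectation (\<lambda>\<omega>. ?w \<omega> * v \<omega>)" by simp
  moreover have "0 \<le> expectation (\<lambda>\<omega>. (?w \<omega>)\<^sup>2)" by (intro Bochner_Integration.integral_nonneg) auto
  ultimately have 1: "\<bar>expectation (\<lambda>\<omega>. (u \<omega>)\<^sup>2) - expectation (\<lambda>\<omega>. (v \<omega>)\<^sup>2)\<bar> \<le> r\<^sup>2 + 2 * (r * B)"
    using r(2) wv(2) by linarith
  have ew: "\<bar>expectation ?w\<bar> \<le> r" by (rule expectation_abs_le[OF wm iw r])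
  have ev: "\<bar>expectation v\<bar> \<le> B" by (rule expectation_abs_le[OF m(2) iv B])
  have "expectation u = expectation ?w + expectation v" using iu1 iv1 by simp
  then have "(expectation u)\<^sup>2 - (expectation v)\<^sup>2 = expectation ?w * (expectation ?w + 2 * expectation v)"
    by (simp add: power2_eq_square algebra_simps)
  also have "\<bar>\<dots>\<bar> \<le> r * (r + 2 * B)"
    unfolding abs_mult using ew ev by (intro mult_mono) auto
  finally have 2: "\<bar>(expectation u)\<^sup>2 - (expectation v)\<^sup>2\<bar> \<le> r * (r + 2 * B)" .
  have "variance u - variance v = (expectation (\<lambda>\<omega>. (u \<omega>)\<^sup>2) - expectation (\<lambda>\<omega>. (v \<omega>)\<^sup>2)) - ((expectation u)\<^sup>2 - (expectation v)\<^sup>2)"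
    unfolding variance_eq[OF iu1 iu] variance_eq[OF iv1 iv] by simp
  then show ?thesis using 1 2 by (simp add: power2_eq_square algebra_simps)
qed

text \<open>Integrate \<open>(2 * a - c)\<^sup>2 = 2 * a\<^sup>2 - c\<^sup>2 + 2 * (a - c)\<^sup>2\<close>, and apply the same identity to the means.\<close>

lemma variance_extrapolation:
  fixes a c :: "'a \<Rightarrow> real"
  assumes m [measurable]: "a \<in> borel_measurable M" "c \<in> borel_measurable M"
    and ia: "integrable M (\<lambda>\<omega>. (a \<omega>)\<^sup>2)" and ic: "integrable M (\<lambda>\<omega>. (c \<omega>)\<^sup>2)"
  shows "integrable M (\<lambda>\<omega>. (a \<omega> - c \<omega>)\<^sup>2)" "integrable M (\<lambda>\<omega>. (2 * a \<omega> - c \<omega>)\<^sup>2)"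
    "variance (\<lambda>\<omega>. 2 * a \<omega> - c \<omega>) = 2 * variance a - variance c + 2 * variance (\<lambda>\<omega>. a \<omega> - c \<omega>)"
proof -
  note ia1 = square_integrable_imp_integrable[OF m(1) ia]
  note ic1 = square_integrable_imp_integrable[OF m(2) ic]
  show id: "integrable M (\<lambda>\<omega>. (a \<omega> - c \<omega>)\<^sup>2)"
    using square_integrable_diff[of M a c] ia ic by simp
  have eq: "(2 * a \<omega> - c \<omega>)\<^sup>2 = 2 * (a \<omega>)\<^sup>2 - (c \<omega>)\<^sup>2 + 2 * (a \<omega> - c \<omega>)\<^sup>2" for \<omega>
    by (simp add: power2_eq_square algebra_simps)
  show ie: "integrable M (\<lambda>\<omega>. (2 * a \<omega> - c \<omega>)\<^sup>2)" unfolding eq using ia ic id by simp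
  have i1: "integrable M (\<lambda>\<omega>. 2 * a \<omega> - c \<omega>)" "integrable M (\<lambda>\<omega>. a \<omega> - c \<omega>)" using ia1 ic1 by auto
  have E2: "expectation (\<lambda>\<omega>. (2 * a \<omega> - c \<omega>)\<^sup>2) = 2 * expectation (\<lambda>\<omega>. (a \<omega>)\<^sup>2) - expectation (\<lambda>\<omega>. (c \<omega>)\<^sup>2) + 2 * expectation (\<lambda>\<omega>. (a \<omega> - c \<omega>)\<^sup>2)"
    unfolding eq using ia ic id by simp
  have E1: "expectation (\<lambda>\<omega>. 2 * a \<omega> - c \<omega>) = 2 * expectation a - expectation c" "expectation (\<lambda>\<omega>. a \<omega> - c \<omega>) = expectation a - expectation c"
    using ia1 ic1 by simp_all
  show "variance (\<lambda>\<omega>. 2 * a \<omega> - c \<omega>) = 2 * variance a - variance c + 2 * variance (\<lambda>\<omega>. a \<omega> - c \<omega>)"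
    unfolding variance_eq[OF i1(1) ie] variance_eq[OF i1(2) id] variance_eq[OF ia1 ia] variance_eq[OF ic1 ic]
    unfolding E2 E1 by (simp add: power2_eq_square algebra_simps)
qed

lemma extrapolation_L2_diff_le:
  fixes a a' c c' :: "'a \<Rightarrow> real"
  assumes [measurable]: "a \<in> borel_measurable M" "a' \<in> borel_measurable M" "c \<in> borel_measurable M" "c' \<in> borel_measurable M"
    and I: "integrable M (\<lambda>\<omega>. (a \<omega> - a' \<omega>)\<^sup>2)" "integrable M (\<lambda>\<omega>. (c \<omega> - c' \<omega>)\<^sup>2)"
  shows "expectation (\<lambda>\<omega>. ((2 * a \<omega> - c \<omega>) - (2 * a' \<omega> - c' \<omega>))\<^sup>2)
    \<le> 8 * expectation (\<lambda>\<omega>. (a \<omega> - a' \<omega>)\<^sup>2) + 2 * expectation (\<lambda>\<omega>. (c \<omega> - c' \<omega>)\<^sup>2)"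
proof -
  let ?u = "\<lambda>\<omega>. 2 * (a \<omega> - a' \<omega>) - (c \<omega> - c' \<omega>)"
  have "integrable M (\<lambda>\<omega>. (2 * (a \<omega> - a' \<omega>))\<^sup>2)" unfolding power_mult_distrib using I(1) by simp
  then have iu: "integrable M (\<lambda>\<omega>. (?u \<omega>)\<^sup>2)"
    using square_integrable_diff[of M "\<lambda>\<omega>. 2 * (a \<omega> - a' \<omega>)" "\<lambda>\<omega>. c \<omega> - c' \<omega>"] I(2) by simp
  have "(?u \<omega>)\<^sup>2 \<le> 8 * (a \<omega> - a' \<omega>)\<^sup>2 + 2 * (c \<omega> - c' \<omega>)\<^sup>2" for \<omega>
    using norm_diff_sq_le[of "2 * (a \<omega> - a' \<omega>)" "c \<omega> - c' \<omega>"]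
    by (simp only: real_norm_def power2_abs power_mult_distrib) simp
  then have "expectation (\<lambda>\<omega>. (?u \<omega>)\<^sup>2) \<le> expectation (\<lambda>\<omega>. 8 * (a \<omega> - a' \<omega>)\<^sup>2 + 2 * (c \<omega> - c' \<omega>)\<^sup>2)"
    using I by (intro integral_mono iu) auto
  also have "\<dots> = 8 * expectation (\<lambda>\<omega>. (a \<omega> - a' \<omega>)\<^sup>2) + 2 * expectation (\<lambda>\<omega>. (c \<omega> - c' \<omega>)\<^sup>2)" using I by simp
  also have "(\<lambda>\<omega>. (?u \<omega>)\<^sup>2) = (\<lambda>\<omega>. ((2 * a \<omega> - c \<omega>) - (2 * a' \<omega> - c' \<omega>))\<^sup>2)" by (simp add: algebra_simps)
  finally show ?thesis .
qed

lemma variance_tendsto: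
  fixes u :: "nat \<Rightarrow> 'a \<Rightarrow> real"
  assumes m: "\<And>n. 0 < n \<Longrightarrow> u n \<in> borel_measurable M" "v \<in> borel_measurable M"
    and i: "\<And>n. 0 < n \<Longrightarrow> integrable M (\<lambda>\<omega>. (u n \<omega>)\<^sup>2)" "integrable M (\<lambda>\<omega>. (v \<omega>)\<^sup>2)"
    and conv: "\<And>\<epsilon>. 0 < \<epsilon> \<Longrightarrow> \<exists>n0. \<forall>n\<ge>n0. expectation (\<lambda>\<omega>. (u n \<omega> - v \<omega>)\<^sup>2) \<le> \<epsilon>"
  shows "(\<lambda>n. variance (u n)) \<longlonglongrightarrow> variance v"
proof (rule LIMSEQ_I)
  fix e :: real assume e: "0 < e"
  define B where "B = sqrt (expectation (\<lambda>\<omega>. (v \<omega>)\<^sup>2)) + 1"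
  have nn: "0 \<le> expectation (\<lambda>\<omega>. (v \<omega>)\<^sup>2)" by (intro Bochner_Integration.integral_nonneg) auto
  have B: "1 \<le> B" using nn by (simp add: B_def)
  have "expectation (\<lambda>\<omega>. (v \<omega>)\<^sup>2) = (sqrt (expectation (\<lambda>\<omega>. (v \<omega>)\<^sup>2)))\<^sup>2" using nn by simp
  also have "\<dots> \<le> B\<^sup>2" using nn by (intro power_mono) (auto simp: B_def)
  finally have B2: "expectation (\<lambda>\<omega>. (v \<omega>)\<^sup>2) \<le> B\<^sup>2" .
  define r where "r = min 1 (e / (12 * B))"
  have r: "0 < r" "r \<le> 1" "r \<le> e / (12 * B)" using e B by (auto simp: r_def)
  obtain n0 where n0: "\<forall>n\<ge>n0. expectation (\<lambda>\<omega>. (u n \<omega> - v \<omega>)\<^sup>2) \<le> r\<^sup>2" using conv[of "r\<^sup>2"] r(1) by auto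
  show "\<exists>no. \<forall>n\<ge>no. norm (variance (u n) - variance v) < e"
  proof (intro exI[of _ "Suc n0"] allI impI)
    fix n assume "Suc n0 \<le> n"
    then have n: "0 < n" "n0 \<le> n" by auto
    have "\<bar>variance (u n) - variance v\<bar> \<le> 2 * r * (r + 2 * B)"
      using n0 n B B2 r by (intro variance_diff_le m i) auto
    also have "\<dots> \<le> 2 * r * (3 * B)" using r B by (intro mult_left_mono) auto
    also have "\<dots> \<le> 2 * (e / (12 * B)) * (3 * B)" using r B by (intro mult_right_mono mult_left_mono) auto
    also have "\<dots> = e / 2" using B by (simp add: field_simps)
    also have "\<dots> < e" using e by simp
    finally show "norm (variance (u n) - variance v) < e" by simp
  qed
qed

lemma variance_convergent:
  fixes u :: "nat \<Rightarrow> 'a \<Rightarrow> real"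
  assumes m: "\<And>n. 0 < n \<Longrightarrow> u n \<in> borel_measurable M"
    and i: "\<And>n. 0 < n \<Longrightarrow> integrable M (\<lambda>\<omega>. (u n \<omega>)\<^sup>2)"
    and conv: "\<And>\<epsilon>. 0 < \<epsilon> \<Longrightarrow> \<exists>n0. \<forall>n\<ge>n0. \<forall>n'\<ge>n0. expectation (\<lambda>\<omega>. (u n \<omega> - u n' \<omega>)\<^sup>2) \<le> \<epsilon>"
  shows "convergent (\<lambda>n. variance (u n))"
proof -
  obtain n1 where n1: "\<forall>n\<ge>n1. \<forall>n'\<ge>n1. expectation (\<lambda>\<omega>. (u n \<omega> - u n' \<omega>)\<^sup>2) \<le> 1" using conv[of 1] by auto
  define N where "N = Suc n1"
  define S where "S = expectation (\<lambda>\<omega>. (u N \<omega>)\<^sup>2)"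
  have S0: "0 \<le> S" unfolding S_def by (intro Bochner_Integration.integral_nonneg) auto
  define B where "B = sqrt (2 + 2 * S) + 1"
  have B: "1 \<le> B" using S0 by (simp add: B_def)
  have B2: "expectation (\<lambda>\<omega>. (u n \<omega>)\<^sup>2) \<le> B\<^sup>2" if "N \<le> n" for n
  proof -
    have n: "0 < n" "n1 \<le> n" and N: "0 < N" "n1 \<le> N" using that by (auto simp: N_def)
    have id: "integrable M (\<lambda>\<omega>. (u n \<omega> - u N \<omega>)\<^sup>2)" by (rule variance_extrapolation(1)[OF m[OF n(1)] m[OF N(1)] i[OF n(1)] i[OF N(1)]])
    have "expectation (\<lambda>\<omega>. (u n \<omega>)\<^sup>2) \<le> expectation (\<lambda>\<omega>. 2 * (u n \<omega> - u N \<omega>)\<^sup>2 + 2 * (u N \<omega>)\<^sup>2)"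
    proof (rule integral_mono)
      show "(u n \<omega>)\<^sup>2 \<le> 2 * (u n \<omega> - u N \<omega>)\<^sup>2 + 2 * (u N \<omega>)\<^sup>2" for \<omega>
        using norm_add_sq_le[of "u n \<omega> - u N \<omega>" "u N \<omega>"] by simp
    qed (use id i[OF n(1)] i[OF N(1)] in auto)
    also have "\<dots> = 2 * expectation (\<lambda>\<omega>. (u n \<omega> - u N \<omega>)\<^sup>2) + 2 * S" using id i[OF N(1)] by (simp add: S_def)
    also have "\<dots> \<le> 2 + 2 * S" using n1 n(2) N(2) by auto
    also have "\<dots> = (sqrt (2 + 2 * S))\<^sup>2" using S0 by simp
    also have "\<dots> \<le> B\<^sup>2" using S0 by (intro power_mono) (auto simp: B_def)
    finally show ?thesis .
  qed
  have "Cauchy (\<lambda>n. variance (u n))"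
  proof (rule CauchyI)
    fix e :: real assume e: "0 < e"
    define r where "r = min 1 (e / (12 * B))"
    have r: "0 < r" "r \<le> 1" "r \<le> e / (12 * B)" using e B by (auto simp: r_def)
    obtain n0 where n0: "\<forall>n\<ge>n0. \<forall>n'\<ge>n0. expectation (\<lambda>\<omega>. (u n \<omega> - u n' \<omega>)\<^sup>2) \<le> r\<^sup>2" using conv[of "r\<^sup>2"] r(1) by auto
    show "\<exists>no. \<forall>k\<ge>no. \<forall>n\<ge>no. norm (variance (u k) - variance (u n)) < e"
    proof (intro exI[of _ "max N n0"] allI impI)
      fix k n assume "max N n0 \<le> k" "max N n0 \<le> n"
      then have k: "0 < k" "n0 \<le> k" and n: "0 < n" "n0 \<le> n" "N \<le> n" by (auto simp: N_def)
      have "\<bar>variance (u k) - variance (u n)\<bar> \<le> 2 * r * (r + 2 * B)"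
        using n0 k n B B2[OF n(3)] r by (intro variance_diff_le m i) auto
      also have "\<dots> \<le> 2 * r * (3 * B)" using r B by (intro mult_left_mono) auto
      also have "\<dots> \<le> 2 * (e / (12 * B)) * (3 * B)" using r B by (intro mult_right_mono mult_left_mono) auto
      also have "\<dots> = e / 2" using B by (simp add: field_simps)
      also have "\<dots> < e" using e by simp
      finally show "norm (variance (u k) - variance (u n)) < e" by simp
    qed
  qed
  then show ?thesis by (simp add: Cauchy_convergent_iff)
qed

lemma expectation_tendsto:
  fixes u :: "nat \<Rightarrow> 'a \<Rightarrow> real"
  assumes m: "\<And>n. 0 < n \<Longrightarrow> u n \<in> borel_measurable M" "v \<in> borel_measurable M"
    and i: "\<And>n. 0 < n \<Longrightarrow> integrable M (\<lambda>\<omega>. (u n \<omega>)\<^sup>2)" "integrable M (\<lambda>\<omega>. (v \<omega>)\<^sup>2)"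
    and conv: "\<And>\<epsilon>. 0 < \<epsilon> \<Longrightarrow> \<exists>n0. \<forall>n\<ge>n0. expectation (\<lambda>\<omega>. (u n \<omega> - v \<omega>)\<^sup>2) \<le> \<epsilon>"
  shows "(\<lambda>n. expectation (u n)) \<longlonglongrightarrow> expectation v"
proof (rule LIMSEQ_I)
  fix e :: real assume e: "0 < e"
  obtain n0 where n0: "\<forall>n\<ge>n0. expectation (\<lambda>\<omega>. (u n \<omega> - v \<omega>)\<^sup>2) \<le> (e / 2)\<^sup>2" using conv[of "(e / 2)\<^sup>2"] e by auto
  show "\<exists>no. \<forall>n\<ge>no. norm (expectation (u n) - expectation v) < e"
  proof (intro exI[of _ "Suc n0"] allI impI)
    fix n assume "Suc n0 \<le> n"
    then have n: "0 < n" "n0 \<le> n" by auto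
    note id = variance_extrapolation(1)[OF m(1)[OF n(1)] m(2) i(1)[OF n(1)] i(2)]
    have "\<bar>expectation (\<lambda>\<omega>. u n \<omega> - v \<omega>)\<bar> \<le> e / 2"
      using m(1)[OF n(1)] m(2) n0 n e by (intro expectation_abs_le id) auto
    moreover have "expectation (\<lambda>\<omega>. u n \<omega> - v \<omega>) = expectation (u n) - expectation v"
      using square_integrable_imp_integrable[OF m(1)[OF n(1)] i(1)[OF n(1)]] square_integrable_imp_integrable[OF m(2) i(2)] by simp
    ultimately show "norm (expectation (u n) - expectation v) < e" using e by simp
  qed
qed

end

lemma brownian_sde_standard_BM:
  assumes "lipschitz_sde T b \<sigma> K" "prob_space N" "standard_BM N B"
  shows "brownian_sde T b \<sigma> K N (augmented_filtration N B) B"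
  by (intro brownian_sde.intro assms standard_BM_brownian_filtration)

lemma euler_solution_strong_solution:
  assumes "lipschitz_sde T b \<sigma> K" "prob_space M" "standard_BM M W" "strong_solution T b \<sigma> x M W X"
  shows "euler_solution T b \<sigma> x K M (augmented_filtration M W) W X"
  using assms(4)
  by (intro euler_solution.intro brownian_sde_standard_BM assms euler_solution_axioms.intro) (auto simp: strong_solution_def)

lemma euler_variance_eq:
  fixes W :: "real \<Rightarrow> 'w \<Rightarrow> real ^ 'q" and B :: "real \<Rightarrow> 'v \<Rightarrow> real ^ 'q" and f :: "real ^ 'd \<Rightarrow> real"
  assumes M: "brownian_sde T b \<sigma> K M F W" and N: "brownian_sde T b \<sigma> K N G B" and f: "continuous_on UNIV f"
  shows "prob_space.variance M (\<lambda>\<omega>. f (euler T b \<sigma> x W n n \<omega>)) = prob_space.variance N (\<lambda>\<omega>. f (euler T b \<sigma> x B n n \<omega>))"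
proof -
  have fm [measurable]: "f \<in> borel_measurable borel" by (rule borel_measurable_continuous_onI[OF f])
  have "(\<integral>\<omega>. f (euler T b \<sigma> x W n n \<omega>) \<partial>M) = (\<integral>\<omega>. f (euler T b \<sigma> x B n n \<omega>) \<partial>N)"
    by (rule euler_terminal_expectation_eq[OF M N fm])
  moreover have "(\<integral>\<omega>. (f (euler T b \<sigma> x W n n \<omega>) - c)\<^sup>2 \<partial>M) = (\<integral>\<omega>. (f (euler T b \<sigma> x B n n \<omega>) - c)\<^sup>2 \<partial>N)" for c
    by (rule euler_terminal_expectation_eq[OF M N, where g = "\<lambda>y. (f y - c)\<^sup>2"]) measurable
  ultimately show ?thesis by simp
qed

text \<open>Convergence follows from the Cauchy property alone, so that it holds for competing pairs. The lower
  bound drops the nonnegative term \<open>2 * Var (a - c)\<close> of \<open>variance_extrapolation\<close>.\<close>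

lemma richardson_variance_convergent:
  assumes B1: "brownian_sde T b \<sigma> K N G1 B1" and B2: "brownian_sde T b \<sigma> K N G2 B2"
    and f: "continuous_on UNIV f" "linear_growth f"
    and v: "(\<lambda>n. prob_space.variance N (\<lambda>\<omega>. f (euler T b \<sigma> x B1 n n \<omega>))) \<longlonglongrightarrow> v"
      "(\<lambda>n. prob_space.variance N (\<lambda>\<omega>. f (euler T b \<sigma> x B2 n n \<omega>))) \<longlonglongrightarrow> v"
  shows "richardson_variance T b \<sigma> x f N B1 B2 \<longlonglongrightarrow> asymptotic_variance T b \<sigma> x f N B1 B2"
    "v \<le> asymptotic_variance T b \<sigma> x f N B1 B2"
proof -
  interpret P1: brownian_sde T b \<sigma> x K N G1 B1 by fact
  interpret P2: brownian_sde T b \<sigma> x K N G2 B2 by fact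
  let ?c = "\<lambda>n \<omega>. f (euler T b \<sigma> x B1 n n \<omega>)" and ?a = "\<lambda>n \<omega>. f (euler T b \<sigma> x B2 (2 * n) (2 * n) \<omega>)"
  have rv: "richardson_variance T b \<sigma> x f N B1 B2 n = P1.variance (\<lambda>\<omega>. 2 * ?a n \<omega> - ?c n \<omega>)" for n
    by (simp add: richardson_variance_def euler_terminal_def)
  note c = P1.test_function_L2[OF f]
  have a: "?a n \<in> borel_measurable N" "integrable N (\<lambda>\<omega>. (?a n \<omega>)\<^sup>2)" if "0 < n" for n
    using P2.test_function_L2[OF f, of "2 * n"] that by auto
  note ext = P1.variance_extrapolation[OF a(1) c(1) a(2) c(2)]
  have "convergent (\<lambda>n. P1.variance (\<lambda>\<omega>. 2 * ?a n \<omega> - ?c n \<omega>))"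
  proof (rule P1.variance_convergent)
    show "(\<lambda>\<omega>. 2 * ?a n \<omega> - ?c n \<omega>) \<in> borel_measurable N" if "0 < n" for n using a(1)[OF that] c(1)[OF that] by measurable
    show "integrable N (\<lambda>\<omega>. (2 * ?a n \<omega> - ?c n \<omega>)\<^sup>2)" if "0 < n" for n using ext(2) that by blast
    fix \<epsilon> :: real assume "0 < \<epsilon>"
    then have e: "0 < \<epsilon> / 4" "0 < \<epsilon> / 16" by auto
    obtain n1 where n1: "0 < n1" "\<And>n n'. n1 \<le> n \<Longrightarrow> n1 \<le> n' \<Longrightarrow> integrable N (\<lambda>\<omega>. (?c n \<omega> - ?c n' \<omega>)\<^sup>2)"
      "\<And>n n'. n1 \<le> n \<Longrightarrow> n1 \<le> n' \<Longrightarrow> P1.expectation (\<lambda>\<omega>. (?c n \<omega> - ?c n' \<omega>)\<^sup>2) \<le> \<epsilon> / 4"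
      using P1.test_function_cauchy_L2[OF f e(1)] by blast
    obtain n2 where n2: "0 < n2" "\<And>n n'. n2 \<le> n \<Longrightarrow> n2 \<le> n' \<Longrightarrow> integrable N (\<lambda>\<omega>. (f (euler T b \<sigma> x B2 n n \<omega>) - f (euler T b \<sigma> x B2 n' n' \<omega>))\<^sup>2)"
      "\<And>n n'. n2 \<le> n \<Longrightarrow> n2 \<le> n' \<Longrightarrow> P1.expectation (\<lambda>\<omega>. (f (euler T b \<sigma> x B2 n n \<omega>) - f (euler T b \<sigma> x B2 n' n' \<omega>))\<^sup>2) \<le> \<epsilon> / 16"
      using P2.test_function_cauchy_L2[OF f e(2)] by blast
    show "\<exists>n0. \<forall>n\<ge>n0. \<forall>n'\<ge>n0. P1.expectation (\<lambda>\<omega>. ((2 * ?a n \<omega> - ?c n \<omega>) - (2 * ?a n' \<omega> - ?c n' \<omega>))\<^sup>2) \<le> \<epsilon>"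
    proof (intro exI[of _ "max n1 n2"] allI impI)
      fix n n' assume "max n1 n2 \<le> n" "max n1 n2 \<le> n'"
      then have n: "n1 \<le> n" "n1 \<le> n'" "n2 \<le> 2 * n" "n2 \<le> 2 * n'" and pos: "0 < n" "0 < n'" using n1(1) by auto
      have "P1.expectation (\<lambda>\<omega>. ((2 * ?a n \<omega> - ?c n \<omega>) - (2 * ?a n' \<omega> - ?c n' \<omega>))\<^sup>2)
        \<le> 8 * P1.expectation (\<lambda>\<omega>. (?a n \<omega> - ?a n' \<omega>)\<^sup>2) + 2 * P1.expectation (\<lambda>\<omega>. (?c n \<omega> - ?c n' \<omega>)\<^sup>2)"
        by (rule P1.extrapolation_L2_diff_le[OF a(1)[OF pos(1)] a(1)[OF pos(2)] c(1)[OF pos(1)] c(1)[OF pos(2)]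
          n2(2)[OF n(3,4)] n1(2)[OF n(1,2)]])
      also have "\<dots> \<le> \<epsilon>" using n1(3)[OF n(1,2)] n2(3)[OF n(3,4)] by linarith
      finally show "P1.expectation (\<lambda>\<omega>. ((2 * ?a n \<omega> - ?c n \<omega>) - (2 * ?a n' \<omega> - ?c n' \<omega>))\<^sup>2) \<le> \<epsilon>" .
    qed
  qed
  then show lim: "richardson_variance T b \<sigma> x f N B1 B2 \<longlonglongrightarrow> asymptotic_variance T b \<sigma> x f N B1 B2"
    unfolding asymptotic_variance_def rv[symmetric] convergent_LIMSEQ_iff by simp
  have "(\<lambda>n. 2 * P1.variance (?a n) - P1.variance (?c n)) \<longlonglongrightarrow> 2 * v - v"
  proof (intro tendsto_intros v(1))
    show "(\<lambda>n. P1.variance (?a n)) \<longlonglongrightarrow> v"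
      using LIMSEQ_subseq_LIMSEQ[OF v(2), of "\<lambda>n. 2 * n"] by (simp add: comp_def strict_mono_def)
  qed
  moreover have "\<forall>n\<ge>1. 2 * P1.variance (?a n) - P1.variance (?c n) \<le> richardson_variance T b \<sigma> x f N B1 B2 n"
  proof (intro allI impI)
    fix n :: nat assume "1 \<le> n"
    then have "0 < n" by simp
    then show "2 * P1.variance (?a n) - P1.variance (?c n) \<le> richardson_variance T b \<sigma> x f N B1 B2 n"
      unfolding rv using ext(3)[of n n] P1.variance_positive[of "\<lambda>\<omega>. ?a n \<omega> - ?c n \<omega>"] by simp
  qed
  ultimately have "2 * v - v \<le> asymptotic_variance T b \<sigma> x f N B1 B2" using lim by (intro LIMSEQ_le) blast+
  then show "v \<le> asymptotic_variance T b \<sigma> x f N B1 B2" by simp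
qed

lemma richardson_variance_same:
  assumes W: "brownian_sde T b \<sigma> K M F W"
    and f: "continuous_on UNIV f" "linear_growth f"
    and v: "(\<lambda>n. prob_space.variance M (\<lambda>\<omega>. f (euler T b \<sigma> x W n n \<omega>))) \<longlonglongrightarrow> v"
  shows "asymptotic_variance T b \<sigma> x f M W W = v"
proof -
  interpret brownian_sde T b \<sigma> x K M F W by fact
  let ?c = "\<lambda>n \<omega>. f (E n n \<omega>)"
  note c = test_function_L2[OF f]
  have ext: "richardson_variance T b \<sigma> x f M W W n = 2 * variance (?c (2 * n)) - variance (?c n) + 2 * variance (\<lambda>\<omega>. ?c (2 * n) \<omega> - ?c n \<omega>)"
    if "0 < n" for n
    using variance_extrapolation(3)[OF c(1) c(1) c(2) c(2), of "2 * n" n] that by (simp add: richardson_variance_def euler_terminal_def)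
  have d0: "(\<lambda>n. variance (\<lambda>\<omega>. ?c (2 * n) \<omega> - ?c n \<omega>)) \<longlonglongrightarrow> variance (\<lambda>\<omega>. 0)"
  proof (rule variance_tendsto)
    fix n :: nat assume n: "0 < n"
    then have n2: "0 < 2 * n" by simp
    show "(\<lambda>\<omega>. ?c (2 * n) \<omega> - ?c n \<omega>) \<in> borel_measurable M" using c(1)[OF n] c(1)[OF n2] by measurable
    show "integrable M (\<lambda>\<omega>. (?c (2 * n) \<omega> - ?c n \<omega>)\<^sup>2)" by (rule variance_extrapolation(1)[OF c(1)[OF n2] c(1)[OF n] c(2)[OF n2] c(2)[OF n]])
  next
    fix \<epsilon> :: real assume "0 < \<epsilon>"
    then obtain n0 where "\<forall>n\<ge>n0. \<forall>n'\<ge>n0. expectation (\<lambda>\<omega>. (?c n \<omega> - ?c n' \<omega>)\<^sup>2) \<le> \<epsilon>"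
      using test_function_cauchy_L2[OF f] by blast
    then show "\<exists>n0. \<forall>n\<ge>n0. expectation (\<lambda>\<omega>. (?c (2 * n) \<omega> - ?c n \<omega> - 0)\<^sup>2) \<le> \<epsilon>"
      by (intro exI[of _ n0]) auto
  qed simp_all
  have v2: "(\<lambda>n. variance (?c (2 * n))) \<longlonglongrightarrow> v"
    using LIMSEQ_subseq_LIMSEQ[OF v, of "\<lambda>n. 2 * n"] by (simp add: comp_def strict_mono_def)
  have "(\<lambda>n. 2 * variance (?c (2 * n)) - variance (?c n) + 2 * variance (\<lambda>\<omega>. ?c (2 * n) \<omega> - ?c n \<omega>)) \<longlonglongrightarrow> 2 * v - v + 2 * variance (\<lambda>\<omega>. 0)"
    by (intro tendsto_intros v v2 d0)
  then have "richardson_variance T b \<sigma> x f M W W \<longlonglongrightarrow> 2 * v - v + 2 * variance (\<lambda>\<omega>. 0)"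
    by (rule Lim_transform_eventually) (use ext in \<open>auto intro!: eventually_sequentiallyI[of 1]\<close>)
  then show ?thesis unfolding asymptotic_variance_def by (simp add: limI)
qed

lemma (in euler_solution) solution_test_function:
  assumes f: "continuous_on UNIV f" "linear_growth f"
  shows "(\<lambda>\<omega>. f (X T \<omega>)) \<in> borel_measurable M" "integrable M (\<lambda>\<omega>. (f (X T \<omega>))\<^sup>2)"
proof -
  have TT: "T \<in> {0..T}" using T_pos by simp
  note [measurable] = borel_measurable_continuous_onI[OF f(1)] X_measurable[OF TT]
  show m: "(\<lambda>\<omega>. f (X T \<omega>)) \<in> borel_measurable M" by measurable
  obtain n where n: "0 < n" "integrable M (\<lambda>\<omega>. (f (E n n \<omega>) - f (X T \<omega>))\<^sup>2)"
    using test_function_converges_L2[OF f, of 1] by auto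
  show "integrable M (\<lambda>\<omega>. (f (X T \<omega>))\<^sup>2)"
    using square_integrable_diff[of M "\<lambda>\<omega>. f (E n n \<omega>)" "\<lambda>\<omega>. f (E n n \<omega>) - f (X T \<omega>)"]
      test_function_L2(2)[OF f n(1)] n(2) by simp
qed

lemma (in euler_solution) solution_limits:
  assumes f: "continuous_on UNIV f" "linear_growth f"
  shows "(\<lambda>n. variance (\<lambda>\<omega>. f (E n n \<omega>))) \<longlonglongrightarrow> variance (\<lambda>\<omega>. f (X T \<omega>))"
    "(\<lambda>n. expectation (\<lambda>\<omega>. f (E n n \<omega>))) \<longlonglongrightarrow> expectation (\<lambda>\<omega>. f (X T \<omega>))"
proof -
  have conv: "\<exists>n0. \<forall>n\<ge>n0. expectation (\<lambda>\<omega>. (f (E n n \<omega>) - f (X T \<omega>))\<^sup>2) \<le> \<epsilon>" if "0 < \<epsilon>" for \<epsilon>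
    using test_function_converges_L2[OF f that] by blast
  show "(\<lambda>n. variance (\<lambda>\<omega>. f (E n n \<omega>))) \<longlonglongrightarrow> variance (\<lambda>\<omega>. f (X T \<omega>))"
    by (rule variance_tendsto[OF test_function_L2(1)[OF f] solution_test_function(1)[OF f] test_function_L2(2)[OF f] solution_test_function(2)[OF f] conv])
  show "(\<lambda>n. expectation (\<lambda>\<omega>. f (E n n \<omega>))) \<longlonglongrightarrow> expectation (\<lambda>\<omega>. f (X T \<omega>))"
    by (rule expectation_tendsto[OF test_function_L2(1)[OF f] solution_test_function(1)[OF f] test_function_L2(2)[OF f] solution_test_function(2)[OF f] conv])
qed

lemma richardson_variance_limit:
  assumes S1: "euler_solution T b \<sigma> x K M F1 W1 X1" and S2: "euler_solution T b \<sigma> x K M F2 W2 X2"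
    and f: "continuous_on UNIV f" "linear_growth f"
  shows "richardson_variance T b \<sigma> x f M W1 W2 \<longlonglongrightarrow> prob_space.variance M (\<lambda>\<omega>. 2 * f (X2 T \<omega>) - f (X1 T \<omega>))"
proof -
  interpret P1: euler_solution T b \<sigma> x K M F1 W1 X1 by fact
  interpret P2: euler_solution T b \<sigma> x K M F2 W2 X2 by fact
  let ?c = "\<lambda>n \<omega>. f (euler T b \<sigma> x W1 n n \<omega>)" and ?a = "\<lambda>n \<omega>. f (euler T b \<sigma> x W2 (2 * n) (2 * n) \<omega>)"
  have rv: "richardson_variance T b \<sigma> x f M W1 W2 = (\<lambda>n. P1.variance (\<lambda>\<omega>. 2 * ?a n \<omega> - ?c n \<omega>))"
    by (simp add: fun_eq_iff richardson_variance_def euler_terminal_def)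
  note c = P1.test_function_L2[OF f]
  have a: "?a n \<in> borel_measurable M" "integrable M (\<lambda>\<omega>. (?a n \<omega>)\<^sup>2)" if "0 < n" for n
    using P2.test_function_L2[OF f, of "2 * n"] that by auto
  note x1 = P1.solution_test_function[OF f] and x2 = P2.solution_test_function[OF f]
  show ?thesis
    unfolding rv
  proof (rule P1.variance_tendsto)
    show "(\<lambda>\<omega>. 2 * ?a n \<omega> - ?c n \<omega>) \<in> borel_measurable M" if "0 < n" for n using a(1)[OF that] c(1)[OF that] by measurable
    show "(\<lambda>\<omega>. 2 * f (X2 T \<omega>) - f (X1 T \<omega>)) \<in> borel_measurable M" using x1(1) x2(1) by measurable
    show "integrable M (\<lambda>\<omega>. (2 * ?a n \<omega> - ?c n \<omega>)\<^sup>2)" if "0 < n" for n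
      by (rule P1.variance_extrapolation(2)[OF a(1)[OF that] c(1)[OF that] a(2)[OF that] c(2)[OF that]])
    show "integrable M (\<lambda>\<omega>. (2 * f (X2 T \<omega>) - f (X1 T \<omega>))\<^sup>2)"
      by (rule P1.variance_extrapolation(2)[OF x2(1) x1(1) x2(2) x1(2)])
    fix \<epsilon> :: real assume "0 < \<epsilon>"
    then have e: "0 < \<epsilon> / 4" "0 < \<epsilon> / 16" by auto
    obtain n1 where n1: "0 < n1" "\<And>n. n1 \<le> n \<Longrightarrow> integrable M (\<lambda>\<omega>. (?c n \<omega> - f (X1 T \<omega>))\<^sup>2)"
      "\<And>n. n1 \<le> n \<Longrightarrow> P1.expectation (\<lambda>\<omega>. (?c n \<omega> - f (X1 T \<omega>))\<^sup>2) \<le> \<epsilon> / 4"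
      using P1.test_function_converges_L2[OF f e(1)] by blast
    obtain n2 where n2: "0 < n2" "\<And>n. n2 \<le> n \<Longrightarrow> integrable M (\<lambda>\<omega>. (f (euler T b \<sigma> x W2 n n \<omega>) - f (X2 T \<omega>))\<^sup>2)"
      "\<And>n. n2 \<le> n \<Longrightarrow> P1.expectation (\<lambda>\<omega>. (f (euler T b \<sigma> x W2 n n \<omega>) - f (X2 T \<omega>))\<^sup>2) \<le> \<epsilon> / 16"
      using P2.test_function_converges_L2[OF f e(2)] by blast
    show "\<exists>n0. \<forall>n\<ge>n0. P1.expectation (\<lambda>\<omega>. ((2 * ?a n \<omega> - ?c n \<omega>) - (2 * f (X2 T \<omega>) - f (X1 T \<omega>)))\<^sup>2) \<le> \<epsilon>"
    proof (intro exI[of _ "max n1 n2"] allI impI)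
      fix n assume "max n1 n2 \<le> n"
      then have n: "n1 \<le> n" "n2 \<le> 2 * n" and pos: "0 < n" using n1(1) by auto
      have "P1.expectation (\<lambda>\<omega>. ((2 * ?a n \<omega> - ?c n \<omega>) - (2 * f (X2 T \<omega>) - f (X1 T \<omega>)))\<^sup>2)
        \<le> 8 * P1.expectation (\<lambda>\<omega>. (?a n \<omega> - f (X2 T \<omega>))\<^sup>2) + 2 * P1.expectation (\<lambda>\<omega>. (?c n \<omega> - f (X1 T \<omega>))\<^sup>2)"
        by (rule P1.extrapolation_L2_diff_le[OF a(1)[OF pos] x2(1) c(1)[OF pos] x1(1) n2(2)[OF n(2)] n1(2)[OF n(1)]])
      also have "\<dots> \<le> \<epsilon>" using n1(3)[OF n(1)] n2(3)[OF n(2)] by linarith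
      finally show "P1.expectation (\<lambda>\<omega>. ((2 * ?a n \<omega> - ?c n \<omega>) - (2 * f (X2 T \<omega>) - f (X1 T \<omega>)))\<^sup>2) \<le> \<epsilon>" .
    qed
  qed
qed

lemma solution_variance_le:
  fixes W :: "real \<Rightarrow> 'w \<Rightarrow> real ^ 'q" and C1 C2 :: "real \<Rightarrow> 'v \<Rightarrow> real ^ 'q" and f :: "real ^ 'd \<Rightarrow> real"
  assumes lip: "lipschitz_sde T b \<sigma> K" and S: "euler_solution T b \<sigma> x K M F W X"
    and N: "prob_space N" "standard_BM N C1" "standard_BM N C2"
    and f: "continuous_on UNIV f" "linear_growth f"
  shows "prob_space.variance M (\<lambda>\<omega>. f (X T \<omega>)) \<le> asymptotic_variance T b \<sigma> x f N C1 C2"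
proof -
  interpret euler_solution T b \<sigma> x K M F W X by fact
  note C1 = brownian_sde_standard_BM[OF lip N(1,2)] and C2 = brownian_sde_standard_BM[OF lip N(1,3)]
  show ?thesis
    using solution_limits(1)[OF f] euler_variance_eq[OF brownian_sde_axioms C1 f(1), of x]
      euler_variance_eq[OF brownian_sde_axioms C2 f(1), of x]
    by (intro richardson_variance_convergent(2)[OF C1 C2 f]) simp_all
qed

text \<open>The characterizing property is stated on the type of pairs; the joint law of \<open>Y\<close> and \<open>Z\<close> with
  the coordinate maps transports it to the given space.\<close>

lemma (in prob_space) characterizing_AE_eq:
  fixes V :: "(real ^ 'd \<Rightarrow> real) set" and Y Z :: "'a \<Rightarrow> real ^ 'd"
  assumes V: "characterizing_as_equality V" and [measurable]: "Y \<in> borel_measurable M" "Z \<in> borel_measurable M"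
    and cont: "\<And>f. f \<in> V \<Longrightarrow> continuous_on UNIV f"
    and eq: "\<And>f. f \<in> V \<Longrightarrow> AE \<omega> in M. f (Y \<omega>) = f (Z \<omega>)"
  shows "AE \<omega> in M. Y \<omega> = Z \<omega>"
proof -
  have pm: "(\<lambda>\<omega>. (Y \<omega>, Z \<omega>)) \<in> measurable M (borel \<Otimes>\<^sub>M borel)" by measurable
  define N where "N = distr M (borel \<Otimes>\<^sub>M borel) (\<lambda>\<omega>. (Y \<omega>, Z \<omega>))"
  have "prob_space N" unfolding N_def by (rule prob_space_distr[OF pm])
  moreover have "fst \<in> borel_measurable N" "snd \<in> borel_measurable N" unfolding N_def by simp_all
  moreover have "\<forall>f\<in>V. AE p in N. f (fst p) = f (snd p)"
  proof
    fix f assume f: "f \<in> V"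
    have [measurable]: "f \<in> borel_measurable borel" by (rule borel_measurable_continuous_onI[OF cont[OF f]])
    have "{p \<in> space (borel \<Otimes>\<^sub>M borel). f (fst p) = f (snd p)} \<in> sets (borel \<Otimes>\<^sub>M borel)" by measurable
    from AE_distr_iff[OF pm this] show "AE p in N. f (fst p) = f (snd p)"
      unfolding N_def using eq[OF f] by simp
  qed
  ultimately have "AE p in N. fst p = snd p" using V unfolding characterizing_as_equality_def by blast
  moreover have "{p \<in> space (borel \<Otimes>\<^sub>M borel). fst p = (snd p :: real ^ 'd)} \<in> sets (borel \<Otimes>\<^sub>M borel)" by measurable
  ultimately show ?thesis unfolding N_def using AE_distr_iff[OF pm] by simp
qed

theorem mainTheorem1:
  fixes T :: real and x :: "real ^ 'd"
    and b :: "real \<Rightarrow> real ^ 'd \<Rightarrow> real ^ 'd"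
    and \<sigma> :: "real \<Rightarrow> real ^ 'd \<Rightarrow> real ^ 'q ^ 'd"
    and V :: "(real ^ 'd \<Rightarrow> real) set"
    and M :: "'w measure"
    and W1 W2 :: "real \<Rightarrow> 'w \<Rightarrow> real ^ 'q"
    and X1 X2 :: "real \<Rightarrow> 'w \<Rightarrow> real ^ 'd"
  assumes "T > 0"
    and "sde_coefficients T b \<sigma>"
    and "prob_space M"
    and "standard_BM M W1" and "standard_BM M W2"
    and "strong_solution T b \<sigma> x M W1 X1" and "strong_solution T b \<sigma> x M W2 X2"
    and "function_subspace V"
    and "\<And>f. f \<in> V \<Longrightarrow> continuous_on UNIV f \<and> linear_growth f"
    and "weak_error_expansion2 T b \<sigma> x M W1 X1 V"
    and "characterizing_as_equality V"
  shows "(\<forall>f\<in>V. richardson_variance T b \<sigma> x f M W1 W2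
            \<longlonglongrightarrow> prob_space.variance M (\<lambda>\<omega>. 2 * f (X2 T \<omega>) - f (X1 T \<omega>)))
       \<and> ((\<forall>f\<in>V. minimizes_asymptotic_variance T b \<sigma> x f M W1 W2 M)
            \<longleftrightarrow> (AE \<omega> in M. X2 T \<omega> = X1 T \<omega>))
       \<and> ((AE \<omega> in M. X2 T \<omega> = X1 T \<omega>)
            \<longrightarrow> (\<forall>f\<in>V. \<forall>N :: 'v measure. prob_space N
                  \<longrightarrow> minimizes_asymptotic_variance T b \<sigma> x f M W1 W2 N))
       \<and> (\<forall>f\<in>V. minimizes_asymptotic_variance T b \<sigma> x f M W1 W1 M)
       \<and> (\<forall>f\<in>V. \<forall>N :: 'v measure. prob_space N
            \<longrightarrow> minimizes_asymptotic_variance T b \<sigma> x f M W1 W1 N)"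
proof -
  obtain K where lip: "lipschitz_sde T b \<sigma> K" using lipschitz_sde_exists[OF assms(1,2)] by blast
  note V = assms(9)[THEN conjunct1] assms(9)[THEN conjunct2]
  note S1 = euler_solution_strong_solution[OF lip assms(3,4,6)]
  note S2 = euler_solution_strong_solution[OF lip assms(3,5,7)]
  interpret P1: euler_solution T b \<sigma> x K M "augmented_filtration M W1" W1 X1 by (rule S1)
  interpret P2: euler_solution T b \<sigma> x K M "augmented_filtration M W2" W2 X2 by (rule S2)
  note B1 = P1.brownian_sde_axioms and B2 = P2.brownian_sde_axioms
  let ?v = "\<lambda>f. P1.variance (\<lambda>\<omega>. f (X1 T \<omega>))"
  note lower = solution_variance_le[OF lip S1 _ _ _ V]
  have same: "asymptotic_variance T b \<sigma> x f M W1 W1 = ?v f" if "f \<in> V" for f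
    by (rule richardson_variance_same[OF B1 V[OF that] P1.solution_limits(1)[OF V[OF that]]])
  have limit: "richardson_variance T b \<sigma> x f M W1 W2 \<longlonglongrightarrow> P1.variance (\<lambda>\<omega>. 2 * f (X2 T \<omega>) - f (X1 T \<omega>))" if "f \<in> V" for f
    by (rule richardson_variance_limit[OF S1 S2 V[OF that]])
  have asym: "asymptotic_variance T b \<sigma> x f M W1 W2 = ?v f + 2 * P1.variance (\<lambda>\<omega>. f (X2 T \<omega>) - f (X1 T \<omega>))" if f: "f \<in> V" for f
  proof -
    note x1 = P1.solution_test_function[OF V[OF f]] and x2 = P2.solution_test_function[OF V[OF f]]
    have "P1.variance (\<lambda>\<omega>. f (X2 T \<omega>)) = ?v f"
      using P1.solution_limits(1)[OF V[OF f]] P2.solution_limits(1)[OF V[OF f]] euler_variance_eq[OF B1 B2 V(1)[OF f], of x]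
      by (simp add: LIMSEQ_unique)
    then show ?thesis
      using limI[OF limit[OF f]] P1.variance_extrapolation(3)[OF x2(1) x1(1) x2(2) x1(2)]
      unfolding asymptotic_variance_def by simp
  qed
  have forward: "AE \<omega> in M. X2 T \<omega> = X1 T \<omega>" if min: "\<forall>f\<in>V. minimizes_asymptotic_variance T b \<sigma> x f M W1 W2 M"
  proof (rule P1.characterizing_AE_eq[OF assms(11)])
    have TT: "T \<in> {0..T}" using assms(1) by simp
    show "X2 T \<in> borel_measurable M" "X1 T \<in> borel_measurable M" using P1.X_measurable[OF TT] P2.X_measurable[OF TT] by auto
    show "continuous_on UNIV f" if "f \<in> V" for f by (rule V(1)[OF that])
    fix f assume f: "f \<in> V"
    note x1 = P1.solution_test_function[OF V[OF f]] and x2 = P2.solution_test_function[OF V[OF f]]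
    let ?d = "\<lambda>\<omega>. f (X2 T \<omega>) - f (X1 T \<omega>)"
    have d2: "integrable M (\<lambda>\<omega>. (?d \<omega>)\<^sup>2)" by (rule P1.variance_extrapolation(1)[OF x2(1) x1(1) x2(2) x1(2)])
    have i1: "integrable M (\<lambda>\<omega>. f (X1 T \<omega>))" "integrable M (\<lambda>\<omega>. f (X2 T \<omega>))"
      using P1.square_integrable_imp_integrable[OF x1] P1.square_integrable_imp_integrable[OF x2] by auto
    have "asymptotic_variance T b \<sigma> x f M W1 W2 \<le> asymptotic_variance T b \<sigma> x f M W1 W1"
      using min f assms(4) unfolding minimizes_asymptotic_variance_def by blast
    then have var: "P1.variance ?d \<le> 0" using asym[OF f] same[OF f] by simp
    have "P1.expectation (\<lambda>\<omega>. f (X1 T \<omega>)) = P1.expectation (\<lambda>\<omega>. f (X2 T \<omega>))"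
      using P1.solution_limits(2)[OF V[OF f]] P2.solution_limits(2)[OF V[OF f]]
        euler_terminal_expectation_eq[OF B1 B2 borel_measurable_continuous_onI[OF V(1)[OF f]], of x]
      by (simp add: LIMSEQ_unique)
    then have "P1.expectation ?d = 0" using i1 by simp
    then have "P1.expectation (\<lambda>\<omega>. (?d \<omega>)\<^sup>2) \<le> 0" using var by simp
    moreover have "0 \<le> P1.expectation (\<lambda>\<omega>. (?d \<omega>)\<^sup>2)" by (intro Bochner_Integration.integral_nonneg) auto
    ultimately have "P1.expectation (\<lambda>\<omega>. (?d \<omega>)\<^sup>2) = 0" by simp
    then have "AE \<omega> in M. (?d \<omega>)\<^sup>2 = 0" using integral_nonneg_eq_0_iff_AE[OF d2] by simp
    then show "AE \<omega> in M. f (X2 T \<omega>) = f (X1 T \<omega>)" by eventually_elim simp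
  qed
  have backward: "asymptotic_variance T b \<sigma> x f M W1 W2 = ?v f" if eq: "AE \<omega> in M. X2 T \<omega> = X1 T \<omega>" and f: "f \<in> V" for f
  proof -
    note x1 = P1.solution_test_function[OF V[OF f]] and x2 = P2.solution_test_function[OF V[OF f]]
    note [measurable] = x1(1) x2(1)
    let ?d = "\<lambda>\<omega>. f (X2 T \<omega>) - f (X1 T \<omega>)"
    have z: "AE \<omega> in M. ?d \<omega> = 0" using eq by eventually_elim simp
    have "P1.expectation ?d = 0" using integral_cong_AE[OF _ _ z] by simp
    moreover have "AE \<omega> in M. (?d \<omega> - 0)\<^sup>2 = 0" using z by eventually_elim simp
    then have "P1.expectation (\<lambda>\<omega>. (?d \<omega> - 0)\<^sup>2) = 0" using integral_cong_AE[of "\<lambda>\<omega>. (?d \<omega> - 0)\<^sup>2" M "\<lambda>_. 0"] by simp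
    ultimately have "P1.variance ?d = 0" by simp
    then show ?thesis using asym[OF f] by simp
  qed
  show ?thesis
  proof (intro conjI ballI impI allI iffI)
    show "richardson_variance T b \<sigma> x f M W1 W2 \<longlonglongrightarrow> P1.variance (\<lambda>\<omega>. 2 * f (X2 T \<omega>) - f (X1 T \<omega>))" if "f \<in> V" for f
      by (rule limit[OF that])
    show "AE \<omega> in M. X2 T \<omega> = X1 T \<omega>" if "\<forall>f\<in>V. minimizes_asymptotic_variance T b \<sigma> x f M W1 W2 M"
      by (rule forward[OF that])
    show "minimizes_asymptotic_variance T b \<sigma> x f M W1 W2 M" if "AE \<omega> in M. X2 T \<omega> = X1 T \<omega>" "f \<in> V" for f
      unfolding minimizes_asymptotic_variance_def backward[OF that] using lower[OF assms(3) _ _ that(2,2)] by blast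
    show "minimizes_asymptotic_variance T b \<sigma> x f M W1 W2 N"
      if "AE \<omega> in M. X2 T \<omega> = X1 T \<omega>" "f \<in> V" "prob_space N" for f and N :: "'v measure"
      unfolding minimizes_asymptotic_variance_def backward[OF that(1,2)] using lower[OF that(3) _ _ that(2,2)] by blast
    show "minimizes_asymptotic_variance T b \<sigma> x f M W1 W1 M" if "f \<in> V" for f
      unfolding minimizes_asymptotic_variance_def same[OF that] using lower[OF assms(3) _ _ that that] by blast
    show "minimizes_asymptotic_variance T b \<sigma> x f M W1 W1 N" if "f \<in> V" "prob_space N" for f and N :: "'v measure"
      unfolding minimizes_asymptotic_variance_def same[OF that(1)] using lower[OF that(2) _ _ that(1,1)] by blast
  qed
qed

end
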